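(* Let $\mathbf C$ and $\mathbf D$ be $2$-categories, and let $L\colon\mathbf C\to\mathbf D$ be a normal pseudo-functor. The following statements are equivalent. (i) The normal pseudo-functor $L\colon \mathbf C\to\mathbf D$ has a right bi-adjoint $R\colon\mathbf D\to\mathbf C$. (ii) For all objects $D\in\mathbf D$, there is an object $RD\in \mathbf C$ together with a morphism $\varepsilon_D\colon LRD\to D$ in $\mathbf D$ such that $(RD,\varepsilon_D)$ is double bi-terminal in the pseudo-slice double category $\mathbb HL\downarrow\downarrow D$. (iii) For all objects $D\in\mathbf D$, there is an object $RD\in \mathbf C$ together with a morphism $\varepsilon_D\colon LRD\to D$ in $\mathbf D$ such that $(RD,\varepsilon_D)$ is bi-terminal in the pseudo-slice $2$-category $L\downarrow D$ and $(RD,\mathrm{id}_{\varepsilon_D})$ is bi-terminal in the pseudo-slice $2$-category $\mathrm{Ar}_*L\downarrow D$. (iv) For all objects $D\in\mathbf D$, there is an object $RD\in \mathbf C$ together with a morphism $\varepsilon_D\colon LRD\to D$ in $\mathbf D$ such that $(RD,\mathrm{id}_{\varepsilon_D})$ is bi-terminal in $\mathrm{Ar}_*L\downarrow D$.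
   Context: **$2$-categories.** $\mathbf{Cat}$ is the $2$-category of categories, functors and natural transformations; $\mathbf C^{\mathrm{op}}$ reverses morphisms but not $2$-morphisms. A normal pseudo-functor $F\colon\mathbf A\to\mathbf B$ between (strict) $2$-categories consists of an assignment on objects, functors $\mathbf A(A,A')\to\mathbf B(FA,FA')$, and invertible compositors $\phi_{a,a'}\colon (Fa')(Fa)\Rightarrow F(a'a)$ satisfying the usual naturality, associativity and unit axioms, with all unitors identities (so $F\mathrm{id}_A=\mathrm{id}_{FA}$). **Bi-adjunction.** A bi-adjunction between $\mathbf C$ and $\mathbf D$ comprises normal pseudo-functors $L\colon\mathbf C\to\mathbf D$ and $R\colon\mathbf D\to\mathbf C$, and adjoint equivalences of categories $\Phi_{C,D}\colon\mathbf C(C,RD)\to\mathbf D(LC,D)$ pseudo-natural in $C\in\mathbf C^{\mathrm{op}}$ and $D\in\mathbf D$. In that case $R$ is called a right bi-adjoint of $L$. **Pseudo-slice $2$-category $L\downarrow D$** (for any normal pseudo-functor $L\colon\mathbf C\to\mathbf D$ and $D\in\mathbf D$): objects $(C,f\colon LC\to D)$; morphisms $(C,f)\to(C',f')$ pairs $(c,\psi)$ of $c\colon C\to C'$ and an invertible $\psi\colon f'(Lc)\Rightarrow f$ (composed using the compositors of $L$); $2$-morphisms $(c,\psi)\Rightarrow(d,\varphi)$ the $\beta\colon c\Rightarrow d$ with $\varphi\circ(f'\,L\beta)=\psi$. **$\mathrm{Ar}_*$.** For a $2$-category $\mathbf C$, $\mathrm{Ar}_*\mathbf C$ is the $2$-category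 with the same objects as $\mathbf C$ and hom-categories the arrow categories $\mathrm{Ar}_*\mathbf C(C,C')=\mathbf C(C,C')^{\mathbb 2}$, $\mathbb 2=\{0\to1\}$: morphisms are $2$-morphisms of $\mathbf C$ (composed horizontally), and $2$-morphisms are commutative squares of vertical composites of $2$-morphisms. For a normal pseudo-functor $L$, $\mathrm{Ar}_*L$ acts as $L$ on objects and as $L^{\mathbb 2}$ on hom-categories, with compositors given component-wise by those of $L$. The $2$-category $\mathrm{Ar}_*L\downarrow D$ is the pseudo-slice for $\mathrm{Ar}_*L\colon\mathrm{Ar}_*\mathbf C\to\mathrm{Ar}_*\mathbf D$ and the object $D$; its objects are pairs of $C\in\mathbf C$ and a $2$-morphism $f\Rightarrow g$ between morphisms $f,g\colon LC\to D$. **Double categories** are strict. They have objects, horizontal morphisms, vertical morphisms and squares; a square has a top and a bottom horizontal morphism and a left and a right vertical morphism. $\mathrm e_A$ denotes the vertical identity at $A$. A square whose left and right boundaries are vertical identities is vertically invertible if it has an inverse for vertical composition. $\mathbb A^{\mathrm{op}}$ denotes the horizontal opposite. **Pseudo-slice double category $\mathbb HL\downarrow\downarrow D$.** ($\mathbb H$ views a $2$-category as a double category with only identity vertical morphisms.) Its objects and horizontal morphisms are the objects and morphisms of $L\downarrow D$; its vertical morphisms from $(C,f)$ to $(C,g)$ are the $2$-morphisms $\alpha\colon f\Rightarrow g$ of $\mathbf D$ (there are none between objects with different first components); its squares with top $(c,\psi)\colon(C,f)\to(C',f')$, bottom $(d,\varphi)\colon(C,g)\to(C',g')$, left $\alpha\colon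 f\Rightarrow g$, right $\alpha'\colon f'\Rightarrow g'$ are the $2$-morphisms $\gamma\colon c\Rightarrow d$ of $\mathbf C$ with $\alpha\circ\psi=\varphi\circ(\alpha' * L\gamma)$, where $*$ is horizontal composition. **Bi-initial and bi-terminal objects.** For an object $I$ of a $2$-category $\mathbf A$, the pseudo-slice $I\downarrow\mathbf A$ has objects $(A,f\colon I\to A)$; morphisms $(A,f)\to(A',f')$ pairs $(a,\psi)$ of $a\colon A\to A'$ and an invertible $\psi\colon f'\Rightarrow af$; $2$-morphisms $(a,\psi)\Rightarrow(b,\varphi)$ the $\beta\colon a\Rightarrow b$ with $(\beta f)\circ\psi=\varphi$. A $2$-functor is a trivial fibration if it is surjective on objects, full on morphisms (every morphism $FA\to FA'$ is the image of some morphism $A\to A'$) and fully faithful on $2$-morphisms. $I$ is bi-initial if the projection $I\downarrow\mathbf A\to\mathbf A$ is a trivial fibration, and bi-terminal in $\mathbf A$ if it is bi-initial in $\mathbf A^{\mathrm{op}}$. **Double bi-initial and bi-terminal objects.** For an object $I$ of a double category $\mathbb A$, the pseudo-slice double category $I\downarrow\downarrow\mathbb A$ has: objects $(A,f)$ with $f\colon I\to A$ horizontal; horizontal morphisms $(A,f)\to(A',f')$: pairs $(a,\psi)$ of a horizontal $a\colon A\to A'$ and a vertically invertible square $\psi$ with top $f'$, bottom $af$, left $\mathrm e_I$, right $\mathrm e_{A'}$; vertical morphisms from $(A,f)$ to $(B,g)$: pairs $(u,\gamma)$ of a vertical morphism $u$ from $A$ to $B$ and a square $\gamma$ with top $f$,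 bottom $g$, left $\mathrm e_I$, right $u$; squares with top $(a,\psi)$, bottom $(b,\varphi)$, left $(u,\gamma)$, right $(u',\gamma')$: squares $\alpha$ of $\mathbb A$ with top $a$, bottom $b$, left $u$, right $u'$ such that $\psi$ pasted vertically above the horizontal composite of $\gamma$ and $\alpha$ equals $\gamma'$ pasted vertically above $\varphi$. A double functor is a double trivial fibration if it is surjective on objects, full on horizontal morphisms, surjective on vertical morphisms, and fully faithful on squares (every square whose boundary is the image of a given boundary is the image of a unique square with that given boundary). $I$ is double bi-initial if the projection $I\downarrow\downarrow\mathbb A\to\mathbb A$ is a double trivial fibration, and double bi-terminal in $\mathbb A$ if it is double bi-initial in $\mathbb A^{\mathrm{op}}$. *)

theory Defs
  imports Main
begin

section \<open>Categories\<close>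

record ('x, 'y) cat =
  Obj :: "'x set"
  Arr :: "'y set"
  Dom :: "'y \<Rightarrow> 'x"
  Cod :: "'y \<Rightarrow> 'x"
  Idn :: "'x \<Rightarrow> 'y"
  Comp :: "'y \<Rightarrow> 'y \<Rightarrow> 'y"  (infixl "\<odot>\<index>" 70)

definition Homs :: "('x, 'y, 'z) cat_scheme \<Rightarrow> 'x \<Rightarrow> 'x \<Rightarrow> 'y set" where
  "Homs A x y = {f \<in> Arr A. Dom A f = x \<and> Cod A f = y}"

locale category =
  fixes A :: "('x, 'y) cat"  (structure)
  assumes Dom_Obj: "f \<in> Arr A \<Longrightarrow> Dom A f \<in> Obj A"
    and Cod_Obj: "f \<in> Arr A \<Longrightarrow> Cod A f \<in> Obj A"
    and Idn_Homs: "x \<in> Obj A \<Longrightarrow> Idn A x \<in> Homs A x x"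
    and Comp_Homs: "f \<in> Homs A x y \<Longrightarrow> g \<in> Homs A y z \<Longrightarrow> g \<odot> f \<in> Homs A x z"
    and Comp_Idn: "f \<in> Homs A x y \<Longrightarrow> f \<odot> Idn A x = f"
    and Idn_Comp: "f \<in> Homs A x y \<Longrightarrow> Idn A y \<odot> f = f"
    and Comp_assoc: "f \<in> Homs A x y \<Longrightarrow> g \<in> Homs A y z \<Longrightarrow> h \<in> Homs A z w
      \<Longrightarrow> (h \<odot> g) \<odot> f = h \<odot> (g \<odot> f)"

definition iso_arr :: "('x, 'y) cat \<Rightarrow> 'y \<Rightarrow> bool" where
  "iso_arr A f \<longleftrightarrow> f \<in> Arr A \<and> (\<exists>g \<in> Homs A (Cod A f) (Dom A f).
     g \<odot>\<^bsub>A\<^esub> f = Idn A (Dom A f) \<and> f \<odot>\<^bsub>A\<^esub> g = Idn A (Cod A f))"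

record ('x, 'y, 'u, 'v) fctr =
  fob :: "'x \<Rightarrow> 'u"
  farr :: "'y \<Rightarrow> 'v"

definition id_fctr :: "('x, 'y, 'x, 'y) fctr" where
  "id_fctr = \<lparr>fob = (\<lambda>x. x), farr = (\<lambda>f. f)\<rparr>"

definition comp_fctr :: "('u, 'v, 'p, 'q) fctr \<Rightarrow> ('x, 'y, 'u, 'v) fctr \<Rightarrow> ('x, 'y, 'p, 'q) fctr" where
  "comp_fctr G F = \<lparr>fob = fob G \<circ> fob F, farr = farr G \<circ> farr F\<rparr>"

definition is_functor :: "('x, 'y) cat \<Rightarrow> ('u, 'v) cat \<Rightarrow> ('x, 'y, 'u, 'v) fctr \<Rightarrow> bool" where
  "is_functor A B F \<longleftrightarrow>
     (\<forall>x \<in> Obj A. fob F x \<in> Obj B) \<and>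
     (\<forall>x \<in> Obj A. \<forall>y \<in> Obj A. \<forall>f \<in> Homs A x y. farr F f \<in> Homs B (fob F x) (fob F y)) \<and>
     (\<forall>x \<in> Obj A. farr F (Idn A x) = Idn B (fob F x)) \<and>
     (\<forall>x \<in> Obj A. \<forall>y \<in> Obj A. \<forall>z \<in> Obj A. \<forall>f \<in> Homs A x y. \<forall>g \<in> Homs A y z.
        farr F (g \<odot>\<^bsub>A\<^esub> f) = farr F g \<odot>\<^bsub>B\<^esub> farr F f)"

definition is_nat_iso ::
    "('x, 'y) cat \<Rightarrow> ('u, 'v) cat \<Rightarrow> ('x, 'y, 'u, 'v) fctr \<Rightarrow> ('x, 'y, 'u, 'v) fctr
      \<Rightarrow> ('x \<Rightarrow> 'v) \<Rightarrow> bool" where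
  "is_nat_iso A B F G \<theta> \<longleftrightarrow>
     is_functor A B F \<and> is_functor A B G \<and>
     (\<forall>x \<in> Obj A. \<theta> x \<in> Homs B (fob F x) (fob G x) \<and> iso_arr B (\<theta> x)) \<and>
     (\<forall>x \<in> Obj A. \<forall>y \<in> Obj A. \<forall>f \<in> Homs A x y.
        \<theta> y \<odot>\<^bsub>B\<^esub> farr F f = farr G f \<odot>\<^bsub>B\<^esub> \<theta> x)"

definition adjoint_equivalence ::
    "('x, 'y) cat \<Rightarrow> ('u, 'v) cat \<Rightarrow> ('x, 'y, 'u, 'v) fctr \<Rightarrow> ('u, 'v, 'x, 'y) fctr
      \<Rightarrow> ('x \<Rightarrow> 'y) \<Rightarrow> ('u \<Rightarrow> 'v) \<Rightarrow> bool" where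
  "adjoint_equivalence A B F G \<eta> \<epsilon> \<longleftrightarrow>
     is_functor A B F \<and> is_functor B A G \<and>
     is_nat_iso A A id_fctr (comp_fctr G F) \<eta> \<and>
     is_nat_iso B B (comp_fctr F G) id_fctr \<epsilon> \<and>
     (\<forall>x \<in> Obj A. \<epsilon> (fob F x) \<odot>\<^bsub>B\<^esub> farr F (\<eta> x) = Idn B (fob F x)) \<and>
     (\<forall>u \<in> Obj B. farr G (\<epsilon> u) \<odot>\<^bsub>A\<^esub> \<eta> (fob G u) = Idn A (fob G u))"

section \<open>2-categories\<close>

text \<open>All compositions are written in applicative order: \<open>g \<cdot> f\<close> is ``g after f'',
  \<open>\<bullet>\<close> is vertical and \<open>\<star>\<close> horizontal composition of 2-morphisms.\<close>

record ('o, 'm, 't) two_cat =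
  Ob :: "'o set"
  Mor :: "'m set"
  Two :: "'t set"
  dom1 :: "'m \<Rightarrow> 'o"
  cod1 :: "'m \<Rightarrow> 'o"
  dom2 :: "'t \<Rightarrow> 'm"
  cod2 :: "'t \<Rightarrow> 'm"
  id1 :: "'o \<Rightarrow> 'm"
  id2 :: "'m \<Rightarrow> 't"
  comp1 :: "'m \<Rightarrow> 'm \<Rightarrow> 'm"  (infixl "\<cdot>\<index>" 70)
  vcomp :: "'t \<Rightarrow> 't \<Rightarrow> 't"  (infixl "\<bullet>\<index>" 65)
  hcomp :: "'t \<Rightarrow> 't \<Rightarrow> 't"  (infixl "\<star>\<index>" 70)

definition hom1 :: "('o, 'm, 't) two_cat \<Rightarrow> 'o \<Rightarrow> 'o \<Rightarrow> 'm set" where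
  "hom1 C X Y = {f \<in> Mor C. dom1 C f = X \<and> cod1 C f = Y}"

definition hom2 :: "('o, 'm, 't) two_cat \<Rightarrow> 'm \<Rightarrow> 'm \<Rightarrow> 't set" where
  "hom2 C f g = {\<alpha> \<in> Two C. dom2 C \<alpha> = f \<and> cod2 C \<alpha> = g}"

definition hom_cat :: "('o, 'm, 't) two_cat \<Rightarrow> 'o \<Rightarrow> 'o \<Rightarrow> ('m, 't) cat" where
  "hom_cat C X Y = \<lparr>Obj = hom1 C X Y,
     Arr = {\<alpha> \<in> Two C. dom2 C \<alpha> \<in> hom1 C X Y \<and> cod2 C \<alpha> \<in> hom1 C X Y},
     Dom = dom2 C, Cod = cod2 C, Idn = id2 C, Comp = vcomp C\<rparr>"

locale two_category =
  fixes C :: "('o, 'm, 't) two_cat"  (structure)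
  assumes dom1_Ob: "f \<in> Mor C \<Longrightarrow> dom1 C f \<in> Ob C"
    and cod1_Ob: "f \<in> Mor C \<Longrightarrow> cod1 C f \<in> Ob C"
    and dom2_Mor: "\<alpha> \<in> Two C \<Longrightarrow> dom2 C \<alpha> \<in> Mor C"
    and cod2_Mor: "\<alpha> \<in> Two C \<Longrightarrow> cod2 C \<alpha> \<in> Mor C"
    and dom1_dom2: "\<alpha> \<in> Two C \<Longrightarrow> dom1 C (dom2 C \<alpha>) = dom1 C (cod2 C \<alpha>)"
    and cod1_dom2: "\<alpha> \<in> Two C \<Longrightarrow> cod1 C (dom2 C \<alpha>) = cod1 C (cod2 C \<alpha>)"
    and hom_category: "X \<in> Ob C \<Longrightarrow> Y \<in> Ob C \<Longrightarrow> category (hom_cat C X Y)"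
    and id1_hom1: "X \<in> Ob C \<Longrightarrow> id1 C X \<in> hom1 C X X"
    and comp1_hom1: "f \<in> hom1 C X Y \<Longrightarrow> g \<in> hom1 C Y Z \<Longrightarrow> g \<cdot> f \<in> hom1 C X Z"
    and comp1_id1: "f \<in> hom1 C X Y \<Longrightarrow> f \<cdot> id1 C X = f"
    and id1_comp1: "f \<in> hom1 C X Y \<Longrightarrow> id1 C Y \<cdot> f = f"
    and comp1_assoc: "f \<in> hom1 C X Y \<Longrightarrow> g \<in> hom1 C Y Z \<Longrightarrow> h \<in> hom1 C Z W
      \<Longrightarrow> (h \<cdot> g) \<cdot> f = h \<cdot> (g \<cdot> f)"
    and hcomp_hom2: "f \<in> hom1 C X Y \<Longrightarrow> f' \<in> hom1 C Y Z \<Longrightarrow> \<alpha> \<in> hom2 C f g \<Longrightarrow> \<alpha>' \<in> hom2 C f' g'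
      \<Longrightarrow> \<alpha>' \<star> \<alpha> \<in> hom2 C (f' \<cdot> f) (g' \<cdot> g)"
    and hcomp_id2: "f \<in> hom1 C X Y \<Longrightarrow> g \<in> hom1 C Y Z \<Longrightarrow> id2 C g \<star> id2 C f = id2 C (g \<cdot> f)"
    and interchange: "f \<in> hom1 C X Y \<Longrightarrow> f' \<in> hom1 C Y Z
      \<Longrightarrow> \<alpha> \<in> hom2 C f g \<Longrightarrow> \<beta> \<in> hom2 C g h \<Longrightarrow> \<alpha>' \<in> hom2 C f' g' \<Longrightarrow> \<beta>' \<in> hom2 C g' h'
      \<Longrightarrow> (\<beta>' \<bullet> \<alpha>') \<star> (\<beta> \<bullet> \<alpha>) = (\<beta>' \<star> \<beta>) \<bullet> (\<alpha>' \<star> \<alpha>)"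
    and hcomp_id1: "f \<in> hom1 C X Y \<Longrightarrow> \<alpha> \<in> hom2 C f g \<Longrightarrow> \<alpha> \<star> id2 C (id1 C X) = \<alpha>"
    and id1_hcomp: "f \<in> hom1 C X Y \<Longrightarrow> \<alpha> \<in> hom2 C f g \<Longrightarrow> id2 C (id1 C Y) \<star> \<alpha> = \<alpha>"
    and hcomp_assoc: "f \<in> hom1 C X Y \<Longrightarrow> f' \<in> hom1 C Y Z \<Longrightarrow> f'' \<in> hom1 C Z W
      \<Longrightarrow> \<alpha> \<in> hom2 C f g \<Longrightarrow> \<alpha>' \<in> hom2 C f' g' \<Longrightarrow> \<alpha>'' \<in> hom2 C f'' g''
      \<Longrightarrow> (\<alpha>'' \<star> \<alpha>') \<star> \<alpha> = \<alpha>'' \<star> (\<alpha>' \<star> \<alpha>)"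

definition inverse2 :: "('o, 'm, 't) two_cat \<Rightarrow> 't \<Rightarrow> 't \<Rightarrow> bool" where
  "inverse2 C \<alpha> \<beta> \<longleftrightarrow> \<alpha> \<in> Two C \<and> \<beta> \<in> hom2 C (cod2 C \<alpha>) (dom2 C \<alpha>) \<and>
     \<beta> \<bullet>\<^bsub>C\<^esub> \<alpha> = id2 C (dom2 C \<alpha>) \<and> \<alpha> \<bullet>\<^bsub>C\<^esub> \<beta> = id2 C (cod2 C \<alpha>)"

definition iso2 :: "('o, 'm, 't) two_cat \<Rightarrow> 'm \<Rightarrow> 'm \<Rightarrow> 't set" where
  "iso2 C f g = {\<alpha> \<in> hom2 C f g. \<exists>\<beta>. inverse2 C \<alpha> \<beta>}"

definition inv2 :: "('o, 'm, 't) two_cat \<Rightarrow> 't \<Rightarrow> 't" where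
  "inv2 C \<alpha> = (THE \<beta>. inverse2 C \<alpha> \<beta>)"

definition op2 :: "('o, 'm, 't) two_cat \<Rightarrow> ('o, 'm, 't) two_cat" where
  "op2 C = \<lparr>Ob = Ob C, Mor = Mor C, Two = Two C,
     dom1 = cod1 C, cod1 = dom1 C, dom2 = dom2 C, cod2 = cod2 C,
     id1 = id1 C, id2 = id2 C,
     comp1 = (\<lambda>g f. f \<cdot>\<^bsub>C\<^esub> g), vcomp = vcomp C, hcomp = (\<lambda>\<beta> \<alpha>. \<alpha> \<star>\<^bsub>C\<^esub> \<beta>)\<rparr>"

definition prod2 :: "('o, 'm, 't) two_cat \<Rightarrow> ('o2, 'm2, 't2) two_cat
    \<Rightarrow> ('o \<times> 'o2, 'm \<times> 'm2, 't \<times> 't2) two_cat" where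
  "prod2 C D = \<lparr>Ob = Ob C \<times> Ob D, Mor = Mor C \<times> Mor D, Two = Two C \<times> Two D,
     dom1 = map_prod (dom1 C) (dom1 D), cod1 = map_prod (cod1 C) (cod1 D),
     dom2 = map_prod (dom2 C) (dom2 D), cod2 = map_prod (cod2 C) (cod2 D),
     id1 = map_prod (id1 C) (id1 D), id2 = map_prod (id2 C) (id2 D),
     comp1 = (\<lambda>(g, g') (f, f'). (g \<cdot>\<^bsub>C\<^esub> f, g' \<cdot>\<^bsub>D\<^esub> f')),
     vcomp = (\<lambda>(\<beta>, \<beta>') (\<alpha>, \<alpha>'). (\<beta> \<bullet>\<^bsub>C\<^esub> \<alpha>, \<beta>' \<bullet>\<^bsub>D\<^esub> \<alpha>')),
     hcomp = (\<lambda>(\<beta>, \<beta>') (\<alpha>, \<alpha>'). (\<beta> \<star>\<^bsub>C\<^esub> \<alpha>, \<beta>' \<star>\<^bsub>D\<^esub> \<alpha>'))\<rparr>"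

section \<open>Normal pseudo-functors\<close>

text \<open>\<open>cmpr F a a'\<close> is the compositor \<open>(F a') (F a) \<Rightarrow> F (a' a)\<close>: the arguments are in
  diagrammatic order.\<close>

record ('o, 'm, 't, 'p, 'n, 's) psf =
  on_ob :: "'o \<Rightarrow> 'p"
  on_mor :: "'m \<Rightarrow> 'n"
  on_two :: "'t \<Rightarrow> 's"
  cmpr :: "'m \<Rightarrow> 'm \<Rightarrow> 's"

locale normal_pseudo_functor =
  fixes A :: "('o, 'm, 't) two_cat" and B :: "('p, 'n, 's) two_cat"
    and F :: "('o, 'm, 't, 'p, 'n, 's) psf"
  assumes on_ob_Ob: "X \<in> Ob A \<Longrightarrow> on_ob F X \<in> Ob B"
    and hom_functor: "X \<in> Ob A \<Longrightarrow> Y \<in> Ob A \<Longrightarrow>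
      is_functor (hom_cat A X Y) (hom_cat B (on_ob F X) (on_ob F Y))
        \<lparr>fob = on_mor F, farr = on_two F\<rparr>"
    and on_mor_id1: "X \<in> Ob A \<Longrightarrow> on_mor F (id1 A X) = id1 B (on_ob F X)"
    and cmpr_iso2: "a \<in> hom1 A X Y \<Longrightarrow> a' \<in> hom1 A Y Z \<Longrightarrow>
      cmpr F a a' \<in> iso2 B (on_mor F a' \<cdot>\<^bsub>B\<^esub> on_mor F a) (on_mor F (a' \<cdot>\<^bsub>A\<^esub> a))"
    and cmpr_natural: "a \<in> hom1 A X Y \<Longrightarrow> a' \<in> hom1 A Y Z \<Longrightarrow>
      \<alpha> \<in> hom2 A a b \<Longrightarrow> \<alpha>' \<in> hom2 A a' b' \<Longrightarrow>
      on_two F (\<alpha>' \<star>\<^bsub>A\<^esub> \<alpha>) \<bullet>\<^bsub>B\<^esub> cmpr F a a'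
        = cmpr F b b' \<bullet>\<^bsub>B\<^esub> (on_two F \<alpha>' \<star>\<^bsub>B\<^esub> on_two F \<alpha>)"
    and cmpr_assoc: "a \<in> hom1 A X Y \<Longrightarrow> a' \<in> hom1 A Y Z \<Longrightarrow> a'' \<in> hom1 A Z W \<Longrightarrow>
      cmpr F (a' \<cdot>\<^bsub>A\<^esub> a) a'' \<bullet>\<^bsub>B\<^esub> (id2 B (on_mor F a'') \<star>\<^bsub>B\<^esub> cmpr F a a')
        = cmpr F a (a'' \<cdot>\<^bsub>A\<^esub> a') \<bullet>\<^bsub>B\<^esub> (cmpr F a' a'' \<star>\<^bsub>B\<^esub> id2 B (on_mor F a))"
    and cmpr_id1_left: "a \<in> hom1 A X Y \<Longrightarrow> cmpr F (id1 A X) a = id2 B (on_mor F a)"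
    and cmpr_id1_right: "a \<in> hom1 A X Y \<Longrightarrow> cmpr F a (id1 A Y) = id2 B (on_mor F a)"

section \<open>Bi-adjunctions\<close>

text \<open>Data of a normal pseudo-functor \<open>A \<rightarrow> Cat\<close> whose values are categories on the types
  \<open>'x\<close>, \<open>'y\<close>; natural transformations are given by their components. Pseudo-naturality is stated
  between two such pseudo-functors with values on possibly different types, so that the
  hom-categories of two unrelated 2-categories can be compared.\<close>

record ('o, 'm, 't, 'x, 'y) cat_psf =
  cob :: "'o \<Rightarrow> ('x, 'y) cat"
  cmor :: "'m \<Rightarrow> ('x, 'y, 'x, 'y) fctr"
  ctwo :: "'t \<Rightarrow> 'x \<Rightarrow> 'y"
  ccmpr :: "'m \<Rightarrow> 'm \<Rightarrow> 'x \<Rightarrow> 'y"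

definition pseudo_natural ::
    "('o, 'm, 't) two_cat \<Rightarrow> ('o, 'm, 't, 'x, 'y) cat_psf \<Rightarrow> ('o, 'm, 't, 'u, 'v) cat_psf
      \<Rightarrow> ('o \<Rightarrow> ('x, 'y, 'u, 'v) fctr) \<Rightarrow> ('m \<Rightarrow> 'x \<Rightarrow> 'v) \<Rightarrow> bool" where
  "pseudo_natural A F G \<Phi> \<phi> \<longleftrightarrow>
     (\<forall>X \<in> Ob A. is_functor (cob F X) (cob G X) (\<Phi> X)) \<and>
     (\<forall>X \<in> Ob A. \<forall>Y \<in> Ob A. \<forall>a \<in> hom1 A X Y.
        is_nat_iso (cob F X) (cob G Y)
          (comp_fctr (cmor G a) (\<Phi> X)) (comp_fctr (\<Phi> Y) (cmor F a)) (\<phi> a)) \<and>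
     (\<forall>X \<in> Ob A. \<forall>Y \<in> Ob A. \<forall>a \<in> hom1 A X Y. \<forall>b \<in> hom1 A X Y. \<forall>\<alpha> \<in> hom2 A a b. \<forall>x \<in> Obj (cob F X).
        \<phi> b x \<odot>\<^bsub>cob G Y\<^esub> ctwo G \<alpha> (fob (\<Phi> X) x)
          = farr (\<Phi> Y) (ctwo F \<alpha> x) \<odot>\<^bsub>cob G Y\<^esub> \<phi> a x) \<and>
     (\<forall>X \<in> Ob A. \<forall>Y \<in> Ob A. \<forall>Z \<in> Ob A. \<forall>a \<in> hom1 A X Y. \<forall>a' \<in> hom1 A Y Z. \<forall>x \<in> Obj (cob F X).
        \<phi> (a' \<cdot>\<^bsub>A\<^esub> a) x \<odot>\<^bsub>cob G Z\<^esub> ccmpr G a a' (fob (\<Phi> X) x)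
          = farr (\<Phi> Z) (ccmpr F a a' x) \<odot>\<^bsub>cob G Z\<^esub>
              (\<phi> a' (fob (cmor F a) x) \<odot>\<^bsub>cob G Z\<^esub> farr (cmor G a') (\<phi> a x))) \<and>
     (\<forall>X \<in> Ob A. \<forall>x \<in> Obj (cob F X). \<phi> (id1 A X) x = Idn (cob G X) (fob (\<Phi> X) x))"

text \<open>The pseudo-functors \<open>C(-, R-)\<close> and \<open>D(L-, -)\<close> from \<open>C\<^sup>o\<^sup>p \<times> D\<close> to \<open>Cat\<close>.\<close>

definition hom_right :: "('o, 'm, 't) two_cat \<Rightarrow> ('p, 'n, 's, 'o, 'm, 't) psf
    \<Rightarrow> ('o \<times> 'p, 'm \<times> 'n, 't \<times> 's, 'm, 't) cat_psf" where
  "hom_right C R = \<lparr>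
     cob = (\<lambda>(X, Y). hom_cat C X (on_ob R Y)),
     cmor = (\<lambda>(c, d). \<lparr>fob = (\<lambda>h. on_mor R d \<cdot>\<^bsub>C\<^esub> (h \<cdot>\<^bsub>C\<^esub> c)),
       farr = (\<lambda>\<theta>. id2 C (on_mor R d) \<star>\<^bsub>C\<^esub> (\<theta> \<star>\<^bsub>C\<^esub> id2 C c))\<rparr>),
     ctwo = (\<lambda>(\<gamma>, \<delta>) h. on_two R \<delta> \<star>\<^bsub>C\<^esub> (id2 C h \<star>\<^bsub>C\<^esub> \<gamma>)),
     ccmpr = (\<lambda>(c, d) (c', d') h. cmpr R d d' \<star>\<^bsub>C\<^esub> id2 C (h \<cdot>\<^bsub>C\<^esub> (c \<cdot>\<^bsub>C\<^esub> c')))\<rparr>"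

definition hom_left :: "('p, 'n, 's) two_cat \<Rightarrow> ('o, 'm, 't, 'p, 'n, 's) psf
    \<Rightarrow> ('o \<times> 'p, 'm \<times> 'n, 't \<times> 's, 'n, 's) cat_psf" where
  "hom_left D L = \<lparr>
     cob = (\<lambda>(X, Y). hom_cat D (on_ob L X) Y),
     cmor = (\<lambda>(c, d). \<lparr>fob = (\<lambda>k. d \<cdot>\<^bsub>D\<^esub> (k \<cdot>\<^bsub>D\<^esub> on_mor L c)),
       farr = (\<lambda>\<theta>. id2 D d \<star>\<^bsub>D\<^esub> (\<theta> \<star>\<^bsub>D\<^esub> id2 D (on_mor L c)))\<rparr>),
     ctwo = (\<lambda>(\<gamma>, \<delta>) k. \<delta> \<star>\<^bsub>D\<^esub> (id2 D k \<star>\<^bsub>D\<^esub> on_two L \<gamma>)),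
     ccmpr = (\<lambda>(c, d) (c', d') k. id2 D (d' \<cdot>\<^bsub>D\<^esub> (d \<cdot>\<^bsub>D\<^esub> k)) \<star>\<^bsub>D\<^esub> cmpr L c' c)\<rparr>"

definition bi_adjunction ::
    "('o, 'm, 't) two_cat \<Rightarrow> ('p, 'n, 's) two_cat
      \<Rightarrow> ('o, 'm, 't, 'p, 'n, 's) psf \<Rightarrow> ('p, 'n, 's, 'o, 'm, 't) psf
      \<Rightarrow> ('o \<times> 'p \<Rightarrow> ('m, 't, 'n, 's) fctr) \<Rightarrow> ('m \<times> 'n \<Rightarrow> 'm \<Rightarrow> 's)
      \<Rightarrow> ('o \<times> 'p \<Rightarrow> ('n, 's, 'm, 't) fctr)
      \<Rightarrow> ('o \<times> 'p \<Rightarrow> 'm \<Rightarrow> 't) \<Rightarrow> ('o \<times> 'p \<Rightarrow> 'n \<Rightarrow> 's) \<Rightarrow> bool" where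
  "bi_adjunction C D L R \<Phi> \<phi> \<Psi> \<eta> \<epsilon> \<longleftrightarrow>
     normal_pseudo_functor C D L \<and> normal_pseudo_functor D C R \<and>
     pseudo_natural (prod2 (op2 C) D) (hom_right C R) (hom_left D L) \<Phi> \<phi> \<and>
     (\<forall>X \<in> Ob C. \<forall>Y \<in> Ob D.
        adjoint_equivalence (hom_cat C X (on_ob R Y)) (hom_cat D (on_ob L X) Y)
          (\<Phi> (X, Y)) (\<Psi> (X, Y)) (\<eta> (X, Y)) (\<epsilon> (X, Y)))"

definition right_bi_adjoint ::
    "('o, 'm, 't) two_cat \<Rightarrow> ('p, 'n, 's) two_cat
      \<Rightarrow> ('o, 'm, 't, 'p, 'n, 's) psf \<Rightarrow> ('p, 'n, 's, 'o, 'm, 't) psf \<Rightarrow> bool" where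
  "right_bi_adjoint C D L R \<longleftrightarrow> (\<exists>\<Phi> \<phi> \<Psi> \<eta> \<epsilon>. bi_adjunction C D L R \<Phi> \<phi> \<Psi> \<eta> \<epsilon>)"

section \<open>Pseudo-slices and arrow 2-categories\<close>

text \<open>Morphisms and 2-morphisms of the slices below carry their source and target explicitly,
  since these are not determined by the underlying data: a morphism of \<open>slice_over C D L Y\<close> is
  \<open>((X, f), (X', f'), c, \<psi>)\<close>, and a 2-morphism is \<open>(p, q, \<beta>)\<close> with \<open>p\<close>, \<open>q\<close> parallel
  morphisms.\<close>

type_synonym ('o, 'm, 'n, 's) slice_mor = "('o \<times> 'n) \<times> ('o \<times> 'n) \<times> 'm \<times> 's"

definition over_obs ::
    "('o, 'm, 't) two_cat \<Rightarrow> ('p, 'n, 's) two_cat \<Rightarrow> ('o, 'm, 't, 'p, 'n, 's) psf \<Rightarrow> 'p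
      \<Rightarrow> ('o \<times> 'n) set" where
  "over_obs C D L Y = {(X, f). X \<in> Ob C \<and> f \<in> hom1 D (on_ob L X) Y}"

definition over_mors ::
    "('o, 'm, 't) two_cat \<Rightarrow> ('p, 'n, 's) two_cat \<Rightarrow> ('o, 'm, 't, 'p, 'n, 's) psf \<Rightarrow> 'p
      \<Rightarrow> ('o, 'm, 'n, 's) slice_mor set" where
  "over_mors C D L Y = {((X, f), (X', f'), c, \<psi>).
     (X, f) \<in> over_obs C D L Y \<and> (X', f') \<in> over_obs C D L Y \<and>
     c \<in> hom1 C X X' \<and> \<psi> \<in> iso2 D (f' \<cdot>\<^bsub>D\<^esub> on_mor L c) f}"

definition over_id1 ::
    "('o, 'm, 't) two_cat \<Rightarrow> ('p, 'n, 's) two_cat \<Rightarrow> 'o \<times> 'n \<Rightarrow> ('o, 'm, 'n, 's) slice_mor" where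
  "over_id1 C D = (\<lambda>(X, f). ((X, f), (X, f), id1 C X, id2 D f))"

text \<open>The 2-morphism of the composite is
  \<open>f'' L(c' c) \<Rightarrow> f'' (L c') (L c) \<Rightarrow> f' (L c) \<Rightarrow> f\<close>.\<close>

definition over_comp1 ::
    "('o, 'm, 't) two_cat \<Rightarrow> ('p, 'n, 's) two_cat \<Rightarrow> ('o, 'm, 't, 'p, 'n, 's) psf
      \<Rightarrow> ('o, 'm, 'n, 's) slice_mor \<Rightarrow> ('o, 'm, 'n, 's) slice_mor \<Rightarrow> ('o, 'm, 'n, 's) slice_mor" where
  "over_comp1 C D L = (\<lambda>(_, (X'', f''), c', \<psi>') ((X, f), _, c, \<psi>).
     ((X, f), (X'', f''), c' \<cdot>\<^bsub>C\<^esub> c,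
       \<psi> \<bullet>\<^bsub>D\<^esub> ((\<psi>' \<star>\<^bsub>D\<^esub> id2 D (on_mor L c)) \<bullet>\<^bsub>D\<^esub> (id2 D f'' \<star>\<^bsub>D\<^esub> inv2 D (cmpr L c c')))))"

definition slice_over ::
    "('o, 'm, 't) two_cat \<Rightarrow> ('p, 'n, 's) two_cat \<Rightarrow> ('o, 'm, 't, 'p, 'n, 's) psf \<Rightarrow> 'p
      \<Rightarrow> ('o \<times> 'n, ('o, 'm, 'n, 's) slice_mor,
          ('o, 'm, 'n, 's) slice_mor \<times> ('o, 'm, 'n, 's) slice_mor \<times> 't) two_cat" where
  "slice_over C D L Y = \<lparr>
     Ob = over_obs C D L Y,
     Mor = over_mors C D L Y,
     Two = {(((X, f), (X', f'), c, \<psi>), ((W, g), (W', g'), d, \<phi>), \<beta>).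
       ((X, f), (X', f'), c, \<psi>) \<in> over_mors C D L Y \<and>
       ((W, g), (W', g'), d, \<phi>) \<in> over_mors C D L Y \<and>
       (W, g) = (X, f) \<and> (W', g') = (X', f') \<and>
       \<beta> \<in> hom2 C c d \<and> \<phi> \<bullet>\<^bsub>D\<^esub> (id2 D f' \<star>\<^bsub>D\<^esub> on_two L \<beta>) = \<psi>},
     dom1 = (\<lambda>(x, y, c, \<psi>). x),
     cod1 = (\<lambda>(x, y, c, \<psi>). y),
     dom2 = (\<lambda>(p, q, \<beta>). p),
     cod2 = (\<lambda>(p, q, \<beta>). q),
     id1 = over_id1 C D,
     id2 = (\<lambda>(x, y, c, \<psi>). ((x, y, c, \<psi>), (x, y, c, \<psi>), id2 C c)),
     comp1 = over_comp1 C D L,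
     vcomp = (\<lambda>(_, r, \<beta>') (p, _, \<beta>). (p, r, \<beta>' \<bullet>\<^bsub>C\<^esub> \<beta>)),
     hcomp = (\<lambda>(p', q', \<beta>') (p, q, \<beta>).
       (over_comp1 C D L p' p, over_comp1 C D L q' q, \<beta>' \<star>\<^bsub>C\<^esub> \<beta>))\<rparr>"

text \<open>A morphism \<open>((A, f), (A', f'), a, \<psi>)\<close> of \<open>slice_under A I\<close> has \<open>\<psi> : f' \<Rightarrow> a f\<close>.\<close>

definition under_obs :: "('o, 'm, 't) two_cat \<Rightarrow> 'o \<Rightarrow> ('o \<times> 'm) set" where
  "under_obs A I = {(X, f). X \<in> Ob A \<and> f \<in> hom1 A I X}"

definition under_mors :: "('o, 'm, 't) two_cat \<Rightarrow> 'o \<Rightarrow> ('o, 'm, 'm, 't) slice_mor set" where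
  "under_mors A I = {((X, f), (X', f'), a, \<psi>).
     (X, f) \<in> under_obs A I \<and> (X', f') \<in> under_obs A I \<and>
     a \<in> hom1 A X X' \<and> \<psi> \<in> iso2 A f' (a \<cdot>\<^bsub>A\<^esub> f)}"

definition under_comp1 ::
    "('o, 'm, 't) two_cat
      \<Rightarrow> ('o, 'm, 'm, 't) slice_mor \<Rightarrow> ('o, 'm, 'm, 't) slice_mor \<Rightarrow> ('o, 'm, 'm, 't) slice_mor" where
  "under_comp1 A = (\<lambda>(_, y', a', \<psi>') (x, _, a, \<psi>).
     (x, y', a' \<cdot>\<^bsub>A\<^esub> a, (id2 A a' \<star>\<^bsub>A\<^esub> \<psi>) \<bullet>\<^bsub>A\<^esub> \<psi>'))"

definition slice_under ::
    "('o, 'm, 't) two_cat \<Rightarrow> 'o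
      \<Rightarrow> ('o \<times> 'm, ('o, 'm, 'm, 't) slice_mor,
          ('o, 'm, 'm, 't) slice_mor \<times> ('o, 'm, 'm, 't) slice_mor \<times> 't) two_cat" where
  "slice_under A I = \<lparr>
     Ob = under_obs A I,
     Mor = under_mors A I,
     Two = {(((X, f), (X', f'), a, \<psi>), ((W, g), (W', g'), b, \<phi>), \<beta>).
       ((X, f), (X', f'), a, \<psi>) \<in> under_mors A I \<and>
       ((W, g), (W', g'), b, \<phi>) \<in> under_mors A I \<and>
       (W, g) = (X, f) \<and> (W', g') = (X', f') \<and>
       \<beta> \<in> hom2 A a b \<and> (\<beta> \<star>\<^bsub>A\<^esub> id2 A f) \<bullet>\<^bsub>A\<^esub> \<psi> = \<phi>},
     dom1 = (\<lambda>(x, y, a, \<psi>). x),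
     cod1 = (\<lambda>(x, y, a, \<psi>). y),
     dom2 = (\<lambda>(p, q, \<beta>). p),
     cod2 = (\<lambda>(p, q, \<beta>). q),
     id1 = (\<lambda>(X, f). ((X, f), (X, f), id1 A X, id2 A f)),
     id2 = (\<lambda>(x, y, a, \<psi>). ((x, y, a, \<psi>), (x, y, a, \<psi>), id2 A a)),
     comp1 = under_comp1 A,
     vcomp = (\<lambda>(_, r, \<beta>') (p, _, \<beta>). (p, r, \<beta>' \<bullet>\<^bsub>A\<^esub> \<beta>)),
     hcomp = (\<lambda>(p', q', \<beta>') (p, q, \<beta>).
       (under_comp1 A p' p, under_comp1 A q' q, \<beta>' \<star>\<^bsub>A\<^esub> \<beta>))\<rparr>"

text \<open>A 2-morphism \<open>(\<alpha>, \<beta>, \<sigma>, \<tau>)\<close> of \<open>Ar C\<close> from \<open>\<alpha>\<close> to \<open>\<beta>\<close> is the commutative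
  square \<open>\<beta> \<sigma> = \<tau> \<alpha>\<close>.\<close>

definition Ar :: "('o, 'm, 't) two_cat \<Rightarrow> ('o, 't, 't \<times> 't \<times> 't \<times> 't) two_cat" where
  "Ar C = \<lparr>
     Ob = Ob C,
     Mor = Two C,
     Two = {(\<alpha>, \<beta>, \<sigma>, \<tau>). \<alpha> \<in> Two C \<and> \<beta> \<in> Two C \<and>
       \<sigma> \<in> hom2 C (dom2 C \<alpha>) (dom2 C \<beta>) \<and> \<tau> \<in> hom2 C (cod2 C \<alpha>) (cod2 C \<beta>) \<and>
       \<beta> \<bullet>\<^bsub>C\<^esub> \<sigma> = \<tau> \<bullet>\<^bsub>C\<^esub> \<alpha>},
     dom1 = (\<lambda>\<alpha>. dom1 C (dom2 C \<alpha>)),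
     cod1 = (\<lambda>\<alpha>. cod1 C (dom2 C \<alpha>)),
     dom2 = (\<lambda>(\<alpha>, \<beta>, \<sigma>, \<tau>). \<alpha>),
     cod2 = (\<lambda>(\<alpha>, \<beta>, \<sigma>, \<tau>). \<beta>),
     id1 = (\<lambda>X. id2 C (id1 C X)),
     id2 = (\<lambda>\<alpha>. (\<alpha>, \<alpha>, id2 C (dom2 C \<alpha>), id2 C (cod2 C \<alpha>))),
     comp1 = hcomp C,
     vcomp = (\<lambda>(_, \<gamma>, \<sigma>', \<tau>') (\<alpha>, _, \<sigma>, \<tau>). (\<alpha>, \<gamma>, \<sigma>' \<bullet>\<^bsub>C\<^esub> \<sigma>, \<tau>' \<bullet>\<^bsub>C\<^esub> \<tau>)),
     hcomp = (\<lambda>(\<alpha>', \<beta>', \<sigma>', \<tau>') (\<alpha>, \<beta>, \<sigma>, \<tau>).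
       (\<alpha>' \<star>\<^bsub>C\<^esub> \<alpha>, \<beta>' \<star>\<^bsub>C\<^esub> \<beta>, \<sigma>' \<star>\<^bsub>C\<^esub> \<sigma>, \<tau>' \<star>\<^bsub>C\<^esub> \<tau>))\<rparr>"

definition Ar_psf ::
    "('o, 'm, 't) two_cat \<Rightarrow> ('p, 'n, 's) two_cat \<Rightarrow> ('o, 'm, 't, 'p, 'n, 's) psf
      \<Rightarrow> ('o, 't, 't \<times> 't \<times> 't \<times> 't, 'p, 's, 's \<times> 's \<times> 's \<times> 's) psf" where
  "Ar_psf C D L = \<lparr>
     on_ob = on_ob L,
     on_mor = on_two L,
     on_two = (\<lambda>(\<alpha>, \<beta>, \<sigma>, \<tau>). (on_two L \<alpha>, on_two L \<beta>, on_two L \<sigma>, on_two L \<tau>)),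
     cmpr = (\<lambda>\<alpha> \<alpha>'. (on_two L \<alpha>' \<star>\<^bsub>D\<^esub> on_two L \<alpha>, on_two L (\<alpha>' \<star>\<^bsub>C\<^esub> \<alpha>),
       cmpr L (dom2 C \<alpha>) (dom2 C \<alpha>'), cmpr L (cod2 C \<alpha>) (cod2 C \<alpha>')))\<rparr>"

section \<open>Bi-initial and bi-terminal objects\<close>

text \<open>The three maps are those of a (strict) 2-functor; below they are the projections from a
  slice, which preserve all the structure by definition.\<close>

definition trivial_fibration ::
    "('o, 'm, 't) two_cat \<Rightarrow> ('p, 'n, 's) two_cat
      \<Rightarrow> ('o \<Rightarrow> 'p) \<Rightarrow> ('m \<Rightarrow> 'n) \<Rightarrow> ('t \<Rightarrow> 's) \<Rightarrow> bool" where
  "trivial_fibration A B F0 F1 F2 \<longleftrightarrow>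
     (\<forall>Y \<in> Ob B. \<exists>X \<in> Ob A. F0 X = Y) \<and>
     (\<forall>X \<in> Ob A. \<forall>X' \<in> Ob A. \<forall>b \<in> hom1 B (F0 X) (F0 X'). \<exists>a \<in> hom1 A X X'. F1 a = b) \<and>
     (\<forall>X \<in> Ob A. \<forall>X' \<in> Ob A. \<forall>a \<in> hom1 A X X'. \<forall>a' \<in> hom1 A X X'.
        \<forall>\<beta> \<in> hom2 B (F1 a) (F1 a'). \<exists>!\<alpha>. \<alpha> \<in> hom2 A a a' \<and> F2 \<alpha> = \<beta>)"

definition bi_initial :: "('o, 'm, 't) two_cat \<Rightarrow> 'o \<Rightarrow> bool" where
  "bi_initial A I \<longleftrightarrow> I \<in> Ob A \<and>
     trivial_fibration (slice_under A I) A
       (\<lambda>(X, f). X) (\<lambda>(x, y, a, \<psi>). a) (\<lambda>(p, q, \<beta>). \<beta>)"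

definition bi_terminal :: "('o, 'm, 't) two_cat \<Rightarrow> 'o \<Rightarrow> bool" where
  "bi_terminal A I \<longleftrightarrow> bi_initial (op2 A) I"

section \<open>Double categories\<close>

text \<open>Applicative order again: \<open>sq_hcomp \<beta> \<alpha>\<close> has \<open>\<alpha>\<close> on the left of \<open>\<beta>\<close>, and
  \<open>sq_vcomp \<beta> \<alpha>\<close> has \<open>\<alpha>\<close> above \<open>\<beta>\<close>. For a vertical morphism \<open>u\<close>, \<open>sq_hid u\<close> is the
  identity for horizontal composition of squares; for a horizontal morphism \<open>f\<close>, \<open>sq_vid f\<close> is
  the identity for vertical composition.\<close>

record ('o, 'h, 'v, 'q) dbl_cat =
  DOb :: "'o set"
  Hor :: "'h set"
  Ver :: "'v set"
  Sq :: "'q set"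
  hdom :: "'h \<Rightarrow> 'o"
  hcod :: "'h \<Rightarrow> 'o"
  vdom :: "'v \<Rightarrow> 'o"
  vcod :: "'v \<Rightarrow> 'o"
  sq_top :: "'q \<Rightarrow> 'h"
  sq_bot :: "'q \<Rightarrow> 'h"
  sq_left :: "'q \<Rightarrow> 'v"
  sq_right :: "'q \<Rightarrow> 'v"
  hor_id :: "'o \<Rightarrow> 'h"
  hor_comp :: "'h \<Rightarrow> 'h \<Rightarrow> 'h"
  ver_id :: "'o \<Rightarrow> 'v"
  ver_comp :: "'v \<Rightarrow> 'v \<Rightarrow> 'v"
  sq_hid :: "'v \<Rightarrow> 'q"
  sq_hcomp :: "'q \<Rightarrow> 'q \<Rightarrow> 'q"
  sq_vid :: "'h \<Rightarrow> 'q"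
  sq_vcomp :: "'q \<Rightarrow> 'q \<Rightarrow> 'q"

definition hor :: "('o, 'h, 'v, 'q) dbl_cat \<Rightarrow> 'o \<Rightarrow> 'o \<Rightarrow> 'h set" where
  "hor A X Y = {f \<in> Hor A. hdom A f = X \<and> hcod A f = Y}"

definition ver :: "('o, 'h, 'v, 'q) dbl_cat \<Rightarrow> 'o \<Rightarrow> 'o \<Rightarrow> 'v set" where
  "ver A X Y = {u \<in> Ver A. vdom A u = X \<and> vcod A u = Y}"

definition sq :: "('o, 'h, 'v, 'q) dbl_cat \<Rightarrow> 'h \<Rightarrow> 'h \<Rightarrow> 'v \<Rightarrow> 'v \<Rightarrow> 'q set" where
  "sq A t b l r = {\<alpha> \<in> Sq A. sq_top A \<alpha> = t \<and> sq_bot A \<alpha> = b \<and>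
     sq_left A \<alpha> = l \<and> sq_right A \<alpha> = r}"

text \<open>The four categories: objects with horizontal morphisms, objects with vertical morphisms,
  vertical morphisms with squares (under horizontal composition), and horizontal morphisms with
  squares (under vertical composition).\<close>

locale double_category =
  fixes A :: "('o, 'h, 'v, 'q) dbl_cat"
  assumes hor_category: "category \<lparr>Obj = DOb A, Arr = Hor A, Dom = hdom A, Cod = hcod A,
        Idn = hor_id A, Comp = hor_comp A\<rparr>"
    and ver_category: "category \<lparr>Obj = DOb A, Arr = Ver A, Dom = vdom A, Cod = vcod A,
        Idn = ver_id A, Comp = ver_comp A\<rparr>"
    and sq_hor_category: "category \<lparr>Obj = Ver A, Arr = Sq A, Dom = sq_left A, Cod = sq_right A,
        Idn = sq_hid A, Comp = sq_hcomp A\<rparr>"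
    and sq_ver_category: "category \<lparr>Obj = Hor A, Arr = Sq A, Dom = sq_top A, Cod = sq_bot A,
        Idn = sq_vid A, Comp = sq_vcomp A\<rparr>"
    and boundary: "\<alpha> \<in> sq A t b l r \<Longrightarrow>
        hdom A t = vdom A l \<and> hcod A t = vdom A r \<and> hdom A b = vcod A l \<and> hcod A b = vcod A r"
    and sq_hid_sq: "u \<in> ver A X Y \<Longrightarrow> sq_hid A u \<in> sq A (hor_id A X) (hor_id A Y) u u"
    and sq_vid_sq: "f \<in> hor A X Y \<Longrightarrow> sq_vid A f \<in> sq A f f (ver_id A X) (ver_id A Y)"
    and sq_hcomp_sq: "\<alpha> \<in> sq A t b l m \<Longrightarrow> \<beta> \<in> sq A t' b' m r \<Longrightarrow>
        sq_hcomp A \<beta> \<alpha> \<in> sq A (hor_comp A t' t) (hor_comp A b' b) l r"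
    and sq_vcomp_sq: "\<alpha> \<in> sq A t c l r \<Longrightarrow> \<beta> \<in> sq A c b l' r' \<Longrightarrow>
        sq_vcomp A \<beta> \<alpha> \<in> sq A t b (ver_comp A l' l) (ver_comp A r' r)"
    and sq_hid_id: "X \<in> DOb A \<Longrightarrow> sq_hid A (ver_id A X) = sq_vid A (hor_id A X)"
    and sq_hid_comp: "u \<in> ver A X Y \<Longrightarrow> v \<in> ver A Y Z \<Longrightarrow>
        sq_hid A (ver_comp A v u) = sq_vcomp A (sq_hid A v) (sq_hid A u)"
    and sq_vid_comp: "f \<in> hor A X Y \<Longrightarrow> g \<in> hor A Y Z \<Longrightarrow>
        sq_vid A (hor_comp A g f) = sq_hcomp A (sq_vid A g) (sq_vid A f)"
    and sq_interchange: "\<alpha> \<in> sq A t c l m \<Longrightarrow> \<beta> \<in> sq A t' c' m r \<Longrightarrow>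
        \<gamma> \<in> sq A c b l' m' \<Longrightarrow> \<delta> \<in> sq A c' b' m' r' \<Longrightarrow>
        sq_vcomp A (sq_hcomp A \<delta> \<gamma>) (sq_hcomp A \<beta> \<alpha>) = sq_hcomp A (sq_vcomp A \<delta> \<beta>) (sq_vcomp A \<gamma> \<alpha>)"

definition dbl_op :: "('o, 'h, 'v, 'q) dbl_cat \<Rightarrow> ('o, 'h, 'v, 'q) dbl_cat" where
  "dbl_op A = A\<lparr>hdom := hcod A, hcod := hdom A, sq_left := sq_right A, sq_right := sq_left A,
     hor_comp := (\<lambda>g f. hor_comp A f g), sq_hcomp := (\<lambda>\<beta> \<alpha>. sq_hcomp A \<alpha> \<beta>)\<rparr>"

text \<open>Squares from \<open>f\<close> to \<open>g\<close> bounded by vertical identities that have a vertical inverse.\<close>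

definition vert_inv_sq :: "('o, 'h, 'v, 'q) dbl_cat \<Rightarrow> 'o \<Rightarrow> 'o \<Rightarrow> 'h \<Rightarrow> 'h \<Rightarrow> 'q set" where
  "vert_inv_sq A X Y f g = {\<psi> \<in> sq A f g (ver_id A X) (ver_id A Y).
     \<exists>\<psi>' \<in> sq A g f (ver_id A X) (ver_id A Y).
       sq_vcomp A \<psi>' \<psi> = sq_vid A f \<and> sq_vcomp A \<psi> \<psi>' = sq_vid A g}"

text \<open>\<open>dbl_slice_over C D L Y\<close> is the pseudo-slice double category of \<open>L\<close> over \<open>Y\<close>, with \<open>L\<close>
  regarded as a double functor between 2-categories with only identity vertical morphisms. A vertical
  morphism is \<open>((X, f), (X, g), \<alpha>)\<close>; a square is \<open>(top, bottom, left, right, \<gamma>)\<close>.\<close>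

type_synonym ('o, 'n, 's) over_ver = "('o \<times> 'n) \<times> ('o \<times> 'n) \<times> 's"

definition dbl_over_vers ::
    "('o, 'm, 't) two_cat \<Rightarrow> ('p, 'n, 's) two_cat \<Rightarrow> ('o, 'm, 't, 'p, 'n, 's) psf \<Rightarrow> 'p
      \<Rightarrow> ('o, 'n, 's) over_ver set" where
  "dbl_over_vers C D L Y = {((X, f), (X', g), \<alpha>).
     (X, f) \<in> over_obs C D L Y \<and> (X', g) \<in> over_obs C D L Y \<and> X' = X \<and> \<alpha> \<in> hom2 D f g}"

definition dbl_slice_over ::
    "('o, 'm, 't) two_cat \<Rightarrow> ('p, 'n, 's) two_cat \<Rightarrow> ('o, 'm, 't, 'p, 'n, 's) psf \<Rightarrow> 'p
      \<Rightarrow> ('o \<times> 'n, ('o, 'm, 'n, 's) slice_mor, ('o, 'n, 's) over_ver,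
          ('o, 'm, 'n, 's) slice_mor \<times> ('o, 'm, 'n, 's) slice_mor
            \<times> ('o, 'n, 's) over_ver \<times> ('o, 'n, 's) over_ver \<times> 't) dbl_cat" where
  "dbl_slice_over C D L Y = \<lparr>
     DOb = over_obs C D L Y,
     Hor = over_mors C D L Y,
     Ver = dbl_over_vers C D L Y,
     Sq = {((x, y, c, \<psi>), (x', y', d, \<phi>), (w, w', \<alpha>), (z, z', \<alpha>'), \<gamma>).
       (x, y, c, \<psi>) \<in> over_mors C D L Y \<and> (x', y', d, \<phi>) \<in> over_mors C D L Y \<and>
       (w, w', \<alpha>) \<in> dbl_over_vers C D L Y \<and> (z, z', \<alpha>') \<in> dbl_over_vers C D L Y \<and>
       w = x \<and> w' = x' \<and> z = y \<and> z' = y' \<and>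
       \<gamma> \<in> hom2 C c d \<and> \<alpha> \<bullet>\<^bsub>D\<^esub> \<psi> = \<phi> \<bullet>\<^bsub>D\<^esub> (\<alpha>' \<star>\<^bsub>D\<^esub> on_two L \<gamma>)},
     hdom = (\<lambda>(x, y, c, \<psi>). x),
     hcod = (\<lambda>(x, y, c, \<psi>). y),
     vdom = (\<lambda>(x, y, \<alpha>). x),
     vcod = (\<lambda>(x, y, \<alpha>). y),
     sq_top = (\<lambda>(t, b, l, r, \<gamma>). t),
     sq_bot = (\<lambda>(t, b, l, r, \<gamma>). b),
     sq_left = (\<lambda>(t, b, l, r, \<gamma>). l),
     sq_right = (\<lambda>(t, b, l, r, \<gamma>). r),
     hor_id = over_id1 C D,
     hor_comp = over_comp1 C D L,
     ver_id = (\<lambda>(X, f). ((X, f), (X, f), id2 D f)),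
     ver_comp = (\<lambda>(_, z, \<alpha>') (x, _, \<alpha>). (x, z, \<alpha>' \<bullet>\<^bsub>D\<^esub> \<alpha>)),
     sq_hid = (\<lambda>((X, f), (X', g), \<alpha>). (over_id1 C D (X, f), over_id1 C D (X', g),
       ((X, f), (X', g), \<alpha>), ((X, f), (X', g), \<alpha>), id2 C (id1 C X))),
     sq_hcomp = (\<lambda>(t', b', _, r, \<gamma>') (t, b, l, _, \<gamma>).
       (over_comp1 C D L t' t, over_comp1 C D L b' b, l, r, \<gamma>' \<star>\<^bsub>C\<^esub> \<gamma>)),
     sq_vid = (\<lambda>((X, f), (X', f'), c, \<psi>).
       (((X, f), (X', f'), c, \<psi>), ((X, f), (X', f'), c, \<psi>),
        ((X, f), (X, f), id2 D f), ((X', f'), (X', f'), id2 D f'), id2 C c)),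
     sq_vcomp = (\<lambda>(_, b, (_, w', \<alpha>1), (_, z', \<alpha>1'), \<gamma>') (t, _, (w, _, \<alpha>), (z, _, \<alpha>'), \<gamma>).
       (t, b, (w, w', \<alpha>1 \<bullet>\<^bsub>D\<^esub> \<alpha>), (z, z', \<alpha>1' \<bullet>\<^bsub>D\<^esub> \<alpha>'), \<gamma>' \<bullet>\<^bsub>C\<^esub> \<gamma>))\<rparr>"

section \<open>Double bi-initial and double bi-terminal objects\<close>

definition dbl_under_obs :: "('o, 'h, 'v, 'q) dbl_cat \<Rightarrow> 'o \<Rightarrow> ('o \<times> 'h) set" where
  "dbl_under_obs A I = {(X, f). X \<in> DOb A \<and> f \<in> hor A I X}"

definition dbl_under_hors ::
    "('o, 'h, 'v, 'q) dbl_cat \<Rightarrow> 'o \<Rightarrow> (('o \<times> 'h) \<times> ('o \<times> 'h) \<times> 'h \<times> 'q) set" where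
  "dbl_under_hors A I = {((X, f), (X', f'), a, \<psi>).
     (X, f) \<in> dbl_under_obs A I \<and> (X', f') \<in> dbl_under_obs A I \<and>
     a \<in> hor A X X' \<and> \<psi> \<in> vert_inv_sq A I X' f' (hor_comp A a f)}"

definition dbl_under_vers ::
    "('o, 'h, 'v, 'q) dbl_cat \<Rightarrow> 'o \<Rightarrow> (('o \<times> 'h) \<times> ('o \<times> 'h) \<times> 'v \<times> 'q) set" where
  "dbl_under_vers A I = {((X, f), (Y, g), u, \<gamma>).
     (X, f) \<in> dbl_under_obs A I \<and> (Y, g) \<in> dbl_under_obs A I \<and>
     u \<in> ver A X Y \<and> \<gamma> \<in> sq A f g (ver_id A I) u}"

definition dbl_under_hor_id ::
    "('o, 'h, 'v, 'q) dbl_cat \<Rightarrow> 'o \<times> 'h \<Rightarrow> ('o \<times> 'h) \<times> ('o \<times> 'h) \<times> 'h \<times> 'q" where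
  "dbl_under_hor_id A = (\<lambda>(X, f). ((X, f), (X, f), hor_id A X, sq_vid A f))"

definition dbl_under_hor_comp ::
    "('o, 'h, 'v, 'q) dbl_cat \<Rightarrow> ('o \<times> 'h) \<times> ('o \<times> 'h) \<times> 'h \<times> 'q
      \<Rightarrow> ('o \<times> 'h) \<times> ('o \<times> 'h) \<times> 'h \<times> 'q \<Rightarrow> ('o \<times> 'h) \<times> ('o \<times> 'h) \<times> 'h \<times> 'q" where
  "dbl_under_hor_comp A = (\<lambda>(_, z, a', \<psi>') (x, _, a, \<psi>).
     (x, z, hor_comp A a' a, sq_vcomp A (sq_hcomp A (sq_vid A a') \<psi>) \<psi>'))"

definition dbl_under_ver_id ::
    "('o, 'h, 'v, 'q) dbl_cat \<Rightarrow> 'o \<times> 'h \<Rightarrow> ('o \<times> 'h) \<times> ('o \<times> 'h) \<times> 'v \<times> 'q" where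
  "dbl_under_ver_id A = (\<lambda>(X, f). ((X, f), (X, f), ver_id A X, sq_vid A f))"

definition dbl_under_ver_comp ::
    "('o, 'h, 'v, 'q) dbl_cat \<Rightarrow> ('o \<times> 'h) \<times> ('o \<times> 'h) \<times> 'v \<times> 'q
      \<Rightarrow> ('o \<times> 'h) \<times> ('o \<times> 'h) \<times> 'v \<times> 'q \<Rightarrow> ('o \<times> 'h) \<times> ('o \<times> 'h) \<times> 'v \<times> 'q" where
  "dbl_under_ver_comp A = (\<lambda>(_, z, u', \<gamma>') (x, _, u, \<gamma>).
     (x, z, ver_comp A u' u, sq_vcomp A \<gamma>' \<gamma>))"

definition dbl_slice_under ::
    "('o, 'h, 'v, 'q) dbl_cat \<Rightarrow> 'o
      \<Rightarrow> ('o \<times> 'h, ('o \<times> 'h) \<times> ('o \<times> 'h) \<times> 'h \<times> 'q, ('o \<times> 'h) \<times> ('o \<times> 'h) \<times> 'v \<times> 'q,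
          (('o \<times> 'h) \<times> ('o \<times> 'h) \<times> 'h \<times> 'q) \<times> (('o \<times> 'h) \<times> ('o \<times> 'h) \<times> 'h \<times> 'q)
            \<times> (('o \<times> 'h) \<times> ('o \<times> 'h) \<times> 'v \<times> 'q) \<times> (('o \<times> 'h) \<times> ('o \<times> 'h) \<times> 'v \<times> 'q) \<times> 'q) dbl_cat" where
  "dbl_slice_under A I = \<lparr>
     DOb = dbl_under_obs A I,
     Hor = dbl_under_hors A I,
     Ver = dbl_under_vers A I,
     Sq = {((x, y, a, \<psi>), (x', y', b, \<phi>), (w, w', u, \<gamma>), (z, z', u', \<gamma>'), \<alpha>).
       (x, y, a, \<psi>) \<in> dbl_under_hors A I \<and> (x', y', b, \<phi>) \<in> dbl_under_hors A I \<and>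
       (w, w', u, \<gamma>) \<in> dbl_under_vers A I \<and> (z, z', u', \<gamma>') \<in> dbl_under_vers A I \<and>
       w = x \<and> w' = x' \<and> z = y \<and> z' = y' \<and>
       \<alpha> \<in> sq A a b u u' \<and>
       sq_vcomp A (sq_hcomp A \<alpha> \<gamma>) \<psi> = sq_vcomp A \<phi> \<gamma>'},
     hdom = (\<lambda>(x, y, a, \<psi>). x),
     hcod = (\<lambda>(x, y, a, \<psi>). y),
     vdom = (\<lambda>(x, y, u, \<gamma>). x),
     vcod = (\<lambda>(x, y, u, \<gamma>). y),
     sq_top = (\<lambda>(t, b, l, r, \<alpha>). t),
     sq_bot = (\<lambda>(t, b, l, r, \<alpha>). b),
     sq_left = (\<lambda>(t, b, l, r, \<alpha>). l),
     sq_right = (\<lambda>(t, b, l, r, \<alpha>). r),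
     hor_id = dbl_under_hor_id A,
     hor_comp = dbl_under_hor_comp A,
     ver_id = dbl_under_ver_id A,
     ver_comp = dbl_under_ver_comp A,
     sq_hid = (\<lambda>(x, y, u, \<gamma>). (dbl_under_hor_id A x, dbl_under_hor_id A y,
       (x, y, u, \<gamma>), (x, y, u, \<gamma>), sq_hid A u)),
     sq_hcomp = (\<lambda>(t', b', _, r, \<beta>) (t, b, l, _, \<alpha>).
       (dbl_under_hor_comp A t' t, dbl_under_hor_comp A b' b, l, r, sq_hcomp A \<beta> \<alpha>)),
     sq_vid = (\<lambda>(x, y, a, \<psi>). ((x, y, a, \<psi>), (x, y, a, \<psi>),
       dbl_under_ver_id A x, dbl_under_ver_id A y, sq_vid A a)),
     sq_vcomp = (\<lambda>(_, b, l', r', \<beta>) (t, _, l, r, \<alpha>).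
       (t, b, dbl_under_ver_comp A l' l, dbl_under_ver_comp A r' r, sq_vcomp A \<beta> \<alpha>))\<rparr>"

definition double_trivial_fibration ::
    "('o, 'h, 'v, 'q) dbl_cat \<Rightarrow> ('o2, 'h2, 'v2, 'q2) dbl_cat
      \<Rightarrow> ('o \<Rightarrow> 'o2) \<Rightarrow> ('h \<Rightarrow> 'h2) \<Rightarrow> ('v \<Rightarrow> 'v2) \<Rightarrow> ('q \<Rightarrow> 'q2) \<Rightarrow> bool" where
  "double_trivial_fibration A B Fo Fh Fv Fs \<longleftrightarrow>
     (\<forall>Y \<in> DOb B. \<exists>X \<in> DOb A. Fo X = Y) \<and>
     (\<forall>X \<in> DOb A. \<forall>X' \<in> DOb A. \<forall>b \<in> hor B (Fo X) (Fo X'). \<exists>a \<in> hor A X X'. Fh a = b) \<and>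
     (\<forall>v \<in> Ver B. \<exists>u \<in> Ver A. Fv u = v) \<and>
     (\<forall>t \<in> Hor A. \<forall>b \<in> Hor A. \<forall>l \<in> Ver A. \<forall>r \<in> Ver A.
        hdom A t = vdom A l \<and> hcod A t = vdom A r \<and> hdom A b = vcod A l \<and> hcod A b = vcod A r \<longrightarrow>
        (\<forall>\<beta> \<in> sq B (Fh t) (Fh b) (Fv l) (Fv r). \<exists>!\<alpha>. \<alpha> \<in> sq A t b l r \<and> Fs \<alpha> = \<beta>))"

definition double_bi_initial :: "('o, 'h, 'v, 'q) dbl_cat \<Rightarrow> 'o \<Rightarrow> bool" where
  "double_bi_initial A I \<longleftrightarrow> I \<in> DOb A \<and>
     double_trivial_fibration (dbl_slice_under A I) A
       (\<lambda>(X, f). X) (\<lambda>(x, y, a, \<psi>). a) (\<lambda>(x, y, u, \<gamma>). u) (\<lambda>(t, b, l, r, \<alpha>). \<alpha>)"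

definition double_bi_terminal :: "('o, 'h, 'v, 'q) dbl_cat \<Rightarrow> 'o \<Rightarrow> bool" where
  "double_bi_terminal A I \<longleftrightarrow> double_bi_initial (dbl_op A) I"

end

theory Submission
  imports Defs
begin

text \<open>For an object \<open>Y\<close> of \<open>D\<close>, call an arrow \<open>e : L R \<rightarrow> Y\<close> couniversal if, for every object \<open>X\<close> of \<open>C\<close>, the
functor \<open>C(X, R) \<rightarrow> D(L X, Y)\<close> sending \<open>h\<close> to \<open>e (L h)\<close> is essentially surjective and fully faithful. Each
of the four conditions is shown to mean that every \<open>Y\<close> admits a couniversal arrow; for \<open>ii\<close>, \<open>iii\<close> and
\<open>iv\<close> the equivalence holds for each single arrow.

The bi-terminal objects of a 2-category are those into which all hom-categories are contractible
(\<open>bi_terminal_iff\<close>), and the double bi-terminal objects are those into which every horizontal boundary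
along a given vertical morphism has a unique filling square (\<open>double_bi_terminal_iff\<close>). In the slice double
category, the squares into \<open>(R, e)\<close> along a 2-cell \<open>\<alpha>\<close> are the solutions \<open>\<gamma>\<close> of an equation
\<open>e (L \<gamma>) = \<phi>\<inverse> \<alpha> \<psi>\<close> with \<open>\<phi>\<close> and \<open>\<psi>\<close> invertible, so unique fillers express full faithfulness, while the
existence of morphisms into \<open>(R, e)\<close> is essential surjectivity. In the slice 2-category \<open>\<alpha>\<close> is
an identity, so only invertible values of \<open>e (L \<gamma>)\<close> are prescribed. Passing to arrow 2-categories brings back
all the others: a morphism into \<open>(R, id\<^sub>e)\<close> over \<open>\<alpha>\<close> is a square along \<open>\<alpha>\<close>, its
existence gives fullness, and faithfulness follows because the comparison between two squares with the
same boundary consists of endomorphisms in the slice, that is, of identities. Couniversality also makes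
\<open>(R, e)\<close> bi-terminal in the slice 2-category, as \<open>iii\<close> asks.

From a bi-adjunction one obtains \<open>e\<close> as the transpose of the identity of \<open>R Y\<close>; pseudo-naturality makes
\<open>h \<mapsto> e (L h)\<close> isomorphic to the given equivalence. Conversely, given couniversal arrows \<open>e\<^sub>Y\<close>, essential
surjectivity applied to \<open>d e\<^sub>Y\<close> defines \<open>R d\<close> together with an invertible 2-cell \<open>\<rho> d\<close> from \<open>e (L (R d))\<close> to \<open>d e\<close>, and the action of \<open>R\<close>
on 2-cells and its compositors are unique fillers of squares built from the \<open>\<rho> d\<close>. Everything then rests on the
fact that squares are closed under horizontal and vertical composition (\<open>over_square_hcomp\<close>,
\<open>over_square_vcomp\<close>) and under composition with arrows of \<open>D\<close> (\<open>over_square_whisker\<close>), while composition of their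
horizontal sides is associative (\<open>paste_assoc\<close>): the two sides of each axiom for \<open>R\<close> fill the same square.
The pseudo-naturality constraints are inverses of 2-cells of composites in the slices, and their coherence
(\<open>\<chi>_comp\<close>) is again an instance of these closure properties.\<close>

section \<open>Calculus of cells in a 2-category\<close>

lemma hom_cat_simps:
  "Obj (hom_cat C X Y) = hom1 C X Y" "Dom (hom_cat C X Y) = dom2 C"
  "Cod (hom_cat C X Y) = cod2 C" "Idn (hom_cat C X Y) = id2 C" "Comp (hom_cat C X Y) = vcomp C"
  by (simp_all add: hom_cat_def)

context two_category
begin

text \<open>The axioms are restated with membership conditions and equations between sources and targets in place
  of hom-sets: the simplifier can compute a boundary, but it cannot guess the intermediate objects and
  morphisms in a hypothesis such as \<open>f \<in> hom1 C X Y\<close>.\<close>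

lemma Homs_hom_cat:
  "f \<in> hom1 C X Y \<Longrightarrow> g \<in> hom1 C X Y \<Longrightarrow> Homs (hom_cat C X Y) f g = hom2 C f g"
  by (auto simp: Homs_def hom_cat_def hom1_def hom2_def)

lemma comp1_cell [simp]:
  assumes "f \<in> Mor C" "g \<in> Mor C" "dom1 C g = cod1 C f"
  shows "g \<cdot> f \<in> Mor C" "dom1 C (g \<cdot> f) = dom1 C f" "cod1 C (g \<cdot> f) = cod1 C g"
  using comp1_hom1[of f "dom1 C f" "cod1 C f" g "cod1 C g"] assms by (auto simp: hom1_def)

lemma id1_cell [simp]:
  assumes "X \<in> Ob C"
  shows "id1 C X \<in> Mor C" "dom1 C (id1 C X) = X" "cod1 C (id1 C X) = X"
  using id1_hom1[OF assms] by (auto simp: hom1_def)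

lemmas [simp] = dom1_Ob cod1_Ob dom2_Mor cod2_Mor

lemma cod2_boundary [simp]:
  assumes "\<alpha> \<in> Two C"
  shows "dom1 C (cod2 C \<alpha>) = dom1 C (dom2 C \<alpha>)" "cod1 C (cod2 C \<alpha>) = cod1 C (dom2 C \<alpha>)"
  using dom1_dom2[OF assms] cod1_dom2[OF assms] by simp_all

lemma Arr_Homs:
  assumes "\<alpha> \<in> Two C" and "X = dom1 C (dom2 C \<alpha>)" and "Y = cod1 C (dom2 C \<alpha>)"
  shows "\<alpha> \<in> Homs (hom_cat C X Y) (dom2 C \<alpha>) (cod2 C \<alpha>)"
  using assms by (auto simp: Homs_def hom_cat_def hom1_def)

lemma hom_category_of: "f \<in> Mor C \<Longrightarrow> category (hom_cat C (dom1 C f) (cod1 C f))"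
  by (simp add: hom_category)

lemma id2_cell [simp]:
  assumes "f \<in> Mor C"
  shows "id2 C f \<in> Two C" "dom2 C (id2 C f) = f" "cod2 C (id2 C f) = f"
  using category.Idn_Homs[OF hom_category_of[OF assms], of f] assms
  by (auto simp: hom_cat_def hom1_def Homs_def)

lemma vcomp_cell [simp]:
  assumes "\<alpha> \<in> Two C" "\<beta> \<in> Two C" "dom2 C \<beta> = cod2 C \<alpha>"
  shows "\<beta> \<bullet> \<alpha> \<in> Two C" "dom2 C (\<beta> \<bullet> \<alpha>) = dom2 C \<alpha>" "cod2 C (\<beta> \<bullet> \<alpha>) = cod2 C \<beta>"
proof -
  let ?H = "hom_cat C (dom1 C (dom2 C \<alpha>)) (cod1 C (dom2 C \<alpha>))"
  have "\<beta> \<bullet> \<alpha> \<in> Homs ?H (dom2 C \<alpha>) (cod2 C \<beta>)"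
    using category.Comp_Homs[OF hom_category_of Arr_Homs[OF assms(1) refl refl], of \<beta> "cod2 C \<beta>"]
      Arr_Homs[OF assms(2)] assms
    by (simp add: hom_cat_simps)
  then show "\<beta> \<bullet> \<alpha> \<in> Two C" "dom2 C (\<beta> \<bullet> \<alpha>) = dom2 C \<alpha>" "cod2 C (\<beta> \<bullet> \<alpha>) = cod2 C \<beta>"
    by (auto simp: Homs_def hom_cat_def)
qed

lemma vcomp_id2 [simp]:
  assumes "\<alpha> \<in> Two C" "dom2 C \<alpha> = f"
  shows "\<alpha> \<bullet> id2 C f = \<alpha>"
  using category.Comp_Idn[OF hom_category_of Arr_Homs[OF assms(1) refl refl]] assms(1)
  unfolding assms(2)[symmetric] by (simp add: hom_cat_simps)

lemma id2_vcomp [simp]: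
  assumes "\<alpha> \<in> Two C" "cod2 C \<alpha> = f"
  shows "id2 C f \<bullet> \<alpha> = \<alpha>"
  using category.Idn_Comp[OF hom_category_of Arr_Homs[OF assms(1) refl refl]] assms(1)
  unfolding assms(2)[symmetric] by (simp add: hom_cat_simps)

lemma vcomp_assoc [simp]:
  assumes "\<alpha> \<in> Two C" "\<beta> \<in> Two C" "\<gamma> \<in> Two C" "dom2 C \<beta> = cod2 C \<alpha>" "dom2 C \<gamma> = cod2 C \<beta>"
  shows "(\<gamma> \<bullet> \<beta>) \<bullet> \<alpha> = \<gamma> \<bullet> (\<beta> \<bullet> \<alpha>)"
proof -
  let ?H = "hom_cat C (dom1 C (dom2 C \<alpha>)) (cod1 C (dom2 C \<alpha>))"
  have "\<beta> \<in> Homs ?H (cod2 C \<alpha>) (cod2 C \<beta>)" "\<gamma> \<in> Homs ?H (cod2 C \<beta>) (cod2 C \<gamma>)"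
    using Arr_Homs[OF assms(2)] Arr_Homs[OF assms(3)] assms
    by (metis cod2_boundary)+
  then show ?thesis
    using category.Comp_assoc[OF hom_category_of Arr_Homs[OF assms(1) refl refl]] assms
    by (simp add: hom_cat_simps)
qed

lemma hcomp_cell [simp]:
  assumes "\<alpha> \<in> Two C" "\<beta> \<in> Two C" "dom1 C (dom2 C \<beta>) = cod1 C (dom2 C \<alpha>)"
  shows "\<beta> \<star> \<alpha> \<in> Two C" "dom2 C (\<beta> \<star> \<alpha>) = dom2 C \<beta> \<cdot> dom2 C \<alpha>"
    "cod2 C (\<beta> \<star> \<alpha>) = cod2 C \<beta> \<cdot> cod2 C \<alpha>"
  using hcomp_hom2[of "dom2 C \<alpha>" "dom1 C (dom2 C \<alpha>)" "cod1 C (dom2 C \<alpha>)" "dom2 C \<beta>"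
      "cod1 C (dom2 C \<beta>)" \<alpha> "cod2 C \<alpha>" \<beta> "cod2 C \<beta>"] assms
  by (auto simp: hom1_def hom2_def)

lemma comp1_units [simp]:
  "f \<in> Mor C \<Longrightarrow> dom1 C f = X \<Longrightarrow> f \<cdot> id1 C X = f"
  "f \<in> Mor C \<Longrightarrow> cod1 C f = Y \<Longrightarrow> id1 C Y \<cdot> f = f"
  using comp1_id1 id1_comp1 by (auto simp: hom1_def)

lemma comp1_assoc' [simp]:
  assumes "f \<in> Mor C" "g \<in> Mor C" "h \<in> Mor C" "dom1 C g = cod1 C f" "dom1 C h = cod1 C g"
  shows "(h \<cdot> g) \<cdot> f = h \<cdot> (g \<cdot> f)"
  using comp1_assoc[of f "dom1 C f" "cod1 C f" g "cod1 C g" h "cod1 C h"] assms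
  by (simp add: hom1_def)

lemma hcomp_units [simp]:
  "\<alpha> \<in> Two C \<Longrightarrow> dom1 C (dom2 C \<alpha>) = X \<Longrightarrow> \<alpha> \<star> id2 C (id1 C X) = \<alpha>"
  "\<alpha> \<in> Two C \<Longrightarrow> cod1 C (dom2 C \<alpha>) = Y \<Longrightarrow> id2 C (id1 C Y) \<star> \<alpha> = \<alpha>"
  using hcomp_id1[of "dom2 C \<alpha>" "dom1 C (dom2 C \<alpha>)" "cod1 C (dom2 C \<alpha>)" \<alpha> "cod2 C \<alpha>"]
    id1_hcomp[of "dom2 C \<alpha>" "dom1 C (dom2 C \<alpha>)" "cod1 C (dom2 C \<alpha>)" \<alpha> "cod2 C \<alpha>"]
  by (auto simp: hom1_def hom2_def)

lemma hcomp_assoc' [simp]: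
  assumes "\<alpha> \<in> Two C" "\<beta> \<in> Two C" "\<gamma> \<in> Two C"
    "dom1 C (dom2 C \<beta>) = cod1 C (dom2 C \<alpha>)" "dom1 C (dom2 C \<gamma>) = cod1 C (dom2 C \<beta>)"
  shows "(\<gamma> \<star> \<beta>) \<star> \<alpha> = \<gamma> \<star> (\<beta> \<star> \<alpha>)"
  using hcomp_assoc[of "dom2 C \<alpha>" "dom1 C (dom2 C \<alpha>)" "cod1 C (dom2 C \<alpha>)" "dom2 C \<beta>"
      "cod1 C (dom2 C \<beta>)" "dom2 C \<gamma>" "cod1 C (dom2 C \<gamma>)" \<alpha> "cod2 C \<alpha>" \<beta> "cod2 C \<beta>" \<gamma> "cod2 C \<gamma>"] assms
  by (simp add: hom1_def hom2_def)

lemma hcomp_id2s [simp]: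
  assumes "f \<in> Mor C" "g \<in> Mor C" "dom1 C g = cod1 C f"
  shows "id2 C g \<star> id2 C f = id2 C (g \<cdot> f)"
  using hcomp_id2[of f "dom1 C f" "cod1 C f" g "cod1 C g"] assms by (simp add: hom1_def)

lemma interchange':
  assumes "\<alpha> \<in> Two C" "\<beta> \<in> Two C" "dom2 C \<beta> = cod2 C \<alpha>"
    and "\<alpha>' \<in> Two C" "\<beta>' \<in> Two C" "dom2 C \<beta>' = cod2 C \<alpha>'"
    and "dom1 C (dom2 C \<alpha>') = cod1 C (dom2 C \<alpha>)"
  shows "(\<beta>' \<star> \<beta>) \<bullet> (\<alpha>' \<star> \<alpha>) = (\<beta>' \<bullet> \<alpha>') \<star> (\<beta> \<bullet> \<alpha>)"
  using interchange[of "dom2 C \<alpha>" "dom1 C (dom2 C \<alpha>)" "cod1 C (dom2 C \<alpha>)" "dom2 C \<alpha>'"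
      "cod1 C (dom2 C \<alpha>')" \<alpha> "cod2 C \<alpha>" \<beta> "cod2 C \<beta>" \<alpha>' "cod2 C \<alpha>'" \<beta>' "cod2 C \<beta>'"] assms
  by (simp add: hom1_def hom2_def)

lemma whisker_merge [simp]:
  assumes "f \<in> Mor C" "g \<in> Mor C" "\<alpha> \<in> Two C" "dom1 C g = cod1 C f" "dom1 C f = cod1 C (dom2 C \<alpha>)"
  shows "id2 C g \<star> (id2 C f \<star> \<alpha>) = id2 C (g \<cdot> f) \<star> \<alpha>"
  using hcomp_assoc'[of \<alpha> "id2 C f" "id2 C g"] assms by simp

text \<open>Distributing whiskerings over vertical composites, with \<open>vcomp_assoc\<close>, \<open>hcomp_assoc'\<close>
  and \<open>whisker_merge\<close>, brings a pasting into the form of a vertical composite of cells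
  \<open>id2 g \<star> (\<alpha> \<star> id2 f)\<close>; what this normal form does not decide is the order in which
  two horizontally disjoint cells occur, for which \<open>interchange'\<close> is needed.\<close>

lemma whisker_vcomp:
  assumes "\<alpha> \<in> Two C" "\<beta> \<in> Two C" "dom2 C \<beta> = cod2 C \<alpha>" "f \<in> Mor C"
  shows "dom1 C f = cod1 C (dom2 C \<alpha>) \<Longrightarrow> id2 C f \<star> (\<beta> \<bullet> \<alpha>) = (id2 C f \<star> \<beta>) \<bullet> (id2 C f \<star> \<alpha>)"
    and "cod1 C f = dom1 C (dom2 C \<alpha>) \<Longrightarrow> (\<beta> \<bullet> \<alpha>) \<star> id2 C f = (\<beta> \<star> id2 C f) \<bullet> (\<alpha> \<star> id2 C f)"
  using interchange'[of \<alpha> \<beta> "id2 C f" "id2 C f"] interchange'[of "id2 C f" "id2 C f" \<alpha> \<beta>] assms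
  by simp_all

lemma inverse2_sym: "inverse2 C \<alpha> \<beta> \<Longrightarrow> inverse2 C \<beta> \<alpha>"
  by (auto simp: inverse2_def hom2_def)

lemma inverse2_unique:
  assumes "inverse2 C \<alpha> \<beta>" "inverse2 C \<alpha> \<beta>'"
  shows "\<beta> = \<beta>'"
proof -
  note [simp] = assms[unfolded inverse2_def hom2_def mem_Collect_eq]
  have "\<beta> = \<beta> \<bullet> (\<alpha> \<bullet> \<beta>')" by simp
  also have "\<dots> = (\<beta> \<bullet> \<alpha>) \<bullet> \<beta>'" by (rule vcomp_assoc[symmetric]) simp_all
  also have "\<dots> = \<beta>'" by (simp del: vcomp_assoc)
  finally show ?thesis .
qed

lemma iso2_cell: "\<alpha> \<in> iso2 C f g \<Longrightarrow> \<alpha> \<in> Two C \<and> dom2 C \<alpha> = f \<and> cod2 C \<alpha> = g"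
  by (simp add: iso2_def hom2_def)

lemma inv2_inverse2: "\<alpha> \<in> iso2 C f g \<Longrightarrow> inverse2 C \<alpha> (inv2 C \<alpha>)"
  unfolding inv2_def iso2_def using inverse2_unique by (blast intro: theI)

lemma inv2_iso2: "\<alpha> \<in> iso2 C f g \<Longrightarrow> inv2 C \<alpha> \<in> iso2 C g f"
  using inv2_inverse2[of \<alpha> f g] inverse2_sym
  by (force simp: iso2_def inverse2_def hom2_def)

lemma inv2_laws:
  assumes "\<alpha> \<in> iso2 C f g"
  shows "inv2 C \<alpha> \<bullet> \<alpha> = id2 C f" "\<alpha> \<bullet> inv2 C \<alpha> = id2 C g"
  using inv2_inverse2[OF assms] iso2_cell[OF assms] by (auto simp: inverse2_def)

lemma inv2_cancel:
  assumes "\<alpha> \<in> iso2 C f g"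
  shows "\<beta> \<in> Two C \<Longrightarrow> cod2 C \<beta> = f \<Longrightarrow> inv2 C \<alpha> \<bullet> (\<alpha> \<bullet> \<beta>) = \<beta>"
    and "\<beta> \<in> Two C \<Longrightarrow> cod2 C \<beta> = g \<Longrightarrow> \<alpha> \<bullet> (inv2 C \<alpha> \<bullet> \<beta>) = \<beta>"
  using inv2_laws[OF assms] iso2_cell[OF assms] iso2_cell[OF inv2_iso2[OF assms]]
    vcomp_assoc[of \<beta> \<alpha> "inv2 C \<alpha>"] vcomp_assoc[of \<beta> "inv2 C \<alpha>" \<alpha>]
  by auto

lemma iso2I: "inverse2 C \<alpha> \<beta> \<Longrightarrow> \<alpha> \<in> iso2 C (dom2 C \<alpha>) (cod2 C \<alpha>)"
  by (auto simp: iso2_def hom2_def inverse2_def)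

lemma inv2_eq: "inverse2 C \<alpha> \<beta> \<Longrightarrow> inv2 C \<alpha> = \<beta>"
  using inv2_inverse2[OF iso2I] inverse2_unique by blast

lemma iso2_id2:
  assumes "f \<in> Mor C"
  shows "id2 C f \<in> iso2 C f f" "inv2 C (id2 C f) = id2 C f"
proof -
  have "inverse2 C (id2 C f) (id2 C f)" using assms by (simp add: inverse2_def hom2_def)
  from iso2I[OF this] inv2_eq[OF this] show "id2 C f \<in> iso2 C f f" "inv2 C (id2 C f) = id2 C f"
    using assms by simp_all
qed

declare iso2_id2(2) [simp]

lemma iso2_vcomp:
  assumes a: "\<alpha> \<in> iso2 C f g" and b: "\<beta> \<in> iso2 C g h"
  shows "\<beta> \<bullet> \<alpha> \<in> iso2 C f h" "inv2 C (\<beta> \<bullet> \<alpha>) = inv2 C \<alpha> \<bullet> inv2 C \<beta>"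
proof -
  note [simp] = iso2_cell[OF a] iso2_cell[OF b] iso2_cell[OF inv2_iso2[OF a]]
    iso2_cell[OF inv2_iso2[OF b]] inv2_laws[OF a] inv2_laws[OF b] inv2_cancel[OF a] inv2_cancel[OF b]
  have "inverse2 C (\<beta> \<bullet> \<alpha>) (inv2 C \<alpha> \<bullet> inv2 C \<beta>)"
    by (simp add: inverse2_def hom2_def)
  from iso2I[OF this] inv2_eq[OF this]
  show "\<beta> \<bullet> \<alpha> \<in> iso2 C f h" "inv2 C (\<beta> \<bullet> \<alpha>) = inv2 C \<alpha> \<bullet> inv2 C \<beta>" by simp_all
qed

lemma iso2_hcomp:
  assumes a: "\<alpha> \<in> iso2 C f g" and b: "\<beta> \<in> iso2 C f' g'" and "dom1 C f' = cod1 C f"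
  shows "\<beta> \<star> \<alpha> \<in> iso2 C (f' \<cdot> f) (g' \<cdot> g)" "inv2 C (\<beta> \<star> \<alpha>) = inv2 C \<beta> \<star> inv2 C \<alpha>"
proof -
  note c = iso2_cell[OF a] iso2_cell[OF b] iso2_cell[OF inv2_iso2[OF a]] iso2_cell[OF inv2_iso2[OF b]]
  note [simp] = c inv2_laws[OF a] inv2_laws[OF b] assms(3)
  have [simp]: "f \<in> Mor C" "f' \<in> Mor C" "g \<in> Mor C" "g' \<in> Mor C" "dom1 C g' = dom1 C f'" "cod1 C g = cod1 C f"
    using c dom2_Mor cod2_Mor cod2_boundary by metis+
  have "inverse2 C (\<beta> \<star> \<alpha>) (inv2 C \<beta> \<star> inv2 C \<alpha>)"
    by (simp add: inverse2_def hom2_def interchange')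
  from iso2I[OF this] inv2_eq[OF this]
  show "\<beta> \<star> \<alpha> \<in> iso2 C (f' \<cdot> f) (g' \<cdot> g)" "inv2 C (\<beta> \<star> \<alpha>) = inv2 C \<beta> \<star> inv2 C \<alpha>" by simp_all
qed

lemma iso2_whisker:
  assumes "\<alpha> \<in> iso2 C f g" "h \<in> Mor C"
  shows "dom1 C h = cod1 C f \<Longrightarrow> id2 C h \<star> \<alpha> \<in> iso2 C (h \<cdot> f) (h \<cdot> g)"
    "dom1 C h = cod1 C f \<Longrightarrow> inv2 C (id2 C h \<star> \<alpha>) = id2 C h \<star> inv2 C \<alpha>"
    "dom1 C f = cod1 C h \<Longrightarrow> \<alpha> \<star> id2 C h \<in> iso2 C (f \<cdot> h) (g \<cdot> h)"
    "dom1 C f = cod1 C h \<Longrightarrow> inv2 C (\<alpha> \<star> id2 C h) = inv2 C \<alpha> \<star> id2 C h"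
  using iso2_hcomp[OF assms(1) iso2_id2(1)[OF assms(2)]] iso2_hcomp[OF iso2_id2(1)[OF assms(2)] assms(1)]
    iso2_id2(2)[OF assms(2)] assms
  by simp_all

end

lemma hom1_iff: "f \<in> hom1 C X Y \<longleftrightarrow> f \<in> Mor C \<and> dom1 C f = X \<and> cod1 C f = Y"
  by (simp add: hom1_def)

lemma hom2_iff: "\<alpha> \<in> hom2 C f g \<longleftrightarrow> \<alpha> \<in> Two C \<and> dom2 C \<alpha> = f \<and> cod2 C \<alpha> = g"
  by (simp add: hom2_def)

section \<open>Terminality as contractibility of hom-categories\<close>

lemma op2_simps [simp]:
  "Ob (op2 A) = Ob A" "Mor (op2 A) = Mor A" "Two (op2 A) = Two A" "dom1 (op2 A) = cod1 A"
  "cod1 (op2 A) = dom1 A" "dom2 (op2 A) = dom2 A" "cod2 (op2 A) = cod2 A" "id1 (op2 A) = id1 A"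
  "id2 (op2 A) = id2 A" "comp1 (op2 A) g f = comp1 A f g" "vcomp (op2 A) = vcomp A"
  "hcomp (op2 A) \<beta> \<alpha> = hcomp A \<alpha> \<beta>"
  by (simp_all add: op2_def)

lemma op2_homs [simp]:
  "hom1 (op2 A) X Y = hom1 A Y X" "hom2 (op2 A) f g = hom2 A f g"
  "iso2 (op2 A) f g = iso2 A f g"
  by (auto simp: hom1_def hom2_def iso2_def inverse2_def)

lemma trivial_fibrationD:
  assumes "trivial_fibration A B F0 F1 F2"
  shows "Y \<in> Ob B \<Longrightarrow> \<exists>X \<in> Ob A. F0 X = Y"
    and "X \<in> Ob A \<Longrightarrow> X' \<in> Ob A \<Longrightarrow> b \<in> hom1 B (F0 X) (F0 X') \<Longrightarrow> \<exists>a \<in> hom1 A X X'. F1 a = b"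
    and "X \<in> Ob A \<Longrightarrow> X' \<in> Ob A \<Longrightarrow> a \<in> hom1 A X X' \<Longrightarrow> a' \<in> hom1 A X X' \<Longrightarrow>
      \<beta> \<in> hom2 B (F1 a) (F1 a') \<Longrightarrow> \<exists>!\<alpha>. \<alpha> \<in> hom2 A a a' \<and> F2 \<alpha> = \<beta>"
  using assms by (simp_all add: trivial_fibration_def)

definition contractible_homs_to :: "('o, 'm, 't) two_cat \<Rightarrow> 'o \<Rightarrow> bool" where
  "contractible_homs_to A T \<longleftrightarrow> T \<in> Ob A \<and>
     (\<forall>X \<in> Ob A. hom1 A X T \<noteq> {} \<and>
       (\<forall>f \<in> hom1 A X T. \<forall>g \<in> hom1 A X T. \<exists>!\<gamma>. \<gamma> \<in> hom2 A f g))"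

text \<open>Fullness of the projection from the slice at an identity compares any two morphisms into \<open>T\<close>; full
  faithfulness on 2-cells shows that every 2-cell between them agrees with this comparison.\<close>

lemma (in two_category) bi_terminal_imp_contractible:
  assumes T: "bi_terminal C T"
  shows "contractible_homs_to C T"
proof -
  let ?U = "slice_under (op2 C) T"
  have TOb: "T \<in> Ob C" using T by (simp add: bi_terminal_def bi_initial_def)
  have tf: "trivial_fibration ?U (op2 C) (\<lambda>(X, f). X) (\<lambda>(x, y, a, \<psi>). a) (\<lambda>(p, q, \<beta>). \<beta>)"
    using T by (simp add: bi_terminal_def bi_initial_def)
  have ob: "(X, f) \<in> Ob ?U \<longleftrightarrow> X \<in> Ob C \<and> f \<in> hom1 C X T" for X f
    by (simp add: slice_under_def under_obs_def)
  have hom: "((X, f), (Y, g), a, \<psi>) \<in> hom1 ?U (X', f') (Y', g') \<longleftrightarrow> X' = X \<and> f' = f \<and> Y' = Y \<and> g' = g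
      \<and> (X, f) \<in> Ob ?U \<and> (Y, g) \<in> Ob ?U \<and> a \<in> hom1 C Y X \<and> \<psi> \<in> iso2 C g (f \<cdot> a)"
    for X f Y g a \<psi> X' f' Y' g'
    by (auto simp: hom1_def slice_under_def under_obs_def under_mors_def)
  have surj: "\<exists>f. (X, f) \<in> Ob ?U" if "X \<in> Ob C" for X
    using trivial_fibrationD(1)[OF tf, of X] that by fastforce
  have full: "\<exists>\<psi>. \<psi> \<in> iso2 C g (f \<cdot> a)"
    if "(X, f) \<in> Ob ?U" "(Y, g) \<in> Ob ?U" "a \<in> hom1 C Y X" for X f Y g a
  proof -
    have "\<exists>m \<in> hom1 ?U (X, f) (Y, g). (\<lambda>(x, y, a, \<psi>). a) m = a"
      using trivial_fibrationD(2)[OF tf that(1,2), of a] that(3) by simp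
    then show ?thesis by (auto simp: hom)
  qed
  have faithful: "(id2 C f \<star> \<beta>) \<bullet> \<psi> = \<phi>"
    if m: "((X, f), (Y, g), a, \<psi>) \<in> hom1 ?U (X, f) (Y, g)"
      and n: "((X, f), (Y, g), b, \<phi>) \<in> hom1 ?U (X, f) (Y, g)" and "\<beta> \<in> hom2 C a b"
    for X f Y g a b \<psi> \<phi> \<beta>
  proof -
    have "(X, f) \<in> Ob ?U" "(Y, g) \<in> Ob ?U" using m by (auto simp: hom)
    moreover have "\<beta> \<in> hom2 (op2 C) ((\<lambda>(x, y, a, \<psi>). a) ((X, f), (Y, g), a, \<psi>))
        ((\<lambda>(x, y, a, \<psi>). a) ((X, f), (Y, g), b, \<phi>))" using that by simp
    ultimately obtain \<theta> where "\<theta> \<in> hom2 ?U ((X, f), (Y, g), a, \<psi>) ((X, f), (Y, g), b, \<phi>)"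
      "(\<lambda>(p, q, \<beta>). \<beta>) \<theta> = \<beta>"
      using trivial_fibrationD(3)[OF tf _ _ m n, of \<beta>] by blast
    then show ?thesis by (auto simp: hom2_def slice_under_def)
  qed
  have "\<exists>!\<gamma>. \<gamma> \<in> hom2 C f g" if X: "X \<in> Ob C" and f: "f \<in> hom1 C X T" and g: "g \<in> hom1 C X T" for X f g
  proof -
    have c: "f \<in> Mor C" "dom1 C f = X" "cod1 C f = T" "g \<in> Mor C" "dom1 C g = X" "cod1 C g = T"
      using f g by (auto simp: hom1_def)
    have "\<exists>\<psi>. \<psi> \<in> iso2 C f (g \<cdot> id1 C X)"
      using full[of X g X f "id1 C X"] X f g by (simp add: ob hom1_def)
    then obtain \<psi> where psi: "\<psi> \<in> iso2 C f g" using c by auto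
    show ?thesis
    proof (rule ex1I)
      show "\<psi> \<in> hom2 C f g" using psi by (simp add: iso2_def)
      fix \<gamma> assume \<gamma>: "\<gamma> \<in> hom2 C f g"
      \<comment> \<open>Regard \<open>\<gamma>\<close> as a 2-cell from \<open>(f, id)\<close> to \<open>(g, \<psi>)\<close>, morphisms between \<open>(T, id)\<close>
        and \<open>(X, f)\<close> in the slice: its compatibility condition says \<open>\<gamma> = \<psi>\<close>.\<close>
      have "(id2 C (id1 C T) \<star> \<gamma>) \<bullet> id2 C f = \<psi>"
        using psi \<gamma> f g c X TOb
        by (intro faithful[of T "id1 C T" X f f "id2 C f" g \<psi>], unfold hom)
          (simp_all add: ob iso2_id2 hom1_iff)
      then show "\<gamma> = \<psi>" using \<gamma> c by (simp add: hom2_def)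
    qed
  qed
  then show ?thesis using TOb surj by (fastforce simp: contractible_homs_to_def ob)
qed

text \<open>Since parallel 2-cells between morphisms into \<open>T\<close> are equal, the 2-cells that contractibility provides are
  invertible, and the condition for a 2-cell to lift to the slice always holds.\<close>

lemma (in two_category) contractible_imp_bi_terminal:
  assumes T: "contractible_homs_to C T"
  shows "bi_terminal C T"
proof -
  let ?U = "slice_under (op2 C) T"
  have TOb: "T \<in> Ob C" and inh: "\<And>X. X \<in> Ob C \<Longrightarrow> \<exists>f. f \<in> hom1 C X T"
    and ex: "\<And>X f g. X \<in> Ob C \<Longrightarrow> f \<in> hom1 C X T \<Longrightarrow> g \<in> hom1 C X T \<Longrightarrow> \<exists>\<gamma>. \<gamma> \<in> hom2 C f g"
    and uq: "\<And>X f g \<gamma> \<gamma>'. X \<in> Ob C \<Longrightarrow> f \<in> hom1 C X T \<Longrightarrow> g \<in> hom1 C X T \<Longrightarrow>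
       \<gamma> \<in> hom2 C f g \<Longrightarrow> \<gamma>' \<in> hom2 C f g \<Longrightarrow> \<gamma> = \<gamma>'"
    using T unfolding contractible_homs_to_def by blast+
  have iso: "\<exists>\<psi>. \<psi> \<in> iso2 C f g" if X: "X \<in> Ob C" and f: "f \<in> hom1 C X T" and g: "g \<in> hom1 C X T" for X f g
  proof -
    obtain \<psi> \<psi>' where p: "\<psi> \<in> hom2 C f g" "\<psi>' \<in> hom2 C g f" using ex[OF X f g] ex[OF X g f] by blast
    have "\<psi>' \<bullet> \<psi> = id2 C f" by (rule uq[OF X f f]) (use p f in \<open>auto simp: hom2_def hom1_def\<close>)
    moreover have "\<psi> \<bullet> \<psi>' = id2 C g" by (rule uq[OF X g g]) (use p g in \<open>auto simp: hom2_def hom1_def\<close>)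
    ultimately have "inverse2 C \<psi> \<psi>'" using p by (auto simp: inverse2_def hom2_def)
    then show ?thesis using p by (auto simp: iso2_def)
  qed
  have "trivial_fibration ?U (op2 C) (\<lambda>(X, f). X) (\<lambda>(x, y, a, \<psi>). a) (\<lambda>(p, q, \<beta>). \<beta>)"
    unfolding trivial_fibration_def
  proof (intro conjI ballI)
    fix X assume "X \<in> Ob (op2 C)"
    then show "\<exists>x\<in>Ob ?U. (case x of (X, f) \<Rightarrow> X) = X"
      using inh[of X] by (auto simp: slice_under_def under_obs_def)
  next
    fix x y b
    assume "x \<in> Ob ?U" "y \<in> Ob ?U" and b: "b \<in> hom1 (op2 C) (case x of (X, f) \<Rightarrow> X) (case y of (X, f) \<Rightarrow> X)"
    then obtain X f Y g where x: "x = (X, f)" "X \<in> Ob C" "f \<in> hom1 C X T"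
      and y: "y = (Y, g)" "Y \<in> Ob C" "g \<in> hom1 C Y T"
      by (auto simp: slice_under_def under_obs_def)
    have "f \<cdot> b \<in> hom1 C Y T" using b x y by (auto intro: comp1_hom1)
    then obtain \<psi> where "\<psi> \<in> iso2 C g (f \<cdot> b)" using iso y by blast
    then have "((X, f), (Y, g), b, \<psi>) \<in> hom1 ?U x y"
      using b x y by (auto simp: hom1_def slice_under_def under_obs_def under_mors_def)
    then show "\<exists>a\<in>hom1 ?U x y. (case a of (x, y, a, \<psi>) \<Rightarrow> a) = b" by force
  next
    fix x y m n \<beta>
    assume "x \<in> Ob ?U" "y \<in> Ob ?U" and m: "m \<in> hom1 ?U x y" and n: "n \<in> hom1 ?U x y"
      and b: "\<beta> \<in> hom2 (op2 C) (case m of (x, y, a, \<psi>) \<Rightarrow> a) (case n of (x, y, a, \<psi>) \<Rightarrow> a)"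
    then obtain X f Y g a \<psi> a' \<phi> where x: "x = (X, f)" "X \<in> Ob C" "f \<in> hom1 C X T"
      and y: "y = (Y, g)" "Y \<in> Ob C" "g \<in> hom1 C Y T"
      and m': "m = ((X, f), (Y, g), a, \<psi>)" "a \<in> hom1 C Y X" "\<psi> \<in> iso2 C g (f \<cdot> a)"
      and n': "n = ((X, f), (Y, g), a', \<phi>)" "a' \<in> hom1 C Y X" "\<phi> \<in> iso2 C g (f \<cdot> a')"
      by (auto simp: hom1_def slice_under_def under_obs_def under_mors_def)
    have b': "\<beta> \<in> hom2 C a a'" using b m' n' by simp
    have "(id2 C f \<star> \<beta>) \<bullet> \<psi> = \<phi>"
    proof (rule uq[OF y(2,3)])
      show "f \<cdot> a' \<in> hom1 C Y T" using x n' by (auto intro: comp1_hom1)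
      show "(id2 C f \<star> \<beta>) \<bullet> \<psi> \<in> hom2 C g (f \<cdot> a')" "\<phi> \<in> hom2 C g (f \<cdot> a')"
        using b' x y m' n' iso2_cell[OF m'(3)] iso2_cell[OF n'(3)] by (auto simp: hom1_def hom2_def)
    qed
    then have "(m, n, \<beta>) \<in> hom2 ?U m n"
      using m n m' n' b' by (auto simp: hom1_def hom2_def slice_under_def)
    then show "\<exists>!\<alpha>. \<alpha> \<in> hom2 ?U m n \<and> (case \<alpha> of (p, q, \<beta>) \<Rightarrow> \<beta>) = \<beta>"
      by (auto simp: hom2_def slice_under_def)
  qed
  then show ?thesis using TOb by (simp add: bi_terminal_def bi_initial_def)
qed

lemma (in two_category) bi_terminal_iff: "bi_terminal C T \<longleftrightarrow> contractible_homs_to C T"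
  using bi_terminal_imp_contractible contractible_imp_bi_terminal by blast


text \<open>When \<open>u\<close> is a vertical identity, this is \<open>contractible_homs_to\<close> for the 2-category formed by the squares
  between vertical identities.\<close>

definition contractible_squares_to :: "('o, 'h, 'v, 'q) dbl_cat \<Rightarrow> 'o \<Rightarrow> bool" where
  "contractible_squares_to A T \<longleftrightarrow> T \<in> DOb A \<and> (\<forall>X \<in> DOb A. hor A X T \<noteq> {}) \<and>
     (\<forall>u \<in> Ver A. \<forall>f \<in> hor A (vdom A u) T. \<forall>g \<in> hor A (vcod A u) T.
       \<exists>!\<gamma>. \<gamma> \<in> sq A f g u (ver_id A T))"

lemma double_trivial_fibrationD:
  assumes "double_trivial_fibration A B Fo Fh Fv Fs"
  shows "Y \<in> DOb B \<Longrightarrow> \<exists>X \<in> DOb A. Fo X = Y"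
    and "X \<in> DOb A \<Longrightarrow> X' \<in> DOb A \<Longrightarrow> h \<in> hor B (Fo X) (Fo X') \<Longrightarrow> \<exists>a \<in> hor A X X'. Fh a = h"
    and "v \<in> Ver B \<Longrightarrow> \<exists>u \<in> Ver A. Fv u = v"
    and "t \<in> Hor A \<Longrightarrow> b \<in> Hor A \<Longrightarrow> l \<in> Ver A \<Longrightarrow> r \<in> Ver A \<Longrightarrow>
      hdom A t = vdom A l \<Longrightarrow> hcod A t = vdom A r \<Longrightarrow> hdom A b = vcod A l \<Longrightarrow> hcod A b = vcod A r \<Longrightarrow>
      \<beta> \<in> sq B (Fh t) (Fh b) (Fv l) (Fv r) \<Longrightarrow> \<exists>!\<alpha>. \<alpha> \<in> sq A t b l r \<and> Fs \<alpha> = \<beta>"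
  using assms by (simp_all add: double_trivial_fibration_def)

lemma dbl_op_simps [simp]:
  "DOb (dbl_op A) = DOb A" "Hor (dbl_op A) = Hor A" "Ver (dbl_op A) = Ver A" "Sq (dbl_op A) = Sq A"
  "hdom (dbl_op A) = hcod A" "hcod (dbl_op A) = hdom A" "vdom (dbl_op A) = vdom A"
  "vcod (dbl_op A) = vcod A" "sq_top (dbl_op A) = sq_top A" "sq_bot (dbl_op A) = sq_bot A"
  "sq_left (dbl_op A) = sq_right A" "sq_right (dbl_op A) = sq_left A" "hor_id (dbl_op A) = hor_id A"
  "hor_comp (dbl_op A) g f = hor_comp A f g" "ver_id (dbl_op A) = ver_id A"
  "ver_comp (dbl_op A) = ver_comp A" "sq_hid (dbl_op A) = sq_hid A"
  "sq_hcomp (dbl_op A) \<beta> \<alpha> = sq_hcomp A \<alpha> \<beta>" "sq_vid (dbl_op A) = sq_vid A"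
  "sq_vcomp (dbl_op A) = sq_vcomp A"
  by (simp_all add: dbl_op_def)

lemma dbl_op_homs [simp]:
  "hor (dbl_op A) X Y = hor A Y X" "ver (dbl_op A) X Y = ver A X Y"
  "sq (dbl_op A) t b l r = sq A t b r l" "vert_inv_sq (dbl_op A) X Y f g = vert_inv_sq A Y X f g"
  by (auto simp: hor_def ver_def sq_def vert_inv_sq_def)

context double_category
begin

lemma hor_id_hor: "X \<in> DOb A \<Longrightarrow> hor_id A X \<in> hor A X X"
  using category.Idn_Homs[OF hor_category, of X] by (simp add: Homs_def hor_def)

lemma hor_comp_hor: "f \<in> hor A X Y \<Longrightarrow> g \<in> hor A Y Z \<Longrightarrow> hor_comp A g f \<in> hor A X Z"
  using category.Comp_Homs[OF hor_category, of f X Y g Z] by (simp add: Homs_def hor_def)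

lemma hor_comp_units:
  "f \<in> hor A X Y \<Longrightarrow> hor_comp A f (hor_id A X) = f" "f \<in> hor A X Y \<Longrightarrow> hor_comp A (hor_id A Y) f = f"
  using category.Comp_Idn[OF hor_category, of f X Y] category.Idn_Comp[OF hor_category, of f X Y]
  by (simp_all add: Homs_def hor_def)

lemma hor_obs: "f \<in> hor A X Y \<Longrightarrow> X \<in> DOb A" "f \<in> hor A X Y \<Longrightarrow> Y \<in> DOb A"
  using category.Dom_Obj[OF hor_category, of f] category.Cod_Obj[OF hor_category, of f]
  by (auto simp: hor_def)

lemma ver_id_ver: "X \<in> DOb A \<Longrightarrow> ver_id A X \<in> ver A X X"
  using category.Idn_Homs[OF ver_category, of X] by (simp add: Homs_def ver_def)

lemma ver_comp_units:
  "u \<in> ver A X Y \<Longrightarrow> ver_comp A u (ver_id A X) = u" "u \<in> ver A X Y \<Longrightarrow> ver_comp A (ver_id A Y) u = u"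
  using category.Comp_Idn[OF ver_category, of u X Y] category.Idn_Comp[OF ver_category, of u X Y]
  by (simp_all add: Homs_def ver_def)

lemma ver_obs: "u \<in> ver A X Y \<Longrightarrow> X \<in> DOb A" "u \<in> ver A X Y \<Longrightarrow> Y \<in> DOb A"
  using category.Dom_Obj[OF ver_category, of u] category.Cod_Obj[OF ver_category, of u]
  by (auto simp: ver_def)

lemma sq_vcomp_units:
  "\<alpha> \<in> sq A t b l r \<Longrightarrow> sq_vcomp A \<alpha> (sq_vid A t) = \<alpha>"
  "\<alpha> \<in> sq A t b l r \<Longrightarrow> sq_vcomp A (sq_vid A b) \<alpha> = \<alpha>"
  using category.Comp_Idn[OF sq_ver_category, of \<alpha> t b] category.Idn_Comp[OF sq_ver_category, of \<alpha> t b]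
  by (simp_all add: Homs_def sq_def)

lemma sq_hcomp_hid: "\<alpha> \<in> sq A t b l r \<Longrightarrow> sq_hcomp A (sq_hid A r) \<alpha> = \<alpha>"
  using category.Idn_Comp[OF sq_hor_category, of \<alpha> l r] by (simp add: Homs_def sq_def)

text \<open>As for 2-categories: squares provided in both directions are inverse to each other by uniqueness, and
  the pasting equation for squares of the slice relates two squares with a common boundary.\<close>

lemma contractible_imp_double_bi_terminal:
  assumes T: "contractible_squares_to A T"
  shows "double_bi_terminal A T"
proof -
  let ?U = "dbl_slice_under (dbl_op A) T" and ?e = "ver_id A"
  have TOb: "T \<in> DOb A" and inh: "\<And>X. X \<in> DOb A \<Longrightarrow> \<exists>f. f \<in> hor A X T"
    using T unfolding contractible_squares_to_def by blast+
  have "\<exists>!\<gamma>. \<gamma> \<in> sq A f g u (?e T)" if "u \<in> ver A X Y" "f \<in> hor A X T" "g \<in> hor A Y T" for u X Y f g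
    using T that unfolding contractible_squares_to_def ver_def by blast
  then have ex: "\<And>X Y u f g. u \<in> ver A X Y \<Longrightarrow> f \<in> hor A X T \<Longrightarrow> g \<in> hor A Y T \<Longrightarrow>
       \<exists>\<gamma>. \<gamma> \<in> sq A f g u (?e T)"
    and uq: "\<And>X Y u f g \<gamma> \<gamma>'. u \<in> ver A X Y \<Longrightarrow> f \<in> hor A X T \<Longrightarrow> g \<in> hor A Y T \<Longrightarrow>
       \<gamma> \<in> sq A f g u (?e T) \<Longrightarrow> \<gamma>' \<in> sq A f g u (?e T) \<Longrightarrow> \<gamma> = \<gamma>'"
    by blast+
  note ee = ver_comp_units(1)[OF ver_id_ver]
  have inv: "\<exists>\<psi>. \<psi> \<in> vert_inv_sq A X T f g" if f: "f \<in> hor A X T" and g: "g \<in> hor A X T" for X f g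
  proof -
    have X: "X \<in> DOb A" using hor_obs f by blast
    note v = ver_id_ver[OF X]
    obtain \<psi> \<psi>' where p: "\<psi> \<in> sq A f g (?e X) (?e T)" "\<psi>' \<in> sq A g f (?e X) (?e T)"
      using ex[OF v f g] ex[OF v g f] by blast
    have "sq_vcomp A \<psi>' \<psi> = sq_vid A f"
      by (rule uq[OF v f f]) (use sq_vcomp_sq[OF p] sq_vid_sq[OF f] ee X TOb in simp_all)
    moreover have "sq_vcomp A \<psi> \<psi>' = sq_vid A g"
      by (rule uq[OF v g g]) (use sq_vcomp_sq[OF p(2,1)] sq_vid_sq[OF g] ee X TOb in simp_all)
    ultimately show ?thesis using p by (auto simp: vert_inv_sq_def)
  qed
  have "double_trivial_fibration ?U (dbl_op A)
      (\<lambda>(X, f). X) (\<lambda>(x, y, a, \<psi>). a) (\<lambda>(x, y, u, \<gamma>). u) (\<lambda>(t, b, l, r, \<alpha>). \<alpha>)"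
    unfolding double_trivial_fibration_def
  proof (intro conjI ballI impI)
    fix X assume "X \<in> DOb (dbl_op A)"
    then show "\<exists>x\<in>DOb ?U. (case x of (X, f) \<Rightarrow> X) = X"
      using inh[of X] by (auto simp: dbl_slice_under_def dbl_under_obs_def)
  next
    fix x y b
    assume "x \<in> DOb ?U" "y \<in> DOb ?U" and b: "b \<in> hor (dbl_op A) (case x of (X, f) \<Rightarrow> X) (case y of (X, f) \<Rightarrow> X)"
    then obtain X f Y g where x: "x = (X, f)" "X \<in> DOb A" "f \<in> hor A X T"
      and y: "y = (Y, g)" "Y \<in> DOb A" "g \<in> hor A Y T"
      by (auto simp: dbl_slice_under_def dbl_under_obs_def)
    have "hor_comp A f b \<in> hor A Y T" using b x y by (auto intro: hor_comp_hor)
    then obtain \<psi> where "\<psi> \<in> vert_inv_sq A Y T g (hor_comp A f b)" using inv y by blast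
    then have "((X, f), (Y, g), b, \<psi>) \<in> hor ?U x y"
      using b x y by (auto simp: hor_def dbl_slice_under_def dbl_under_obs_def dbl_under_hors_def)
    then show "\<exists>a\<in>hor ?U x y. (case a of (x, y, a, \<psi>) \<Rightarrow> a) = b" by force
  next
    fix u assume u: "u \<in> Ver (dbl_op A)"
    let ?X = "vdom A u" and ?Y = "vcod A u"
    have v: "u \<in> ver A ?X ?Y" using u by (simp add: ver_def)
    then obtain f g where fg: "f \<in> hor A ?X T" "g \<in> hor A ?Y T" using inh ver_obs by blast
    then obtain \<gamma> where "\<gamma> \<in> sq A f g u (?e T)" using ex v by blast
    then have "((?X, f), (?Y, g), u, \<gamma>) \<in> Ver ?U"
      using fg v ver_obs[OF v] by (auto simp: dbl_slice_under_def dbl_under_obs_def dbl_under_vers_def)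
    then show "\<exists>w\<in>Ver ?U. (case w of (x, y, u, \<gamma>) \<Rightarrow> u) = u" by force
  next
    fix t b l r \<beta>
    assume *: "t \<in> Hor ?U" "b \<in> Hor ?U" "l \<in> Ver ?U" "r \<in> Ver ?U"
      and c: "hdom ?U t = vdom ?U l \<and> hcod ?U t = vdom ?U r \<and> hdom ?U b = vcod ?U l \<and> hcod ?U b = vcod ?U r"
      and be: "\<beta> \<in> sq (dbl_op A) (case t of (x, y, a, \<psi>) \<Rightarrow> a) (case b of (x, y, a, \<psi>) \<Rightarrow> a)
        (case l of (x, y, u, \<gamma>) \<Rightarrow> u) (case r of (x, y, u, \<gamma>) \<Rightarrow> u)"
    obtain X f Y g a \<psi> where t: "t = ((X, f), (Y, g), a, \<psi>)" "f \<in> hor A X T" "g \<in> hor A Y T"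
        "a \<in> hor A Y X" "\<psi> \<in> sq A g (hor_comp A f a) (?e Y) (?e T)"
      using *(1) by (auto simp: dbl_slice_under_def dbl_under_obs_def dbl_under_hors_def vert_inv_sq_def)
    obtain X' f' Y' g' a' \<phi> where b: "b = ((X', f'), (Y', g'), a', \<phi>)" "f' \<in> hor A X' T" "g' \<in> hor A Y' T"
        "a' \<in> hor A Y' X'" "\<phi> \<in> sq A g' (hor_comp A f' a') (?e Y') (?e T)"
      using *(2) by (auto simp: dbl_slice_under_def dbl_under_obs_def dbl_under_hors_def vert_inv_sq_def)
    obtain u \<gamma> where l: "l = ((X, f), (X', f'), u, \<gamma>)" "u \<in> ver A X X'" "\<gamma> \<in> sq A f f' u (?e T)"
      using *(3) c t b by (auto simp: dbl_slice_under_def dbl_under_obs_def dbl_under_vers_def)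
    obtain u' \<gamma>' where r: "r = ((Y, g), (Y', g'), u', \<gamma>')" "u' \<in> ver A Y Y'" "\<gamma>' \<in> sq A g g' u' (?e T)"
      using *(4) c t b by (auto simp: dbl_slice_under_def dbl_under_obs_def dbl_under_vers_def)
    have be': "\<beta> \<in> sq A a a' u' u" using be t b l r by simp
    have "sq_vcomp A (sq_hcomp A \<gamma> \<beta>) \<psi> = sq_vcomp A \<phi> \<gamma>'"
    proof (rule uq[OF r(2) t(3)])
      show "hor_comp A f' a' \<in> hor A Y' T" using b by (auto intro: hor_comp_hor)
      show "sq_vcomp A (sq_hcomp A \<gamma> \<beta>) \<psi> \<in> sq A g (hor_comp A f' a') u' (?e T)"
        using sq_vcomp_sq[OF t(5) sq_hcomp_sq[OF be' l(3)]] ver_comp_units(1)[OF r(2)] ee TOb by simp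
      show "sq_vcomp A \<phi> \<gamma>' \<in> sq A g (hor_comp A f' a') u' (?e T)"
        using sq_vcomp_sq[OF r(3) b(5)] ver_comp_units(2)[OF r(2)] ee TOb by simp
    qed
    then have "(t, b, l, r, \<beta>) \<in> sq ?U t b l r"
      using * be' t b l r by (auto simp: sq_def dbl_slice_under_def)
    then show "\<exists>!\<alpha>. \<alpha> \<in> sq ?U t b l r \<and> (case \<alpha> of (t, b, l, r, \<alpha>) \<Rightarrow> \<alpha>) = \<beta>"
      by (auto simp: sq_def dbl_slice_under_def)
  qed
  then show ?thesis using TOb by (simp add: double_bi_terminal_def double_bi_initial_def)
qed

text \<open>Surjectivity on vertical morphisms provides some square along \<open>u\<close>; fullness at horizontal identities
  provides the vertically invertible squares which correct its top and bottom.\<close>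

lemma double_bi_terminal_imp_contractible:
  assumes T: "double_bi_terminal A T"
  shows "contractible_squares_to A T"
proof -
  let ?U = "dbl_slice_under (dbl_op A) T" and ?e = "ver_id A"
  have TOb: "T \<in> DOb A" using T by (simp add: double_bi_terminal_def double_bi_initial_def)
  have tf: "double_trivial_fibration ?U (dbl_op A)
      (\<lambda>(X, f). X) (\<lambda>(x, y, a, \<psi>). a) (\<lambda>(x, y, u, \<gamma>). u) (\<lambda>(t, b, l, r, \<alpha>). \<alpha>)"
    using T by (simp add: double_bi_terminal_def double_bi_initial_def)
  have ob: "(X, f) \<in> DOb ?U \<longleftrightarrow> X \<in> DOb A \<and> f \<in> hor A X T" for X f
    by (simp add: dbl_slice_under_def dbl_under_obs_def)
  have hor: "((X, f), (Y, g), a, \<psi>) \<in> Hor ?U \<longleftrightarrow>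
      (X, f) \<in> DOb ?U \<and> (Y, g) \<in> DOb ?U \<and> a \<in> hor A Y X \<and> \<psi> \<in> vert_inv_sq A Y T g (hor_comp A f a)"
    for X f Y g a \<psi>
    by (auto simp: dbl_slice_under_def dbl_under_obs_def dbl_under_hors_def)
  have ver: "((X, f), (Y, g), u, \<gamma>) \<in> Ver ?U \<longleftrightarrow>
      (X, f) \<in> DOb ?U \<and> (Y, g) \<in> DOb ?U \<and> u \<in> ver A X Y \<and> \<gamma> \<in> sq A f g u (?e T)"
    for X f Y g u \<gamma>
    by (auto simp: dbl_slice_under_def dbl_under_obs_def dbl_under_vers_def)
  have surj: "\<exists>f. f \<in> hor A X T" if "X \<in> DOb A" for X
    using double_trivial_fibrationD(1)[OF tf, of X] that by (fastforce simp: ob)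
  have full: "\<exists>\<psi>. \<psi> \<in> sq A g f (?e X) (?e T)" if f: "f \<in> hor A X T" and g: "g \<in> hor A X T" for X f g
  proof -
    have X: "X \<in> DOb A" using hor_obs f by blast
    have "\<exists>m \<in> hor ?U (X, f) (X, g). (\<lambda>(x, y, a, \<psi>). a) m = hor_id A X"
      using double_trivial_fibrationD(2)[OF tf, of "(X, f)" "(X, g)" "hor_id A X"] f g X hor_id_hor[OF X]
      by (simp add: ob)
    then have "\<exists>\<psi>. \<psi> \<in> vert_inv_sq A X T g (hor_comp A f (hor_id A X))"
      by (auto simp: hor_def dbl_slice_under_def dbl_under_hors_def)
    then show ?thesis using hor_comp_units(1)[OF f] by (auto simp: vert_inv_sq_def)
  qed
  have "\<exists>!\<gamma>. \<gamma> \<in> sq A f g u (?e T)"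
    if u: "u \<in> ver A X Y" and f: "f \<in> hor A X T" and g: "g \<in> hor A Y T" for u f g X Y
  proof -
    have XY: "X \<in> DOb A" "Y \<in> DOb A" using ver_obs[OF u] by auto
    obtain w where "w \<in> Ver ?U" and "(\<lambda>(x, y, u, \<gamma>). u) w = u"
      using double_trivial_fibrationD(3)[OF tf, of u] u by (auto simp: ver_def)
    then obtain f0 g0 \<gamma>0 where w: "f0 \<in> hor A X T" "g0 \<in> hor A Y T" "\<gamma>0 \<in> sq A f0 g0 u (?e T)"
      using u by (cases w) (auto simp: ver ob ver_def)
    obtain \<psi> \<phi> where p: "\<psi> \<in> sq A f f0 (?e X) (?e T)" and q: "\<phi> \<in> sq A g0 g (?e Y) (?e T)"
      using full[OF w(1) f] full[OF g w(2)] by blast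
    have "sq_vcomp A \<phi> (sq_vcomp A \<gamma>0 \<psi>) \<in> sq A f g u (?e T)"
      using sq_vcomp_sq[OF sq_vcomp_sq[OF p w(3)] q] ver_comp_units[OF u] ver_comp_units(1)[OF ver_id_ver[OF TOb]]
      by simp
    moreover have "\<gamma> = \<gamma>'" if c: "\<gamma> \<in> sq A f g u (?e T)" and c': "\<gamma>' \<in> sq A f g u (?e T)" for \<gamma> \<gamma>'
    proof -
      \<comment> \<open>\<open>\<gamma>\<close> is a square of the slice between the tautological morphisms from \<open>(T, id)\<close> to \<open>(X, f)\<close>
        and to \<open>(Y, g)\<close>, even if the vertical morphism on the side of \<open>f\<close> and \<open>g\<close> carries \<open>\<gamma>'\<close>.\<close>
      let ?T = "(T, hor_id A T)"
      let ?t = "(?T, (X, f), f, sq_vid A f)" and ?b = "(?T, (Y, g), g, sq_vid A g)"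
      let ?l = "(?T, ?T, ?e T, sq_vid A (hor_id A T))" and ?r = "((X, f), (Y, g), u, \<gamma>')"
      have i: "sq_vid A h \<in> vert_inv_sq A Z T h h" if "h \<in> hor A Z T" for h Z
        using sq_vid_sq[OF that] sq_vcomp_units(1)[OF sq_vid_sq[OF that]] by (auto simp: vert_inv_sq_def)
      have "?t \<in> Hor ?U" "?b \<in> Hor ?U" "?l \<in> Ver ?U" "?r \<in> Ver ?U"
        using f g u c' XY TOb i[OF f] i[OF g] hor_comp_units(2)[OF f] hor_comp_units(2)[OF g] hor_id_hor[OF TOb] ver_id_ver[OF TOb]
          sq_vid_sq[OF hor_id_hor[OF TOb]]
        by (simp_all only: hor ver ob)
      moreover have "\<gamma> \<in> sq (dbl_op A) f g (?e T) u" using c by simp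
      ultimately have "\<exists>!\<alpha>. \<alpha> \<in> sq ?U ?t ?b ?l ?r \<and> (\<lambda>(t, b, l, r, \<alpha>). \<alpha>) \<alpha> = \<gamma>"
        by (intro double_trivial_fibrationD(4)[OF tf]) (simp_all add: dbl_slice_under_def)
      then have "sq_vcomp A (sq_hcomp A (sq_vid A (hor_id A T)) \<gamma>) (sq_vid A f) = sq_vcomp A (sq_vid A g) \<gamma>'"
        by (auto simp: sq_def dbl_slice_under_def)
      then show ?thesis
        using sq_vcomp_units(1)[OF c] sq_vcomp_units(2)[OF c'] sq_hcomp_hid[OF c] sq_hid_id[OF TOb] by simp
    qed
    ultimately show ?thesis by blast
  qed
  then show ?thesis using TOb surj by (force simp: contractible_squares_to_def ver_def)
qed

lemma double_bi_terminal_iff: "double_bi_terminal A T \<longleftrightarrow> contractible_squares_to A T"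
  using double_bi_terminal_imp_contractible contractible_imp_double_bi_terminal by blast

end

section \<open>Pasting with a normal pseudo-functor\<close>

locale pseudo_functor = C: two_category C + D: two_category D + normal_pseudo_functor C D L
  for C :: "('o, 'm, 't) two_cat" and D :: "('p, 'n, 's) two_cat" (structure)
    and L :: "('o, 'm, 't, 'p, 'n, 's) psf"
begin

declare on_ob_Ob [simp]

lemma hom_functor_of:
  "f \<in> Mor C \<Longrightarrow> is_functor (hom_cat C (dom1 C f) (cod1 C f))
     (hom_cat D (on_ob L (dom1 C f)) (on_ob L (cod1 C f))) \<lparr>fob = on_mor L, farr = on_two L\<rparr>"
  by (simp add: hom_functor)

lemma on_mor_cell [simp]:
  assumes "f \<in> Mor C"
  shows "on_mor L f \<in> Mor D" "dom1 D (on_mor L f) = on_ob L (dom1 C f)"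
    "cod1 D (on_mor L f) = on_ob L (cod1 C f)"
  using hom_functor_of[OF assms] assms by (auto simp: is_functor_def hom_cat_def hom1_def)

lemma on_two_cell [simp]:
  assumes "\<alpha> \<in> Two C"
  shows "on_two L \<alpha> \<in> Two D" "dom2 D (on_two L \<alpha>) = on_mor L (dom2 C \<alpha>)"
    "cod2 D (on_two L \<alpha>) = on_mor L (cod2 C \<alpha>)"
proof -
  let ?f = "dom2 C \<alpha>"
  have "on_two L \<alpha> \<in> Homs (hom_cat D (on_ob L (dom1 C ?f)) (on_ob L (cod1 C ?f))) (on_mor L ?f) (on_mor L (cod2 C \<alpha>))"
    using hom_functor_of[of ?f] C.Arr_Homs[OF assms refl refl] assms
    by (auto simp: is_functor_def hom_cat_simps hom1_def)
  then show "on_two L \<alpha> \<in> Two D" "dom2 D (on_two L \<alpha>) = on_mor L (dom2 C \<alpha>)"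
    "cod2 D (on_two L \<alpha>) = on_mor L (cod2 C \<alpha>)"
    by (auto simp: Homs_def hom_cat_def)
qed

declare on_mor_id1 [simp]

lemma on_two_id2 [simp]: "f \<in> Mor C \<Longrightarrow> on_two L (id2 C f) = id2 D (on_mor L f)"
  using hom_functor_of[of f] by (auto simp: is_functor_def hom_cat_def hom1_def)

lemma on_two_vcomp [simp]:
  assumes "\<alpha> \<in> Two C" "\<beta> \<in> Two C" "dom2 C \<beta> = cod2 C \<alpha>"
  shows "on_two L (\<beta> \<bullet>\<^bsub>C\<^esub> \<alpha>) = on_two L \<beta> \<bullet> on_two L \<alpha>"
proof -
  let ?X = "dom1 C (dom2 C \<alpha>)" and ?Y = "cod1 C (dom2 C \<alpha>)"
  have "\<alpha> \<in> Homs (hom_cat C ?X ?Y) (dom2 C \<alpha>) (cod2 C \<alpha>)" "\<beta> \<in> Homs (hom_cat C ?X ?Y) (cod2 C \<alpha>) (cod2 C \<beta>)"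
    using C.Arr_Homs[OF assms(1)] C.Arr_Homs[OF assms(2)] assms by simp_all
  moreover have "dom2 C \<alpha> \<in> hom1 C ?X ?Y" "cod2 C \<alpha> \<in> hom1 C ?X ?Y" "cod2 C \<beta> \<in> hom1 C ?X ?Y"
    using assms C.cod2_boundary[OF assms(2)] by (simp_all add: hom1_def)
  ultimately show ?thesis
    using hom_functor_of[of "dom2 C \<alpha>"] assms(1)
    unfolding is_functor_def hom_cat_simps fctr.simps by (metis C.dom2_Mor)
qed

abbreviation cmpr_inv :: "'m \<Rightarrow> 'm \<Rightarrow> 's" where "cmpr_inv a b \<equiv> inv2 D (cmpr L a b)"

lemma cmpr_iso2':
  "a \<in> Mor C \<Longrightarrow> b \<in> Mor C \<Longrightarrow> dom1 C b = cod1 C a \<Longrightarrow>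
    cmpr L a b \<in> iso2 D (on_mor L b \<cdot> on_mor L a) (on_mor L (b \<cdot>\<^bsub>C\<^esub> a))"
  by (rule cmpr_iso2) (auto simp: hom1_def)

lemmas cmpr_inv_iso2 = D.inv2_iso2[OF cmpr_iso2']

lemma cmpr_cell [simp]:
  assumes "a \<in> Mor C" "b \<in> Mor C" "dom1 C b = cod1 C a"
  shows "cmpr L a b \<in> Two D" "dom2 D (cmpr L a b) = on_mor L b \<cdot> on_mor L a"
    "cod2 D (cmpr L a b) = on_mor L (b \<cdot>\<^bsub>C\<^esub> a)"
    "cmpr_inv a b \<in> Two D" "dom2 D (cmpr_inv a b) = on_mor L (b \<cdot>\<^bsub>C\<^esub> a)"
    "cod2 D (cmpr_inv a b) = on_mor L b \<cdot> on_mor L a"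
  using D.iso2_cell[OF cmpr_iso2'[OF assms]] D.iso2_cell[OF cmpr_inv_iso2[OF assms]] by auto

lemma cmpr_units [simp]:
  assumes "a \<in> Mor C"
  shows "dom1 C a = X \<Longrightarrow> cmpr L (id1 C X) a = id2 D (on_mor L a)"
    "cod1 C a = Y \<Longrightarrow> cmpr L a (id1 C Y) = id2 D (on_mor L a)"
  using cmpr_id1_left cmpr_id1_right assms by (auto simp: hom1_def)

text \<open>In the composition of a slice only the inverses of the compositors appear, so the axioms of \<open>L\<close> are needed
  in inverted form.\<close>

lemma cmpr_inv_natural:
  assumes "\<alpha> \<in> Two C" "\<beta> \<in> Two C" "dom1 C (dom2 C \<beta>) = cod1 C (dom2 C \<alpha>)"
  shows "cmpr_inv (cod2 C \<alpha>) (cod2 C \<beta>) \<bullet> on_two L (\<beta> \<star>\<^bsub>C\<^esub> \<alpha>)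
    = (on_two L \<beta> \<star> on_two L \<alpha>) \<bullet> cmpr_inv (dom2 C \<alpha>) (dom2 C \<beta>)"
proof -
  have b: "dom1 C (cod2 C \<beta>) = cod1 C (cod2 C \<alpha>)" using assms by simp
  note iso = cmpr_iso2'[OF C.dom2_Mor[OF assms(1)] C.dom2_Mor[OF assms(2)] assms(3)]
    cmpr_iso2'[OF C.cod2_Mor[OF assms(1)] C.cod2_Mor[OF assms(2)] b]
  have n: "on_two L (\<beta> \<star>\<^bsub>C\<^esub> \<alpha>) \<bullet> cmpr L (dom2 C \<alpha>) (dom2 C \<beta>)
      = cmpr L (cod2 C \<alpha>) (cod2 C \<beta>) \<bullet> (on_two L \<beta> \<star> on_two L \<alpha>)"
    using assms by (intro cmpr_natural) (auto simp: hom1_def hom2_def)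
  have "cmpr_inv (cod2 C \<alpha>) (cod2 C \<beta>) \<bullet> on_two L (\<beta> \<star>\<^bsub>C\<^esub> \<alpha>)
      = cmpr_inv (cod2 C \<alpha>) (cod2 C \<beta>) \<bullet> ((on_two L (\<beta> \<star>\<^bsub>C\<^esub> \<alpha>) \<bullet> cmpr L (dom2 C \<alpha>) (dom2 C \<beta>))
          \<bullet> cmpr_inv (dom2 C \<alpha>) (dom2 C \<beta>))"
    using assms by (simp add: D.inv2_laws[OF iso(1)])
  also have "\<dots> = cmpr_inv (cod2 C \<alpha>) (cod2 C \<beta>) \<bullet> (cmpr L (cod2 C \<alpha>) (cod2 C \<beta>) \<bullet> ((on_two L \<beta> \<star> on_two L \<alpha>)
          \<bullet> cmpr_inv (dom2 C \<alpha>) (dom2 C \<beta>)))"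
    unfolding n using assms by simp
  also have "\<dots> = (on_two L \<beta> \<star> on_two L \<alpha>) \<bullet> cmpr_inv (dom2 C \<alpha>) (dom2 C \<beta>)"
    using assms by (intro D.inv2_cancel(1)[OF iso(2)]) simp_all
  finally show ?thesis .
qed

lemma cmpr_inv_assoc:
  assumes "a \<in> Mor C" "b \<in> Mor C" "c \<in> Mor C" "dom1 C b = cod1 C a" "dom1 C c = cod1 C b"
  shows "(id2 D (on_mor L c) \<star> cmpr_inv a b) \<bullet> cmpr_inv (b \<cdot>\<^bsub>C\<^esub> a) c
    = (cmpr_inv b c \<star> id2 D (on_mor L a)) \<bullet> cmpr_inv a (c \<cdot>\<^bsub>C\<^esub> b)"
proof -
  let ?p = "cmpr L (b \<cdot>\<^bsub>C\<^esub> a) c \<bullet> (id2 D (on_mor L c) \<star> cmpr L a b)"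
  let ?q = "cmpr L a (c \<cdot>\<^bsub>C\<^esub> b) \<bullet> (cmpr L b c \<star> id2 D (on_mor L a))"
  note i = cmpr_iso2'[of a b] cmpr_iso2'[of "b \<cdot>\<^bsub>C\<^esub> a" c] cmpr_iso2'[of b c] cmpr_iso2'[of a "c \<cdot>\<^bsub>C\<^esub> b"]
  have "?p = ?q"
    using assms by (intro cmpr_assoc) (auto simp: hom1_def)
  moreover have "inv2 D ?p = (id2 D (on_mor L c) \<star> cmpr_inv a b) \<bullet> cmpr_inv (b \<cdot>\<^bsub>C\<^esub> a) c"
    using assms i by (simp add: D.iso2_vcomp(2)[OF D.iso2_whisker(1) ] D.iso2_whisker(2))
  moreover have "inv2 D ?q = (cmpr_inv b c \<star> id2 D (on_mor L a)) \<bullet> cmpr_inv a (c \<cdot>\<^bsub>C\<^esub> b)"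
    using assms i by (simp add: D.iso2_vcomp(2)[OF D.iso2_whisker(3) ] D.iso2_whisker(4))
  ultimately show ?thesis by simp
qed


text \<open>The 2-cell of a composite in the pseudo-slices over an object \<open>Y\<close> of \<open>D\<close>.\<close>

definition paste :: "'n \<Rightarrow> 'm \<Rightarrow> 'm \<Rightarrow> 's \<Rightarrow> 's \<Rightarrow> 's" where
  "paste f'' c c' \<psi> \<psi>' = \<psi> \<bullet> ((\<psi>' \<star> id2 D (on_mor L c)) \<bullet> (id2 D f'' \<star> cmpr_inv c c'))"

text \<open>\<open>triangle Y X f X' f' c \<psi>\<close>: the pair \<open>(c, \<psi>)\<close> is a morphism from \<open>(X, f)\<close> to \<open>(X', f')\<close>
  over \<open>Y\<close>.\<close>

definition triangle :: "'p \<Rightarrow> 'o \<times> 'n \<Rightarrow> 'o \<times> 'n \<Rightarrow> 'm \<Rightarrow> 's \<Rightarrow> bool" where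
  "triangle Y = (\<lambda>(X, f) (X', f') c \<psi>. (X, f) \<in> over_obs C D L Y \<and> (X', f') \<in> over_obs C D L Y \<and>
     c \<in> hom1 C X X' \<and> \<psi> \<in> iso2 D (f' \<cdot> on_mor L c) f)"

lemma triangle_iff: "triangle Y (X, f) (X', f') c \<psi> \<longleftrightarrow> X \<in> Ob C \<and> X' \<in> Ob C \<and>
    f \<in> Mor D \<and> dom1 D f = on_ob L X \<and> cod1 D f = Y \<and>
    f' \<in> Mor D \<and> dom1 D f' = on_ob L X' \<and> cod1 D f' = Y \<and>
    c \<in> Mor C \<and> dom1 C c = X \<and> cod1 C c = X' \<and> \<psi> \<in> iso2 D (f' \<cdot> on_mor L c) f"
  by (auto simp: triangle_def over_obs_def hom1_def)

lemma triangle_cell: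
  assumes "triangle Y (X, f) (X', f') c \<psi>"
  shows "X \<in> Ob C" "X' \<in> Ob C" "f \<in> Mor D" "dom1 D f = on_ob L X" "cod1 D f = Y"
    "f' \<in> Mor D" "dom1 D f' = on_ob L X'" "cod1 D f' = Y" "c \<in> Mor C" "dom1 C c = X" "cod1 C c = X'"
    "\<psi> \<in> Two D" "dom2 D \<psi> = f' \<cdot> on_mor L c" "cod2 D \<psi> = f" "\<psi> \<in> iso2 D (f' \<cdot> on_mor L c) f"
  using assms D.iso2_cell[of \<psi>] by (auto simp: triangle_iff)

lemma triangle_id: "(X, f) \<in> over_obs C D L Y \<Longrightarrow> triangle Y (X, f) (X, f) (id1 C X) (id2 D f)"
  by (auto simp: triangle_iff over_obs_def hom1_def D.iso2_id2)

lemma triangle_paste: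
  assumes "triangle Y (X, f) (X', f') c \<psi>" "triangle Y (X', f') (X'', f'') c' \<psi>'"
  shows "triangle Y (X, f) (X'', f'') (c' \<cdot>\<^bsub>C\<^esub> c) (paste f'' c c' \<psi> \<psi>')"
proof -
  note [simp] = triangle_cell[OF assms(1)] triangle_cell[OF assms(2)]
  have "id2 D f'' \<star> cmpr_inv c c' \<in> iso2 D (f'' \<cdot> on_mor L (c' \<cdot>\<^bsub>C\<^esub> c)) (f'' \<cdot> (on_mor L c' \<cdot> on_mor L c))"
    by (rule D.iso2_whisker(1)) (simp_all add: cmpr_inv_iso2)
  moreover have "\<psi>' \<star> id2 D (on_mor L c) \<in> iso2 D ((f'' \<cdot> on_mor L c') \<cdot> on_mor L c) (f' \<cdot> on_mor L c)"
    by (rule D.iso2_whisker(3)) simp_all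
  ultimately have "paste f'' c c' \<psi> \<psi>' \<in> iso2 D (f'' \<cdot> on_mor L (c' \<cdot>\<^bsub>C\<^esub> c)) f"
    unfolding paste_def using triangle_cell(15)[OF assms(1)]
    by (auto intro!: D.iso2_vcomp(1)[OF D.iso2_vcomp(1)])
  then show ?thesis by (simp add: triangle_iff)
qed

lemma paste_id:
  assumes "triangle Y (X, f) (X', f') c \<psi>"
  shows "paste f' (id1 C X) c (id2 D f) \<psi> = \<psi>" "paste f' c (id1 C X') \<psi> (id2 D f') = \<psi>"
  using triangle_cell[OF assms] by (simp_all add: paste_def)

text \<open>Up to the associativity of the compositors of \<open>L\<close>, the two composites differ in the order of \<open>\<psi>''\<close> and the
  compositor of \<open>c\<close> and \<open>c'\<close>, which are horizontally disjoint.\<close>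

lemma paste_assoc:
  assumes "triangle Y (X, f) (X', f') c \<psi>" "triangle Y (X', f') (X'', f'') c' \<psi>'"
    and "triangle Y (X'', f'') (X3, f3) c'' \<psi>''"
  shows "paste f3 c (c'' \<cdot>\<^bsub>C\<^esub> c') \<psi> (paste f3 c' c'' \<psi>' \<psi>'')
    = paste f3 (c' \<cdot>\<^bsub>C\<^esub> c) c'' (paste f'' c c' \<psi> \<psi>') \<psi>''"
proof -
  note [simp] = triangle_cell[OF assms(1)] triangle_cell[OF assms(2)] triangle_cell[OF assms(3)]
  let ?L = "on_mor L" and ?i = "id2 D"
  have x: "(?i f'' \<star> cmpr_inv c c') \<bullet> (\<psi>'' \<star> ?i (?L (c' \<cdot>\<^bsub>C\<^esub> c)))
      = (\<psi>'' \<star> ?i (?L c' \<cdot> ?L c)) \<bullet> (?i (f3 \<cdot> ?L c'') \<star> cmpr_inv c c')"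
    by (simp add: D.interchange')
  have y: "(?i (f3 \<cdot> ?L c'') \<star> cmpr_inv c c') \<bullet> (?i f3 \<star> cmpr_inv (c' \<cdot>\<^bsub>C\<^esub> c) c'')
      = (?i f3 \<star> (cmpr_inv c' c'' \<star> ?i (?L c))) \<bullet> (?i f3 \<star> cmpr_inv c (c'' \<cdot>\<^bsub>C\<^esub> c'))"
    using arg_cong[OF cmpr_inv_assoc[of c c' c''], of "\<lambda>z. ?i f3 \<star> z"] by (simp add: D.whisker_vcomp)
  have "paste f3 (c' \<cdot>\<^bsub>C\<^esub> c) c'' (paste f'' c c' \<psi> \<psi>') \<psi>'' =
     \<psi> \<bullet> ((\<psi>' \<star> ?i (?L c)) \<bullet> (((?i f'' \<star> cmpr_inv c c') \<bullet> (\<psi>'' \<star> ?i (?L (c' \<cdot>\<^bsub>C\<^esub> c))))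
       \<bullet> (?i f3 \<star> cmpr_inv (c' \<cdot>\<^bsub>C\<^esub> c) c'')))"
    by (simp add: paste_def)
  also have "\<dots> = \<psi> \<bullet> ((\<psi>' \<star> ?i (?L c)) \<bullet> ((\<psi>'' \<star> ?i (?L c' \<cdot> ?L c)) \<bullet>
      ((?i (f3 \<cdot> ?L c'') \<star> cmpr_inv c c') \<bullet> (?i f3 \<star> cmpr_inv (c' \<cdot>\<^bsub>C\<^esub> c) c''))))"
    unfolding x by simp
  also have "\<dots> = paste f3 c (c'' \<cdot>\<^bsub>C\<^esub> c') \<psi> (paste f3 c' c'' \<psi>' \<psi>'')"
    unfolding y by (simp add: paste_def D.whisker_vcomp)
  finally show ?thesis by simp
qed

text \<open>The condition on \<open>\<gamma> : c \<Rightarrow> d\<close> to be a square with top \<open>(c, \<psi>)\<close>, bottom \<open>(d, \<phi>)\<close>, left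
  side \<open>\<alpha>\<close> and right side \<open>\<alpha>'\<close>.\<close>

definition over_square :: "'s \<Rightarrow> 's \<Rightarrow> 's \<Rightarrow> 's \<Rightarrow> 't \<Rightarrow> bool" where
  "over_square \<psi> \<phi> \<alpha> \<alpha>' \<gamma> \<longleftrightarrow> \<alpha> \<bullet> \<psi> = \<phi> \<bullet> (\<alpha>' \<star> on_two L \<gamma>)"

text \<open>The equation for \<open>\<gamma>'\<close>, composed horizontally with \<open>L \<gamma>\<close>, is pasted to the equation for \<open>\<gamma>\<close>; naturality of the compositors
  turns \<open>L \<gamma>' \<star> L \<gamma>\<close> into \<open>L (\<gamma>' \<star> \<gamma>)\<close>.\<close>

lemma over_square_hcomp:
  assumes c: "triangle Y (X, f) (X', f') c \<psi>" and d: "triangle Y (X, g) (X', g') d \<phi>"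
    and c': "triangle Y (X', f') (X'', f'') c' \<psi>'" and d': "triangle Y (X', g') (X'', g'') d' \<phi>'"
    and a: "\<alpha> \<in> hom2 D f g" and a': "\<alpha>' \<in> hom2 D f' g'" and a'': "\<alpha>'' \<in> hom2 D f'' g''"
    and ga: "\<gamma> \<in> hom2 C c d" and ga': "\<gamma>' \<in> hom2 C c' d'"
    and s: "over_square \<psi> \<phi> \<alpha> \<alpha>' \<gamma>" and s': "over_square \<psi>' \<phi>' \<alpha>' \<alpha>'' \<gamma>'"
  shows "over_square (paste f'' c c' \<psi> \<psi>') (paste g'' d d' \<phi> \<phi>') \<alpha> \<alpha>'' (\<gamma>' \<star>\<^bsub>C\<^esub> \<gamma>)"
proof -
  note [simp] = triangle_cell[OF c] triangle_cell[OF d] triangle_cell[OF c'] triangle_cell[OF d']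
    a[unfolded hom2_iff] a'[unfolded hom2_iff] a''[unfolded hom2_iff] ga[unfolded hom2_iff] ga'[unfolded hom2_iff]
  let ?L = "on_mor L" and ?L2 = "on_two L" and ?i = "id2 D"
  have x: "(\<alpha>' \<star> ?L2 \<gamma>) \<bullet> (\<psi>' \<star> ?i (?L c)) = (\<phi>' \<star> ?i (?L d)) \<bullet> (\<alpha>'' \<star> (?L2 \<gamma>' \<star> ?L2 \<gamma>))"
  proof -
    have "(\<alpha>' \<star> ?L2 \<gamma>) \<bullet> (\<psi>' \<star> ?i (?L c)) = (\<alpha>' \<bullet> \<psi>') \<star> ?L2 \<gamma>"
      by (simp add: D.interchange')
    also have "\<dots> = (\<phi>' \<bullet> (\<alpha>'' \<star> ?L2 \<gamma>')) \<star> (?i (?L d) \<bullet> ?L2 \<gamma>)"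
      using s' by (simp add: over_square_def)
    also have "\<dots> = (\<phi>' \<star> ?i (?L d)) \<bullet> ((\<alpha>'' \<star> ?L2 \<gamma>') \<star> ?L2 \<gamma>)"
      by (intro D.interchange'[symmetric]) simp_all
    finally show ?thesis by simp
  qed
  have y: "(\<alpha>'' \<star> (?L2 \<gamma>' \<star> ?L2 \<gamma>)) \<bullet> (?i f'' \<star> cmpr_inv c c') = (?i g'' \<star> cmpr_inv d d') \<bullet> (\<alpha>'' \<star> ?L2 (\<gamma>' \<star>\<^bsub>C\<^esub> \<gamma>))"
    using cmpr_inv_natural[of \<gamma> \<gamma>'] by (simp add: D.interchange')
  have "\<alpha> \<bullet> paste f'' c c' \<psi> \<psi>' = (\<alpha> \<bullet> \<psi>) \<bullet> ((\<psi>' \<star> ?i (?L c)) \<bullet> (?i f'' \<star> cmpr_inv c c'))"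
    by (simp add: paste_def)
  also have "\<dots> = \<phi> \<bullet> (((\<alpha>' \<star> ?L2 \<gamma>) \<bullet> (\<psi>' \<star> ?i (?L c))) \<bullet> (?i f'' \<star> cmpr_inv c c'))"
    using s by (simp add: over_square_def)
  also have "\<dots> = \<phi> \<bullet> ((\<phi>' \<star> ?i (?L d)) \<bullet> ((\<alpha>'' \<star> (?L2 \<gamma>' \<star> ?L2 \<gamma>)) \<bullet> (?i f'' \<star> cmpr_inv c c')))"
    unfolding x by simp
  also have "\<dots> = paste g'' d d' \<phi> \<phi>' \<bullet> (\<alpha>'' \<star> ?L2 (\<gamma>' \<star>\<^bsub>C\<^esub> \<gamma>))"
    unfolding y by (simp add: paste_def)
  finally show ?thesis by (simp add: over_square_def)
qed

lemma over_square_vcomp: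
  assumes c: "triangle Y (X, f) (X', f') c \<psi>" and d: "triangle Y (X, g) (X', g') d \<phi>"
    and e: "triangle Y (X, h) (X', h') e \<chi>"
    and a: "\<alpha> \<in> hom2 D f g" and a': "\<alpha>' \<in> hom2 D f' g'" and b: "\<beta> \<in> hom2 D g h" and b': "\<beta>' \<in> hom2 D g' h'"
    and ga: "\<gamma> \<in> hom2 C c d" and de: "\<delta> \<in> hom2 C d e"
    and s: "over_square \<psi> \<phi> \<alpha> \<alpha>' \<gamma>" and t: "over_square \<phi> \<chi> \<beta> \<beta>' \<delta>"
  shows "over_square \<psi> \<chi> (\<beta> \<bullet> \<alpha>) (\<beta>' \<bullet> \<alpha>') (\<delta> \<bullet>\<^bsub>C\<^esub> \<gamma>)"
proof -
  note [simp] = triangle_cell[OF c] triangle_cell[OF d] triangle_cell[OF e]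
    a[unfolded hom2_iff] a'[unfolded hom2_iff] b[unfolded hom2_iff] b'[unfolded hom2_iff]
    ga[unfolded hom2_iff] de[unfolded hom2_iff]
  have "(\<beta> \<bullet> \<alpha>) \<bullet> \<psi> = (\<beta> \<bullet> \<phi>) \<bullet> (\<alpha>' \<star> on_two L \<gamma>)"
    using s by (simp add: over_square_def)
  also have "\<dots> = \<chi> \<bullet> ((\<beta>' \<star> on_two L \<delta>) \<bullet> (\<alpha>' \<star> on_two L \<gamma>))"
    using t by (simp add: over_square_def)
  also have "\<dots> = \<chi> \<bullet> ((\<beta>' \<bullet> \<alpha>') \<star> on_two L (\<delta> \<bullet>\<^bsub>C\<^esub> \<gamma>))"
    by (simp add: D.interchange')
  finally show ?thesis by (simp add: over_square_def)
qed

lemma over_square_id: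
  assumes "triangle Y (X, f) (X', f') c \<psi>"
  shows "over_square \<psi> \<psi> (id2 D f) (id2 D f') (id2 C c)"
  using triangle_cell[OF assms] by (simp add: over_square_def)

end

section \<open>The pseudo-slices are 2-categories and double categories\<close>

context pseudo_functor
begin

lemma over_mors_iff: "(x, y, c, \<psi>) \<in> over_mors C D L Y \<longleftrightarrow> triangle Y x y c \<psi>"
  by (cases x; cases y) (auto simp: over_mors_def triangle_def)

lemma over_comp1_eq:
  "over_comp1 C D L (y, (X'', f''), c', \<psi>') ((X, f), y', c, \<psi>)
    = ((X, f), (X'', f''), c' \<cdot>\<^bsub>C\<^esub> c, paste f'' c c' \<psi> \<psi>')"
  by (simp add: over_comp1_def paste_def)

lemma over_square_ids:
  assumes "triangle Y (X, f) (X', f') c \<psi>"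
  shows "over_square \<psi> \<phi> (id2 D f) (id2 D f') \<gamma> \<longleftrightarrow> \<phi> \<bullet> (id2 D f' \<star> on_two L \<gamma>) = \<psi>"
  using triangle_cell[OF assms] by (auto simp: over_square_def)

lemma slice_simps:
  "Ob (slice_over C D L Y) = over_obs C D L Y" "Mor (slice_over C D L Y) = over_mors C D L Y"
  "dom1 (slice_over C D L Y) (x, y, c, \<psi>) = x" "cod1 (slice_over C D L Y) (x, y, c, \<psi>) = y"
  "dom2 (slice_over C D L Y) (p, q, \<gamma>) = p" "cod2 (slice_over C D L Y) (p, q, \<gamma>) = q"
  "id1 (slice_over C D L Y) (X, f) = ((X, f), (X, f), id1 C X, id2 D f)"
  "id2 (slice_over C D L Y) (x, y, c, \<psi>) = ((x, y, c, \<psi>), (x, y, c, \<psi>), id2 C c)"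
  "comp1 (slice_over C D L Y) (y, (X'', f''), c', \<psi>') ((X, f), y', c, \<psi>)
    = ((X, f), (X'', f''), c' \<cdot>\<^bsub>C\<^esub> c, paste f'' c c' \<psi> \<psi>')"
  "vcomp (slice_over C D L Y) (p', q, \<delta>) (p, q', \<gamma>) = (p, q, \<delta> \<bullet>\<^bsub>C\<^esub> \<gamma>)"
  "hcomp (slice_over C D L Y) ((y, (X'', f''), c', \<psi>'), (z, (W'', g''), d', \<phi>'), \<delta>)
      (((X, f), y', c, \<psi>), ((W, g), z', d, \<phi>), \<gamma>)
    = (((X, f), (X'', f''), c' \<cdot>\<^bsub>C\<^esub> c, paste f'' c c' \<psi> \<psi>'),
       ((W, g), (W'', g''), d' \<cdot>\<^bsub>C\<^esub> d, paste g'' d d' \<phi> \<phi>'), \<delta> \<star>\<^bsub>C\<^esub> \<gamma>)"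
  by (simp_all add: slice_over_def over_id1_def over_comp1_eq)

lemma slice_hom1_iff: "(x', y', c, \<psi>) \<in> hom1 (slice_over C D L Y) x y \<longleftrightarrow> x' = x \<and> y' = y \<and> triangle Y x y c \<psi>"
  by (auto simp: hom1_def slice_simps over_mors_iff)

lemma slice_Two_iff: "(((X, f), (X', f'), c, \<psi>), ((W, g), (W', g'), d, \<phi>), \<gamma>) \<in> Two (slice_over C D L Y) \<longleftrightarrow>
    W = X \<and> g = f \<and> W' = X' \<and> g' = f' \<and> triangle Y (X, f) (X', f') c \<psi> \<and> triangle Y (X, f) (X', f') d \<phi> \<and>
    \<gamma> \<in> hom2 C c d \<and> over_square \<psi> \<phi> (id2 D f) (id2 D f') \<gamma>"
  by (auto simp: slice_over_def over_mors_iff over_square_ids)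

lemma slice_hom2_iff: "(p, q, \<gamma>) \<in> hom2 (slice_over C D L Y) ((X, f), (X', f'), c, \<psi>) ((W, g), (W', g'), d, \<phi>) \<longleftrightarrow>
    p = ((X, f), (X', f'), c, \<psi>) \<and> q = ((W, g), (W', g'), d, \<phi>) \<and>
    W = X \<and> g = f \<and> W' = X' \<and> g' = f' \<and> triangle Y (X, f) (X', f') c \<psi> \<and> triangle Y (X, f) (X', f') d \<phi> \<and>
    \<gamma> \<in> hom2 C c d \<and> over_square \<psi> \<phi> (id2 D f) (id2 D f') \<gamma>"
proof -
  let ?m = "((X, f), (X', f'), c, \<psi>)" and ?n = "((W, g), (W', g'), d, \<phi>)"
  have "(p, q, \<gamma>) \<in> hom2 (slice_over C D L Y) ?m ?n \<longleftrightarrow> p = ?m \<and> q = ?n \<and> (?m, ?n, \<gamma>) \<in> Two (slice_over C D L Y)"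
    by (auto simp: hom2_def slice_simps)
  then show ?thesis unfolding slice_Two_iff .
qed

lemma triangle_obs: "triangle Y x y c \<psi> \<Longrightarrow> x \<in> over_obs C D L Y \<and> y \<in> over_obs C D L Y"
  by (cases x; cases y) (auto simp: triangle_def)

lemma id2_hom2: "triangle Y (X, f) (X', f') c \<psi> \<Longrightarrow> id2 D f \<in> hom2 D f f \<and> id2 D f' \<in> hom2 D f' f'
    \<and> id2 C c \<in> hom2 C c c"
  using triangle_cell[of Y X f X' f' c \<psi>] by (simp add: hom2_def)

lemma slice_vcomp:
  assumes "triangle Y (X, f) (X', f') c \<psi>" "triangle Y (X, f) (X', f') d \<phi>" "triangle Y (X, f) (X', f') e \<chi>"
    "\<gamma> \<in> hom2 C c d" "\<delta> \<in> hom2 C d e"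
    "over_square \<psi> \<phi> (id2 D f) (id2 D f') \<gamma>" "over_square \<phi> \<chi> (id2 D f) (id2 D f') \<delta>"
  shows "\<delta> \<bullet>\<^bsub>C\<^esub> \<gamma> \<in> hom2 C c e \<and> over_square \<psi> \<chi> (id2 D f) (id2 D f') (\<delta> \<bullet>\<^bsub>C\<^esub> \<gamma>)"
  using over_square_vcomp[OF assms(1-3) _ _ _ _ assms(4-7)] id2_hom2[OF assms(1)] triangle_cell[OF assms(1)] assms(4,5)
  by (auto simp: hom2_iff)

lemma slice_hom_category: "category (hom_cat (slice_over C D L Y) x y)"
proof (cases x; cases y)
  fix X f X' f' assume xy: "x = (X, f)" "y = (X', f')"
  let ?H = "hom_cat (slice_over C D L Y) x y"
  have obj: "(x', y', c, \<psi>) \<in> Obj ?H \<longleftrightarrow> x' = x \<and> y' = y \<and> triangle Y x y c \<psi>" for x' y' c \<psi>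
    by (simp add: hom_cat_def slice_hom1_iff)
  have arr: "(p, q, \<gamma>) \<in> Homs ?H (x, y, c, \<psi>) (x, y, d, \<phi>) \<longleftrightarrow> p = (x, y, c, \<psi>) \<and> q = (x, y, d, \<phi>) \<and>
      triangle Y x y c \<psi> \<and> triangle Y x y d \<phi> \<and> \<gamma> \<in> hom2 C c d \<and> over_square \<psi> \<phi> (id2 D f) (id2 D f') \<gamma>"
    for p q c \<psi> d \<phi> \<gamma>
  proof -
    have "(p, q, \<gamma>) \<in> Homs ?H (x, y, c, \<psi>) (x, y, d, \<phi>) \<longleftrightarrow> triangle Y x y c \<psi> \<and> triangle Y x y d \<phi> \<and>
        (p, q, \<gamma>) \<in> hom2 (slice_over C D L Y) (x, y, c, \<psi>) (x, y, d, \<phi>)"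
      by (auto simp: Homs_def hom_cat_def hom2_def slice_simps slice_hom1_iff)
    then show ?thesis unfolding xy slice_hom2_iff by blast
  qed
  have H: "\<alpha> \<in> Homs ?H u v \<longleftrightarrow> (\<exists>c d \<psi> \<phi> \<gamma>. u = (x, y, c, \<psi>) \<and> v = (x, y, d, \<phi>) \<and> \<alpha> = (u, v, \<gamma>) \<and>
      triangle Y x y c \<psi> \<and> triangle Y x y d \<phi> \<and> \<gamma> \<in> hom2 C c d \<and> over_square \<psi> \<phi> (id2 D f) (id2 D f') \<gamma>)"
    for u v \<alpha>
  proof
    assume a: "\<alpha> \<in> Homs ?H u v"
    obtain x1 y1 c \<psi> x2 y2 d \<phi> p q \<gamma> where [simp]: "u = (x1, y1, c, \<psi>)" "v = (x2, y2, d, \<phi>)" "\<alpha> = (p, q, \<gamma>)"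
      by (metis surj_pair)
    have "x1 = x" "y1 = y" "x2 = x" "y2 = y"
      using a by (auto simp: Homs_def hom_cat_def hom1_def) (auto simp: slice_over_def)
    with a show "\<exists>c d \<psi> \<phi> \<gamma>. u = (x, y, c, \<psi>) \<and> v = (x, y, d, \<phi>) \<and> \<alpha> = (u, v, \<gamma>) \<and>
      triangle Y x y c \<psi> \<and> triangle Y x y d \<phi> \<and> \<gamma> \<in> hom2 C c d \<and> over_square \<psi> \<phi> (id2 D f) (id2 D f') \<gamma>"
      by (auto simp: arr)
  qed (auto simp: arr)
  have [simp]: "Idn ?H (x, y, c, \<psi>) = ((x, y, c, \<psi>), (x, y, c, \<psi>), id2 C c)"
    "(p', r, \<delta>) \<odot>\<^bsub>?H\<^esub> (p, q', \<gamma>) = (p, r, \<delta> \<bullet>\<^bsub>C\<^esub> \<gamma>)" for c \<psi> \<delta> \<gamma> p p' q' r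
    by (simp_all add: hom_cat_def slice_over_def)
  show "category ?H"
  proof
    fix \<alpha> assume "\<alpha> \<in> Arr ?H"
    then show "Dom ?H \<alpha> \<in> Obj ?H" "Cod ?H \<alpha> \<in> Obj ?H" by (auto simp: hom_cat_def)
  next
    fix u assume u: "u \<in> Obj ?H"
    then obtain c \<psi> where "u = (x, y, c, \<psi>)" "triangle Y x y c \<psi>" by (cases u) (auto simp: obj)
    then show "Idn ?H u \<in> Homs ?H u u"
      using id2_hom2[of Y X f X' f' c \<psi>] over_square_id[of Y X f X' f' c \<psi>] by (simp add: H flip: xy)
  next
    fix \<alpha> \<beta> u v w assume "\<alpha> \<in> Homs ?H u v" "\<beta> \<in> Homs ?H v w"
    then show "\<beta> \<odot>\<^bsub>?H\<^esub> \<alpha> \<in> Homs ?H u w"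
      using slice_vcomp[of Y X f X' f'] by (fastforce simp: H simp flip: xy)
  next
    fix \<alpha> u v assume "\<alpha> \<in> Homs ?H u v"
    then show "\<alpha> \<odot>\<^bsub>?H\<^esub> Idn ?H u = \<alpha>" "Idn ?H v \<odot>\<^bsub>?H\<^esub> \<alpha> = \<alpha>"
      by (auto simp: H hom2_def)
  next
    fix \<alpha> \<beta> \<gamma> u v w z assume "\<alpha> \<in> Homs ?H u v" "\<beta> \<in> Homs ?H v w" "\<gamma> \<in> Homs ?H w z"
    then show "(\<gamma> \<odot>\<^bsub>?H\<^esub> \<beta>) \<odot>\<^bsub>?H\<^esub> \<alpha> = \<gamma> \<odot>\<^bsub>?H\<^esub> (\<beta> \<odot>\<^bsub>?H\<^esub> \<alpha>)"
      by (auto simp: H hom2_def)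
  qed
qed

text \<open>The 2-cells of the slice are the squares whose vertical sides are identities; the laws of composition of
  morphisms are \<open>paste_id\<close> and \<open>paste_assoc\<close>, and all others are inherited from \<open>C\<close>.\<close>

theorem slice_over_two_category: "two_category (slice_over C D L Y)"
proof -
  let ?A = "slice_over C D L Y"
  note simps = slice_hom1_iff slice_hom2_iff slice_Two_iff slice_simps over_mors_iff
  show ?thesis
  proof (rule two_category.intro, simp_all only: split_paired_all, goal_cases)
    case 1 then show ?case by (auto simp: slice_over_def over_mors_iff dest: triangle_obs)
  next case 2 then show ?case by (auto simp: slice_over_def over_mors_iff dest: triangle_obs)
  next case 3 then show ?case by (auto simp: simps)
  next case 4 then show ?case by (auto simp: simps)
  next case 5 then show ?case by (auto simp: simps)
  next case 6 then show ?case by (auto simp: simps)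
  next case 7 show ?case by (rule slice_hom_category)
  next case 8 then show ?case using triangle_id by (auto simp: simps)
  next case 9 then show ?case using triangle_paste by (auto simp: simps)
  next case 10 then show ?case by (auto simp: simps paste_id triangle_cell)
  next case 11 then show ?case by (auto simp: simps paste_id triangle_cell)
  next case 12 then show ?case by (auto simp: simps paste_assoc triangle_cell)
  next case 13 then show ?case
      by (auto simp: simps triangle_paste C.hcomp_cell triangle_cell hom2_iff intro!: over_square_hcomp)
  next case 14 then show ?case by (auto simp: simps triangle_cell)
  next case 15 then show ?case by (auto simp: simps triangle_cell hom2_iff C.interchange')
  next case 16 then show ?case by (auto simp: simps paste_id triangle_cell hom2_iff)
  next case 17 then show ?case by (auto simp: simps paste_id triangle_cell hom2_iff)
  next case 18 then show ?case by (auto simp: simps paste_assoc triangle_cell hom2_iff)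
  qed
qed

end

context pseudo_functor
begin

lemma dbl_simps:
  "DOb (dbl_slice_over C D L Y) = over_obs C D L Y" "Hor (dbl_slice_over C D L Y) = over_mors C D L Y"
  "Ver (dbl_slice_over C D L Y) = dbl_over_vers C D L Y"
  "hdom (dbl_slice_over C D L Y) (x, y, c, \<psi>) = x" "hcod (dbl_slice_over C D L Y) (x, y, c, \<psi>) = y"
  "vdom (dbl_slice_over C D L Y) (x, z, \<alpha>) = x" "vcod (dbl_slice_over C D L Y) (x, z, \<alpha>) = z"
  "sq_top (dbl_slice_over C D L Y) (t, b, l, r, \<gamma>) = t" "sq_bot (dbl_slice_over C D L Y) (t, b, l, r, \<gamma>) = b"
  "sq_left (dbl_slice_over C D L Y) (t, b, l, r, \<gamma>) = l" "sq_right (dbl_slice_over C D L Y) (t, b, l, r, \<gamma>) = r"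
  "hor_id (dbl_slice_over C D L Y) (X, f) = ((X, f), (X, f), id1 C X, id2 D f)"
  "hor_comp (dbl_slice_over C D L Y) (y, (X'', f''), c', \<psi>') ((X, f), y', c, \<psi>)
    = ((X, f), (X'', f''), c' \<cdot>\<^bsub>C\<^esub> c, paste f'' c c' \<psi> \<psi>')"
  "ver_id (dbl_slice_over C D L Y) (X, f) = ((X, f), (X, f), id2 D f)"
  "ver_comp (dbl_slice_over C D L Y) (z', z, \<alpha>') (x, z'', \<alpha>) = (x, z, \<alpha>' \<bullet> \<alpha>)"
  "sq_hid (dbl_slice_over C D L Y) ((X, f), (X', g), \<alpha>) = (((X, f), (X, f), id1 C X, id2 D f),
      ((X', g), (X', g), id1 C X', id2 D g), ((X, f), (X', g), \<alpha>), ((X, f), (X', g), \<alpha>), id2 C (id1 C X))"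
  "sq_hcomp (dbl_slice_over C D L Y) ((y, (X'', f''), c', \<psi>'), (z, (W'', g''), d', \<phi>'), m, r, \<delta>)
      (((X, f), y', c, \<psi>), ((W, g), z', d, \<phi>), l, m', \<gamma>)
    = (((X, f), (X'', f''), c' \<cdot>\<^bsub>C\<^esub> c, paste f'' c c' \<psi> \<psi>'),
       ((W, g), (W'', g''), d' \<cdot>\<^bsub>C\<^esub> d, paste g'' d d' \<phi> \<phi>'), l, r, \<delta> \<star>\<^bsub>C\<^esub> \<gamma>)"
  "sq_vid (dbl_slice_over C D L Y) ((X, f), (X', f'), c, \<psi>) = (((X, f), (X', f'), c, \<psi>), ((X, f), (X', f'), c, \<psi>),
        ((X, f), (X, f), id2 D f), ((X', f'), (X', f'), id2 D f'), id2 C c)"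
  "sq_vcomp (dbl_slice_over C D L Y) (t', b, (w1, w', \<beta>), (z1, z', \<beta>'), \<delta>) (t, b', (w, w2, \<alpha>), (z, z2, \<alpha>'), \<gamma>)
    = (t, b, (w, w', \<beta> \<bullet> \<alpha>), (z, z', \<beta>' \<bullet> \<alpha>'), \<delta> \<bullet>\<^bsub>C\<^esub> \<gamma>)"
  by (simp_all add: dbl_slice_over_def over_id1_def over_comp1_eq)

lemma dbl_ver_iff: "((X, f), (X', g), \<alpha>) \<in> dbl_over_vers C D L Y \<longleftrightarrow>
    X' = X \<and> X \<in> Ob C \<and> f \<in> hom1 D (on_ob L X) Y \<and> g \<in> hom1 D (on_ob L X) Y \<and> \<alpha> \<in> hom2 D f g"
  by (auto simp: dbl_over_vers_def over_obs_def)

lemma dbl_Sq_iff: "(((X, f), (X', f'), c, \<psi>), ((W, g), (W', g'), d, \<phi>), (w, z, \<alpha>), (w', z', \<alpha>'), \<gamma>)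
      \<in> Sq (dbl_slice_over C D L Y) \<longleftrightarrow>
    W = X \<and> W' = X' \<and> w = (X, f) \<and> z = (X, g) \<and> w' = (X', f') \<and> z' = (X', g') \<and>
    triangle Y (X, f) (X', f') c \<psi> \<and> triangle Y (X, g) (X', g') d \<phi> \<and>
    \<alpha> \<in> hom2 D f g \<and> \<alpha>' \<in> hom2 D f' g' \<and> \<gamma> \<in> hom2 C c d \<and> over_square \<psi> \<phi> \<alpha> \<alpha>' \<gamma>"
  by (auto simp: dbl_slice_over_def over_mors_iff dbl_ver_iff over_square_def triangle_def over_obs_def)

theorem dbl_slice_over_double_category: "double_category (dbl_slice_over C D L Y)"
proof -
  let ?A = "dbl_slice_over C D L Y"
  note simps = Homs_def dbl_simps over_mors_iff dbl_ver_iff dbl_Sq_iff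
  show ?thesis
  proof (rule double_category.intro, simp_all only: split_paired_all, goal_cases)
    case 1
    show ?case
    proof (rule category.intro, simp_all only: split_paired_all, goal_cases)
      case 1 then show ?case by (auto simp: simps dest: triangle_obs)
    next case 2 then show ?case by (auto simp: simps dest: triangle_obs)
    next case 3 then show ?case using triangle_id by (auto simp: simps)
    next case 4 then show ?case using triangle_paste by (auto simp: simps)
    next case 5 then show ?case by (auto simp: simps paste_id triangle_cell)
    next case 6 then show ?case by (auto simp: simps paste_id triangle_cell)
    next case 7 then show ?case by (auto simp: simps paste_assoc triangle_cell)
    qed
  next
    case 2
    show ?case
    proof (rule category.intro, simp_all only: split_paired_all, goal_cases)
      case 1 then show ?case by (auto simp: simps over_obs_def)
    next case 2 then show ?case by (auto simp: simps over_obs_def)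
    next case 3 then show ?case by (auto simp: simps over_obs_def hom1_iff hom2_iff)
    next case 4 then show ?case by (auto simp: simps hom2_iff)
    next case 5 then show ?case by (auto simp: simps hom2_iff)
    next case 6 then show ?case by (auto simp: simps hom2_iff)
    next case 7 then show ?case by (auto simp: simps hom2_iff)
    qed
  next
    case 3
    show ?case
    proof (rule category.intro, simp_all only: split_paired_all, goal_cases)
      case 1 then show ?case by (auto simp: simps triangle_iff hom1_iff)
    next case 2 then show ?case by (auto simp: simps triangle_iff hom1_iff)
    next case 3 then show ?case
        by (auto simp: simps triangle_iff hom1_iff hom2_iff over_square_def D.iso2_id2)
    next case 4 show ?case
        by (insert 4, clarsimp simp: simps, intro conjI, erule (1) triangle_paste, erule (1) triangle_paste,
          simp add: hom2_iff triangle_cell, rule over_square_hcomp, assumption+)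
    next case 5 then show ?case by (auto simp: simps paste_id triangle_cell hom2_iff)
    next case 6 then show ?case by (auto simp: simps paste_id triangle_cell hom2_iff)
    next case 7 then show ?case by (auto simp: simps paste_assoc triangle_cell hom2_iff)
    qed
  next
    case 4
    show ?case
    proof (rule category.intro, simp_all only: split_paired_all, goal_cases)
      case 1 then show ?case by (auto simp: simps)
    next case 2 then show ?case by (auto simp: simps)
    next case 3 then show ?case by (auto simp: simps over_square_id triangle_cell hom2_iff)
    next case 4 show ?case
        by (insert 4, clarsimp simp: simps, intro conjI, simp add: hom2_iff triangle_cell, simp add: hom2_iff triangle_cell,
          simp add: hom2_iff triangle_cell, rule over_square_vcomp, assumption+)
    next case 5 then show ?case by (auto simp: simps triangle_cell hom2_iff)
    next case 6 then show ?case by (auto simp: simps triangle_cell hom2_iff)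
    next case 7 then show ?case by (auto simp: simps triangle_cell hom2_iff)
    qed
  next
    case 5 then show ?case by (auto simp: sq_def simps)
  next
    case 6 then show ?case
      by (auto simp: sq_def ver_def simps triangle_iff hom1_iff hom2_iff over_square_def D.iso2_id2)
  next
    case 7 then show ?case
      by (auto simp: sq_def hor_def simps over_square_id triangle_cell hom2_iff)
  next
    case 8 show ?case
        by (insert 8, clarsimp simp: sq_def simps, intro conjI, erule (1) triangle_paste, erule (1) triangle_paste,
          simp add: hom2_iff triangle_cell, rule over_square_hcomp, assumption+)
  next
    case 9 show ?case
        by (insert 9, clarsimp simp: sq_def simps, intro conjI, simp add: hom2_iff triangle_cell, simp add: hom2_iff triangle_cell,
          simp add: hom2_iff triangle_cell, rule over_square_vcomp, assumption+)
  next
    case 10 then show ?case by (auto simp: simps over_obs_def hom1_iff)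
  next
    case 11 then show ?case by (auto simp: ver_def simps over_obs_def hom1_iff)
  next
    case 12 then show ?case by (auto simp: hor_def simps triangle_cell)
  next
    case 13 then show ?case by (auto simp: sq_def simps triangle_cell hom2_iff C.interchange')
  qed
qed

end

section \<open>Arrow 2-categories\<close>

context two_category
begin

lemma Ar_simps:
  "Ob (Ar C) = Ob C" "Mor (Ar C) = Two C" "dom1 (Ar C) \<alpha> = dom1 C (dom2 C \<alpha>)"
  "cod1 (Ar C) \<alpha> = cod1 C (dom2 C \<alpha>)" "dom2 (Ar C) (\<alpha>, \<beta>, \<sigma>, \<tau>) = \<alpha>" "cod2 (Ar C) (\<alpha>, \<beta>, \<sigma>, \<tau>) = \<beta>"
  "id1 (Ar C) X = id2 C (id1 C X)" "id2 (Ar C) \<alpha> = (\<alpha>, \<alpha>, id2 C (dom2 C \<alpha>), id2 C (cod2 C \<alpha>))"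
  "comp1 (Ar C) = hcomp C"
  "vcomp (Ar C) (\<beta>', \<gamma>, \<sigma>', \<tau>') (\<alpha>, \<beta>, \<sigma>, \<tau>) = (\<alpha>, \<gamma>, \<sigma>' \<bullet> \<sigma>, \<tau>' \<bullet> \<tau>)"
  "hcomp (Ar C) (\<alpha>', \<beta>', \<sigma>', \<tau>') (\<alpha>, \<beta>, \<sigma>, \<tau>) = (\<alpha>' \<star> \<alpha>, \<beta>' \<star> \<beta>, \<sigma>' \<star> \<sigma>, \<tau>' \<star> \<tau>)"
  by (simp_all add: Ar_def)

lemma Ar_hom1_iff: "\<alpha> \<in> hom1 (Ar C) X Y \<longleftrightarrow> \<alpha> \<in> Two C \<and> dom1 C (dom2 C \<alpha>) = X \<and> cod1 C (dom2 C \<alpha>) = Y"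
  by (simp add: hom1_def Ar_simps)

lemma Ar_Two_iff: "(\<alpha>, \<beta>, \<sigma>, \<tau>) \<in> Two (Ar C) \<longleftrightarrow> \<alpha> \<in> Two C \<and> \<beta> \<in> Two C \<and>
    \<sigma> \<in> Two C \<and> dom2 C \<sigma> = dom2 C \<alpha> \<and> cod2 C \<sigma> = dom2 C \<beta> \<and>
    \<tau> \<in> Two C \<and> dom2 C \<tau> = cod2 C \<alpha> \<and> cod2 C \<tau> = cod2 C \<beta> \<and> \<beta> \<bullet> \<sigma> = \<tau> \<bullet> \<alpha>"
  by (auto simp: Ar_def hom2_def)

lemma Ar_boundary: "(\<alpha>, \<beta>, \<sigma>, \<tau>) \<in> Two (Ar C) \<Longrightarrow>
    dom1 C (dom2 C \<beta>) = dom1 C (dom2 C \<alpha>) \<and> cod1 C (dom2 C \<beta>) = cod1 C (dom2 C \<alpha>)"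
  using cod2_boundary[of \<sigma>] by (auto simp: Ar_Two_iff)

lemma Ar_hom2_iff: "(\<alpha>', \<beta>', \<sigma>, \<tau>) \<in> hom2 (Ar C) \<alpha> \<beta> \<longleftrightarrow> \<alpha>' = \<alpha> \<and> \<beta>' = \<beta> \<and> (\<alpha>, \<beta>, \<sigma>, \<tau>) \<in> Two (Ar C)"
  by (auto simp: hom2_def Ar_simps)

lemma Ar_vcomp:
  assumes "(\<alpha>, \<beta>, \<sigma>, \<tau>) \<in> Two (Ar C)" "(\<beta>, \<gamma>, \<sigma>', \<tau>') \<in> Two (Ar C)"
  shows "(\<alpha>, \<gamma>, \<sigma>' \<bullet> \<sigma>, \<tau>' \<bullet> \<tau>) \<in> Two (Ar C)"
proof -
  note [simp] = assms[unfolded Ar_Two_iff]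
  have "\<gamma> \<bullet> (\<sigma>' \<bullet> \<sigma>) = (\<gamma> \<bullet> \<sigma>') \<bullet> \<sigma>" by (rule vcomp_assoc[symmetric]) simp_all
  also have "\<dots> = \<tau>' \<bullet> (\<beta> \<bullet> \<sigma>)" by simp
  also have "\<dots> = (\<tau>' \<bullet> \<tau>) \<bullet> \<alpha>" by simp
  finally show ?thesis by (simp add: Ar_Two_iff)
qed

lemma Ar_hcomp:
  assumes "(\<alpha>, \<beta>, \<sigma>, \<tau>) \<in> Two (Ar C)" "(\<alpha>', \<beta>', \<sigma>', \<tau>') \<in> Two (Ar C)" "dom1 C (dom2 C \<alpha>') = cod1 C (dom2 C \<alpha>)"
  shows "(\<alpha>' \<star> \<alpha>, \<beta>' \<star> \<beta>, \<sigma>' \<star> \<sigma>, \<tau>' \<star> \<tau>) \<in> Two (Ar C)"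
proof -
  note 1 = assms(1,2)[unfolded Ar_Two_iff]
  have "dom1 C (dom2 C \<beta>') = dom1 C (dom2 C \<alpha>')" "cod1 C (dom2 C \<beta>) = cod1 C (dom2 C \<alpha>)"
    using 1 cod2_boundary[of \<sigma>] cod2_boundary[of \<sigma>'] by simp_all
  then show ?thesis using 1 assms(3) by (simp add: Ar_Two_iff interchange')
qed

theorem Ar_two_category: "two_category (Ar C)"
proof (rule two_category.intro, simp_all only: split_paired_all, goal_cases)
  case (7 X Y)
  have H: "(\<alpha>', \<beta>', \<sigma>, \<tau>) \<in> Homs (hom_cat (Ar C) X Y) \<alpha> \<beta> \<longleftrightarrow> \<alpha>' = \<alpha> \<and> \<beta>' = \<beta> \<and>
      \<alpha> \<in> hom1 (Ar C) X Y \<and> \<beta> \<in> hom1 (Ar C) X Y \<and> (\<alpha>, \<beta>, \<sigma>, \<tau>) \<in> Two (Ar C)" for \<alpha> \<beta> \<alpha>' \<beta>' \<sigma> \<tau>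
    by (auto simp: Homs_def hom_cat_def Ar_simps)
  show ?case
  proof (rule category.intro, simp_all only: split_paired_all, goal_cases)
    case 1 then show ?case by (simp add: hom_cat_def)
  next case 2 then show ?case by (simp add: hom_cat_def)
  next case 3 then show ?case by (auto simp: hom_cat_def Homs_def Ar_simps Ar_hom1_iff Ar_Two_iff)
  next case 4 then show ?case by (auto simp: H hom_cat_simps Ar_simps intro!: Ar_vcomp)
  next case 5 then show ?case by (auto simp: H hom_cat_simps Ar_simps Ar_Two_iff)
  next case 6 then show ?case by (auto simp: H hom_cat_simps Ar_simps Ar_Two_iff)
  next case 7 then show ?case by (auto simp: H hom_cat_simps Ar_simps Ar_Two_iff)
  qed
next
  case 13 then show ?case by (auto simp: Ar_hom1_iff Ar_hom2_iff Ar_simps intro!: Ar_hcomp)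
next
  case 5 then show ?case by (simp add: Ar_simps Ar_boundary)
next
  case 6 then show ?case by (simp add: Ar_simps Ar_boundary)
next
  case 15 then show ?case
    using Ar_boundary by (auto simp: Ar_hom1_iff Ar_hom2_iff Ar_Two_iff Ar_simps interchange')
next
  case 16 then show ?case
    by (clarsimp simp: Ar_hom2_iff) (frule Ar_boundary, auto simp: Ar_hom1_iff Ar_Two_iff Ar_simps)
next
  case 17 then show ?case
    by (clarsimp simp: Ar_hom2_iff) (frule Ar_boundary, auto simp: Ar_hom1_iff Ar_Two_iff Ar_simps)
next
  case (18 f X Y f' Z f'' W)
  then show ?case
    by (clarsimp simp: Ar_hom2_iff)
      (frule Ar_boundary[of f], frule Ar_boundary[of f'], frule Ar_boundary[of f''], simp add: Ar_hom1_iff Ar_Two_iff Ar_simps)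
qed (auto simp: Ar_hom1_iff Ar_hom2_iff Ar_Two_iff Ar_simps interchange')

text \<open>A commutative square of 2-cells with invertible components \<open>\<sigma>\<close> and \<open>\<tau>\<close> remains commutative when these are
  replaced by their inverses.\<close>

lemma Ar_iso2_iff: "(\<alpha>', \<beta>', \<sigma>, \<tau>) \<in> iso2 (Ar C) \<alpha> \<beta> \<longleftrightarrow> \<alpha>' = \<alpha> \<and> \<beta>' = \<beta> \<and> \<alpha> \<in> Two C \<and> \<beta> \<in> Two C \<and>
    \<sigma> \<in> iso2 C (dom2 C \<alpha>) (dom2 C \<beta>) \<and> \<tau> \<in> iso2 C (cod2 C \<alpha>) (cod2 C \<beta>) \<and> \<beta> \<bullet> \<sigma> = \<tau> \<bullet> \<alpha>"
  (is "?l \<longleftrightarrow> ?r")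
proof
  assume l: ?l
  then obtain \<sigma>' \<tau>' where "inverse2 (Ar C) (\<alpha>, \<beta>, \<sigma>, \<tau>) (\<beta>, \<alpha>, \<sigma>', \<tau>')" and [simp]: "\<alpha>' = \<alpha>" "\<beta>' = \<beta>"
    by (auto simp: iso2_def Ar_hom2_iff inverse2_def Ar_simps)
  then have "inverse2 C \<sigma> \<sigma>'" "inverse2 C \<tau> \<tau>'"
    by (auto simp: inverse2_def Ar_simps Ar_hom2_iff Ar_Two_iff hom2_iff)
  then show ?r using l by (auto simp: iso2_def Ar_hom2_iff Ar_Two_iff hom2_iff)
next
  assume r: ?r
  then have s: "\<sigma> \<in> iso2 C (dom2 C \<alpha>) (dom2 C \<beta>)" and t: "\<tau> \<in> iso2 C (cod2 C \<alpha>) (cod2 C \<beta>)"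
    and ab: "\<alpha> \<in> Two C" "\<beta> \<in> Two C" and e: "\<beta> \<bullet> \<sigma> = \<tau> \<bullet> \<alpha>" by auto
  note c = iso2_cell[OF s] iso2_cell[OF t] iso2_cell[OF inv2_iso2[OF s]] iso2_cell[OF inv2_iso2[OF t]]
  have "\<alpha> \<bullet> inv2 C \<sigma> = inv2 C \<tau> \<bullet> ((\<tau> \<bullet> \<alpha>) \<bullet> inv2 C \<sigma>)"
    using c ab inv2_cancel(1)[OF t] by simp
  also have "\<dots> = inv2 C \<tau> \<bullet> \<beta>"
    unfolding e[symmetric] using c ab inv2_laws[OF s] by simp
  finally have "inverse2 (Ar C) (\<alpha>, \<beta>, \<sigma>, \<tau>) (\<beta>, \<alpha>, inv2 C \<sigma>, inv2 C \<tau>)"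
    using c ab e inv2_laws[OF s] inv2_laws[OF t] by (auto simp: inverse2_def Ar_simps Ar_hom2_iff Ar_Two_iff)
  from two_category.iso2I[OF Ar_two_category this] show ?l using r by (simp add: Ar_simps)
qed

end

context pseudo_functor
begin

lemma Ar_psf_simps:
  "on_ob (Ar_psf C D L) = on_ob L" "on_mor (Ar_psf C D L) = on_two L"
  "on_two (Ar_psf C D L) (\<alpha>, \<beta>, \<sigma>, \<tau>) = (on_two L \<alpha>, on_two L \<beta>, on_two L \<sigma>, on_two L \<tau>)"
  "cmpr (Ar_psf C D L) \<alpha> \<alpha>' = (on_two L \<alpha>' \<star> on_two L \<alpha>, on_two L (\<alpha>' \<star>\<^bsub>C\<^esub> \<alpha>),
     cmpr L (dom2 C \<alpha>) (dom2 C \<alpha>'), cmpr L (cod2 C \<alpha>) (cod2 C \<alpha>'))"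
  by (simp_all add: Ar_psf_def)

lemma cmpr_natural':
  assumes "\<alpha> \<in> Two C" "\<beta> \<in> Two C" "dom1 C (dom2 C \<beta>) = cod1 C (dom2 C \<alpha>)"
  shows "on_two L (\<beta> \<star>\<^bsub>C\<^esub> \<alpha>) \<bullet> cmpr L (dom2 C \<alpha>) (dom2 C \<beta>)
    = cmpr L (cod2 C \<alpha>) (cod2 C \<beta>) \<bullet> (on_two L \<beta> \<star> on_two L \<alpha>)"
  using assms by (intro cmpr_natural) (auto simp: hom1_def hom2_def)

lemma cmpr_assoc':
  assumes "a \<in> Mor C" "b \<in> Mor C" "c \<in> Mor C" "dom1 C b = cod1 C a" "dom1 C c = cod1 C b"
  shows "cmpr L (b \<cdot>\<^bsub>C\<^esub> a) c \<bullet> (id2 D (on_mor L c) \<star> cmpr L a b)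
    = cmpr L a (c \<cdot>\<^bsub>C\<^esub> b) \<bullet> (cmpr L b c \<star> id2 D (on_mor L a))"
  using assms by (intro cmpr_assoc) (auto simp: hom1_def)

lemma on_two_square:
  assumes "(\<alpha>, \<beta>, \<sigma>, \<tau>) \<in> Two (Ar C)"
  shows "(on_two L \<alpha>, on_two L \<beta>, on_two L \<sigma>, on_two L \<tau>) \<in> Two (Ar D)"
proof -
  have "on_two L \<beta> \<bullet> on_two L \<sigma> = on_two L (\<beta> \<bullet>\<^bsub>C\<^esub> \<sigma>)"
    using assms by (intro on_two_vcomp[symmetric]) (simp_all add: C.Ar_Two_iff)
  also have "\<dots> = on_two L (\<tau> \<bullet>\<^bsub>C\<^esub> \<alpha>)" using assms by (simp add: C.Ar_Two_iff)
  also have "\<dots> = on_two L \<tau> \<bullet> on_two L \<alpha>"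
    using assms by (intro on_two_vcomp) (simp_all add: C.Ar_Two_iff)
  finally show ?thesis using assms by (simp add: C.Ar_Two_iff D.Ar_Two_iff)
qed

text \<open>Each axiom is the corresponding axiom of \<open>L\<close> for the sources and for the targets; that the compositors
  are 2-cells of \<open>Ar D\<close> is the naturality of those of \<open>L\<close>.\<close>

lemma Ar_pseudo_functor: "pseudo_functor (Ar C) (Ar D) (Ar_psf C D L)"
proof -
  note simps = C.Ar_simps D.Ar_simps C.Ar_hom1_iff D.Ar_hom1_iff C.Ar_hom2_iff D.Ar_hom2_iff Ar_psf_simps
  have "normal_pseudo_functor (Ar C) (Ar D) (Ar_psf C D L)"
  proof (rule normal_pseudo_functor.intro, simp_all only: split_paired_all, goal_cases)
    case 1 then show ?case by (simp add: simps)
  next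
    case (2 X Y)
    have H: "m \<in> Homs (hom_cat (Ar C) X Y) \<alpha> \<beta> \<longleftrightarrow> m \<in> hom2 (Ar C) \<alpha> \<beta>"
      if "\<alpha> \<in> hom1 (Ar C) X Y" "\<beta> \<in> hom1 (Ar C) X Y" for m \<alpha> \<beta>
      using that two_category.Homs_hom_cat[OF C.Ar_two_category] by blast
    have K: "m \<in> Homs (hom_cat (Ar D) (on_ob L X) (on_ob L Y)) \<alpha> \<beta> \<longleftrightarrow> m \<in> hom2 (Ar D) \<alpha> \<beta>"
      if "\<alpha> \<in> hom1 (Ar D) (on_ob L X) (on_ob L Y)" "\<beta> \<in> hom1 (Ar D) (on_ob L X) (on_ob L Y)" for m \<alpha> \<beta>
      using that two_category.Homs_hom_cat[OF D.Ar_two_category] by blast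
    show ?case
      unfolding is_functor_def hom_cat_simps
      by (auto simp: H K simps on_two_square Ball_def split_paired_All) (auto simp: C.Ar_Two_iff)
  next
    case 3 then show ?case by (simp add: simps)
  next
    case 4 then show ?case by (simp add: simps D.Ar_iso2_iff cmpr_iso2' cmpr_natural')
  next
    case 5 then show ?case by (auto simp: simps C.Ar_Two_iff hom1_iff hom2_iff intro!: cmpr_natural)
  next
    case 6 then show ?case by (auto simp: simps intro!: cmpr_assoc')
  next
    case 7 then show ?case by (auto simp: simps)
  next
    case 8 then show ?case by (auto simp: simps)
  qed
  then show ?thesis
    by (intro pseudo_functor.intro C.Ar_two_category D.Ar_two_category)
qed

end

section \<open>Couniversal arrows\<close>

lemma ex1_pairE:
  assumes "\<exists>!(a, b). P a b"
  obtains a b where "P a b" "\<And>a' b'. P a' b' \<Longrightarrow> a' = a \<and> b' = b"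
proof -
  obtain r where r: "case r of (a, b) \<Rightarrow> P a b" and u: "\<And>s. (case s of (a, b) \<Rightarrow> P a b) \<Longrightarrow> s = r"
    using assms by (elim ex1E) blast
  obtain a b where ab: "r = (a, b)" by (cases r)
  show thesis
  proof (rule that)
    show "P a b" using r ab by simp
    show "a' = a \<and> b' = b" if "P a' b'" for a' b' using u[of "(a', b')"] that ab by simp
  qed
qed

context pseudo_functor
begin

text \<open>Essential surjectivity and full faithfulness, for every \<open>X\<close>, of the functor \<open>e (L -)\<close> from \<open>C(X, R)\<close> to
  \<open>D(L X, Y)\<close>.\<close>

definition couniversal :: "'p \<Rightarrow> 'o \<Rightarrow> 'n \<Rightarrow> bool" where
  "couniversal Y R e \<longleftrightarrow> R \<in> Ob C \<and> e \<in> hom1 D (on_ob L R) Y \<and>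
     (\<forall>X \<in> Ob C. \<forall>f \<in> hom1 D (on_ob L X) Y. \<exists>c \<in> hom1 C X R. \<exists>\<psi>. \<psi> \<in> iso2 D (e \<cdot> on_mor L c) f) \<and>
     (\<forall>X \<in> Ob C. \<forall>c \<in> hom1 C X R. \<forall>d \<in> hom1 C X R. \<forall>\<alpha> \<in> hom2 D (e \<cdot> on_mor L c) (e \<cdot> on_mor L d).
        \<exists>!\<gamma>. \<gamma> \<in> hom2 C c d \<and> id2 D e \<star> on_two L \<gamma> = \<alpha>)"

text \<open>As \<open>\<phi>\<close> is invertible, a square with right side \<open>id\<^sub>e\<close> prescribes the image of \<open>\<gamma>\<close> under \<open>e (L -)\<close>; this
  turns unique fillers into full faithfulness.\<close>

lemma over_square_solved:
  assumes c: "triangle Y (X, f) (R, e) c \<psi>" and d: "triangle Y (X, g) (R, e) d \<phi>"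
    and "\<alpha> \<in> hom2 D f g" and "\<gamma> \<in> hom2 C c d"
  shows "over_square \<psi> \<phi> \<alpha> (id2 D e) \<gamma> \<longleftrightarrow> id2 D e \<star> on_two L \<gamma> = inv2 D \<phi> \<bullet> (\<alpha> \<bullet> \<psi>)"
proof -
  note [simp] = triangle_cell(1-14)[OF c] triangle_cell(1-14)[OF d] assms(3,4)[unfolded hom2_iff]
  note i = triangle_cell(15)[OF d]
  note [simp] = D.iso2_cell[OF D.inv2_iso2[OF i]]
  show ?thesis
    using D.inv2_cancel(1)[OF i, of "id2 D e \<star> on_two L \<gamma>"] D.inv2_cancel(2)[OF i, of "\<alpha> \<bullet> \<psi>"]
    by (auto simp: over_square_def)
qed

lemma couniversal_triangle:
  assumes "couniversal Y R e" "(X, f) \<in> over_obs C D L Y"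
  shows "\<exists>c \<psi>. triangle Y (X, f) (R, e) c \<psi>"
  using assms unfolding couniversal_def triangle_def over_obs_def by fast

lemma couniversal_square:
  assumes "couniversal Y R e" and c: "triangle Y (X, f) (R, e) c \<psi>" and d: "triangle Y (X, g) (R, e) d \<phi>"
    and a: "\<alpha> \<in> hom2 D f g"
  shows "\<exists>!\<gamma>. \<gamma> \<in> hom2 C c d \<and> over_square \<psi> \<phi> \<alpha> (id2 D e) \<gamma>"
proof -
  have "inv2 D \<phi> \<bullet> (\<alpha> \<bullet> \<psi>) \<in> hom2 D (e \<cdot> on_mor L c) (e \<cdot> on_mor L d)"
    using a triangle_cell[OF c] triangle_cell[OF d] D.iso2_cell[OF D.inv2_iso2[OF triangle_cell(15)[OF d]]]
    by (auto simp: hom2_iff)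
  moreover have "X \<in> Ob C" "c \<in> hom1 C X R" "d \<in> hom1 C X R"
    using triangle_cell[OF c] triangle_cell[OF d] by (auto simp: hom1_iff)
  ultimately have "\<exists>!\<gamma>. \<gamma> \<in> hom2 C c d \<and> id2 D e \<star> on_two L \<gamma> = inv2 D \<phi> \<bullet> (\<alpha> \<bullet> \<psi>)"
    using assms(1) unfolding couniversal_def by blast
  then show ?thesis using over_square_solved[OF c d a] by metis
qed

lemma triangle_trivial:
  assumes "R \<in> Ob C" "e \<in> hom1 D (on_ob L R) Y" "c \<in> hom1 C X R"
  shows "triangle Y (X, e \<cdot> on_mor L c) (R, e) c (id2 D (e \<cdot> on_mor L c))"
  using assms by (auto simp: triangle_iff hom1_iff D.iso2_id2)

lemma over_square_trivial:
  assumes "R \<in> Ob C" "e \<in> hom1 D (on_ob L R) Y" "c \<in> hom1 C X R" "d \<in> hom1 C X R"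
    "\<alpha> \<in> hom2 D (e \<cdot> on_mor L c) (e \<cdot> on_mor L d)" "\<gamma> \<in> hom2 C c d"
  shows "over_square (id2 D (e \<cdot> on_mor L c)) (id2 D (e \<cdot> on_mor L d)) \<alpha> (id2 D e) \<gamma> \<longleftrightarrow> id2 D e \<star> on_two L \<gamma> = \<alpha>"
  using over_square_solved[OF triangle_trivial[OF assms(1,2,3)] triangle_trivial[OF assms(1,2,4)] assms(5,6)] assms
  by (simp add: hom1_iff hom2_iff)

text \<open>Full faithfulness at \<open>c\<close> and \<open>d\<close> is the case of unique fillers between the tautological triangles
  \<open>(c, id)\<close> and \<open>(d, id)\<close>.\<close>

lemma couniversalI:
  assumes R: "R \<in> Ob C" "e \<in> hom1 D (on_ob L R) Y"
    and tri: "\<And>X f. (X, f) \<in> over_obs C D L Y \<Longrightarrow> \<exists>c \<psi>. triangle Y (X, f) (R, e) c \<psi>"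
    and sqr: "\<And>X f g c d \<psi> \<phi> \<alpha>. triangle Y (X, f) (R, e) c \<psi> \<Longrightarrow> triangle Y (X, g) (R, e) d \<phi> \<Longrightarrow>
      \<alpha> \<in> hom2 D f g \<Longrightarrow> \<exists>!\<gamma>. \<gamma> \<in> hom2 C c d \<and> over_square \<psi> \<phi> \<alpha> (id2 D e) \<gamma>"
  shows "couniversal Y R e"
  unfolding couniversal_def
proof (intro conjI ballI R)
  fix X f assume "X \<in> Ob C" "f \<in> hom1 D (on_ob L X) Y"
  then show "\<exists>c\<in>hom1 C X R. \<exists>\<psi>. \<psi> \<in> iso2 D (e \<cdot> on_mor L c) f"
    using tri[of X f] by (auto simp: over_obs_def triangle_def)
next
  fix X c d \<alpha> assume "X \<in> Ob C" and cd: "c \<in> hom1 C X R" "d \<in> hom1 C X R"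
    and a: "\<alpha> \<in> hom2 D (e \<cdot> on_mor L c) (e \<cdot> on_mor L d)"
  show "\<exists>!\<gamma>. \<gamma> \<in> hom2 C c d \<and> id2 D e \<star> on_two L \<gamma> = \<alpha>"
    using sqr[OF triangle_trivial[OF R cd(1)] triangle_trivial[OF R cd(2)] a] over_square_trivial[OF R cd a]
    by metis
qed

lemma contractible_dbl_slice_iff: "contractible_squares_to (dbl_slice_over C D L Y) (R, e) \<longleftrightarrow> couniversal Y R e"
proof -
  let ?A = "dbl_slice_over C D L Y"
  have hor: "(x', y', c, \<psi>) \<in> hor ?A x y \<longleftrightarrow> x' = x \<and> y' = y \<and> triangle Y x y c \<psi>" for x y x' y' c \<psi>
    by (auto simp: hor_def dbl_simps over_mors_iff)
  have sq: "(\<exists>!s. s \<in> sq ?A ((X, f), (R, e), c, \<psi>) ((X, g), (R, e), d, \<phi>) ((X, f), (X, g), \<alpha>) ((R, e), (R, e), id2 D e))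
      \<longleftrightarrow> (\<exists>!\<gamma>. \<gamma> \<in> hom2 C c d \<and> over_square \<psi> \<phi> \<alpha> (id2 D e) \<gamma>)" (is "(\<exists>!s. s \<in> ?S) \<longleftrightarrow> _")
    if t: "triangle Y (X, f) (R, e) c \<psi>" "triangle Y (X, g) (R, e) d \<phi>" "\<alpha> \<in> hom2 D f g"
    for X f g c d \<psi> \<phi> \<alpha>
  proof -
    let ?s = "\<lambda>\<gamma>. (((X, f), (R, e), c, \<psi>), ((X, g), (R, e), d, \<phi>), ((X, f), (X, g), \<alpha>), ((R, e), (R, e), id2 D e), \<gamma>)"
    have "?s \<gamma> \<in> Sq ?A \<longleftrightarrow> \<gamma> \<in> hom2 C c d \<and> over_square \<psi> \<phi> \<alpha> (id2 D e) \<gamma>" for \<gamma>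
      unfolding dbl_Sq_iff using t triangle_cell(6)[OF t(1)] by (simp add: hom2_iff)
    moreover have "s \<in> ?S \<longleftrightarrow> (\<exists>\<gamma>. s = ?s \<gamma> \<and> ?s \<gamma> \<in> Sq ?A)" for s
      by (cases s) (auto simp: sq_def dbl_simps)
    ultimately have "s \<in> ?S \<longleftrightarrow> (\<exists>\<gamma>. s = ?s \<gamma> \<and> \<gamma> \<in> hom2 C c d \<and> over_square \<psi> \<phi> \<alpha> (id2 D e) \<gamma>)" for s
      by simp
    then show ?thesis by auto
  qed
  show ?thesis
  proof
    assume c: "contractible_squares_to ?A (R, e)"
    show "couniversal Y R e"
    proof (rule couniversalI)
      show "R \<in> Ob C" "e \<in> hom1 D (on_ob L R) Y"
        using c by (auto simp: contractible_squares_to_def dbl_simps over_obs_def)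
    next
      fix X f assume "(X, f) \<in> over_obs C D L Y"
      then have "hor ?A (X, f) (R, e) \<noteq> {}" using c by (auto simp: contractible_squares_to_def dbl_simps)
      then show "\<exists>c \<psi>. triangle Y (X, f) (R, e) c \<psi>" using hor by fastforce
    next
      fix X f g c d \<psi> \<phi> \<alpha>
      assume t: "triangle Y (X, f) (R, e) c \<psi>" "triangle Y (X, g) (R, e) d \<phi>" "\<alpha> \<in> hom2 D f g"
      let ?u = "((X, f), (X, g), \<alpha>)"
      have "?u \<in> Ver ?A" using t(3) triangle_cell[OF t(1)] triangle_cell[OF t(2)]
        by (simp add: dbl_simps dbl_ver_iff hom1_iff)
      moreover have "((X, f), (R, e), c, \<psi>) \<in> hor ?A (vdom ?A ?u) (R, e)" "((X, g), (R, e), d, \<phi>) \<in> hor ?A (vcod ?A ?u) (R, e)"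
        using t by (auto simp: hor dbl_simps)
      ultimately have "\<exists>!s. s \<in> sq ?A ((X, f), (R, e), c, \<psi>) ((X, g), (R, e), d, \<phi>) ?u (ver_id ?A (R, e))"
        using c unfolding contractible_squares_to_def by blast
      then show "\<exists>!\<gamma>. \<gamma> \<in> hom2 C c d \<and> over_square \<psi> \<phi> \<alpha> (id2 D e) \<gamma>" using sq[OF t] by (simp add: dbl_simps)
    qed
  next
    assume u: "couniversal Y R e"
    show "contractible_squares_to ?A (R, e)"
      unfolding contractible_squares_to_def
    proof (intro conjI ballI)
      show "(R, e) \<in> DOb ?A" using u by (simp add: dbl_simps over_obs_def couniversal_def)
    next
      fix x assume "x \<in> DOb ?A"
      then show "hor ?A x (R, e) \<noteq> {}"
        using couniversal_triangle[OF u] hor by (cases x) (fastforce simp: dbl_simps)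
    next
      fix w p q assume w: "w \<in> Ver ?A" and p: "p \<in> hor ?A (vdom ?A w) (R, e)" and q: "q \<in> hor ?A (vcod ?A w) (R, e)"
      obtain X f g \<alpha> where w': "w = ((X, f), (X, g), \<alpha>)" "\<alpha> \<in> hom2 D f g"
        using w by (cases w) (auto simp: dbl_simps dbl_ver_iff)
      obtain c \<psi> where p': "p = ((X, f), (R, e), c, \<psi>)" "triangle Y (X, f) (R, e) c \<psi>"
        using p w' by (cases p) (auto simp: hor dbl_simps)
      obtain d \<phi> where q': "q = ((X, g), (R, e), d, \<phi>)" "triangle Y (X, g) (R, e) d \<phi>"
        using q w' by (cases q) (auto simp: hor dbl_simps)
      show "\<exists>!s. s \<in> sq ?A p q w (ver_id ?A (R, e))"
        unfolding p'(1) q'(1) w'(1) dbl_simps sq[OF p'(2) q'(2) w'(2)]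
        by (rule couniversal_square[OF u p'(2) q'(2) w'(2)])
    qed
  qed
qed

text \<open>Only the squares along identities matter here, and by \<open>over_square_solved\<close> these prescribe invertible values
  of \<open>e (L \<gamma>)\<close>; hence the passage to arrow 2-categories below.\<close>

lemma contractible_slice_iff: "contractible_homs_to (slice_over C D L Y) (R, e) \<longleftrightarrow> (R, e) \<in> over_obs C D L Y \<and>
    (\<forall>X f. (X, f) \<in> over_obs C D L Y \<longrightarrow> (\<exists>c \<psi>. triangle Y (X, f) (R, e) c \<psi>)) \<and>
    (\<forall>X f c \<psi> d \<phi>. triangle Y (X, f) (R, e) c \<psi> \<longrightarrow> triangle Y (X, f) (R, e) d \<phi> \<longrightarrow>
      (\<exists>!\<gamma>. \<gamma> \<in> hom2 C c d \<and> over_square \<psi> \<phi> (id2 D f) (id2 D e) \<gamma>))"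
proof -
  let ?A = "slice_over C D L Y"
  have uniq: "(\<exists>!s. s \<in> hom2 ?A ((X, f), (R, e), c, \<psi>) ((X, f), (R, e), d, \<phi>))
      \<longleftrightarrow> (\<exists>!\<gamma>. \<gamma> \<in> hom2 C c d \<and> over_square \<psi> \<phi> (id2 D f) (id2 D e) \<gamma>)" (is "(\<exists>!s. s \<in> ?S) \<longleftrightarrow> _")
    if t: "triangle Y (X, f) (R, e) c \<psi>" "triangle Y (X, f) (R, e) d \<phi>" for X f c d \<psi> \<phi>
  proof -
    have "s \<in> ?S \<longleftrightarrow> (\<exists>\<gamma>. s = (((X, f), (R, e), c, \<psi>), ((X, f), (R, e), d, \<phi>), \<gamma>)
        \<and> \<gamma> \<in> hom2 C c d \<and> over_square \<psi> \<phi> (id2 D f) (id2 D e) \<gamma>)" for s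
      using t by (cases s) (auto simp: slice_hom2_iff)
    then show ?thesis by auto
  qed
  have hom: "p \<in> hom1 ?A (X, f) (R, e) \<longleftrightarrow> (\<exists>c \<psi>. p = ((X, f), (R, e), c, \<psi>) \<and> triangle Y (X, f) (R, e) c \<psi>)" for X f p
    by (cases p) (auto simp: slice_hom1_iff)
  have inh: "hom1 ?A (X, f) (R, e) \<noteq> {} \<longleftrightarrow> (\<exists>c \<psi>. triangle Y (X, f) (R, e) c \<psi>)" for X f
    unfolding ex_in_conv[symmetric] hom by blast
  have ball: "(\<forall>p \<in> hom1 ?A (X, f) (R, e). P p) \<longleftrightarrow>
      (\<forall>c \<psi>. triangle Y (X, f) (R, e) c \<psi> \<longrightarrow> P ((X, f), (R, e), c, \<psi>))" for X f P
    unfolding Ball_def hom by blast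
  have Ob: "(\<forall>x \<in> Ob ?A. P x) \<longleftrightarrow> (\<forall>X f. (X, f) \<in> over_obs C D L Y \<longrightarrow> P (X, f))" for P
    by (auto simp: slice_simps)
  have "contractible_homs_to ?A (R, e) \<longleftrightarrow> (R, e) \<in> over_obs C D L Y \<and>
      (\<forall>X f. (X, f) \<in> over_obs C D L Y \<longrightarrow> (\<exists>c \<psi>. triangle Y (X, f) (R, e) c \<psi>) \<and>
        (\<forall>c \<psi>. triangle Y (X, f) (R, e) c \<psi> \<longrightarrow> (\<forall>d \<phi>. triangle Y (X, f) (R, e) d \<phi> \<longrightarrow>
          (\<exists>!\<gamma>. \<gamma> \<in> hom2 C c d \<and> over_square \<psi> \<phi> (id2 D f) (id2 D e) \<gamma>))))"
    unfolding contractible_homs_to_def Ob inh ball by (simp add: uniq slice_simps)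
  moreover have "(P \<and> (\<forall>X f. W X f \<longrightarrow> E X f \<and> (\<forall>c \<psi>. T X f c \<psi> \<longrightarrow> (\<forall>d \<phi>. T X f d \<phi> \<longrightarrow> Q X f c \<psi> d \<phi>)))) \<longleftrightarrow>
      (P \<and> (\<forall>X f. W X f \<longrightarrow> E X f) \<and> (\<forall>X f c \<psi> d \<phi>. T X f c \<psi> \<longrightarrow> T X f d \<phi> \<longrightarrow> Q X f c \<psi> d \<phi>))"
    if "\<And>X f c \<psi>. T X f c \<psi> \<Longrightarrow> W X f" for P E Q and W :: "'o \<Rightarrow> 'n \<Rightarrow> bool" and T :: "'o \<Rightarrow> 'n \<Rightarrow> 'm \<Rightarrow> 's \<Rightarrow> bool"
    using that by blast
  ultimately show ?thesis using triangle_obs by presburger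
qed

text \<open>A morphism into \<open>(R, id\<^sub>e)\<close> over an arrow \<open>\<alpha>\<close> is a square from its source to its target.\<close>

lemma Ar_triangle_iff:
  assumes e: "R \<in> Ob C" "e \<in> hom1 D (on_ob L R) Y"
  shows "pseudo_functor.triangle (Ar C) (Ar D) (Ar_psf C D L) Y (X, \<alpha>) (R, id2 D e) \<gamma> (m, n, \<psi>, \<phi>) \<longleftrightarrow>
    m = id2 D e \<star> on_two L \<gamma> \<and> n = \<alpha> \<and> \<alpha> \<in> Two D \<and> \<gamma> \<in> Two C \<and>
    triangle Y (X, dom2 D \<alpha>) (R, e) (dom2 C \<gamma>) \<psi> \<and> triangle Y (X, cod2 D \<alpha>) (R, e) (cod2 C \<gamma>) \<phi> \<and>
    over_square \<psi> \<phi> \<alpha> (id2 D e) \<gamma>"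
proof -
  interpret A: pseudo_functor "Ar C" "Ar D" "Ar_psf C D L" by (rule Ar_pseudo_functor)
  show ?thesis
    unfolding A.triangle_iff C.Ar_simps D.Ar_simps Ar_psf_simps triangle_iff D.Ar_iso2_iff
    using e C.cod2_boundary[of \<gamma>] D.cod2_boundary[of \<alpha>]
    by (auto simp: hom1_iff over_square_def)
qed

lemma Ar_over_square_iff:
  assumes e: "R \<in> Ob C" "e \<in> hom1 D (on_ob L R) Y"
    and t: "pseudo_functor.triangle (Ar C) (Ar D) (Ar_psf C D L) Y (X, \<alpha>) (R, id2 D e) \<gamma> (m, n, \<psi>, \<phi>)"
    and t': "pseudo_functor.triangle (Ar C) (Ar D) (Ar_psf C D L) Y (X, \<alpha>) (R, id2 D e) \<gamma>' (m', n', \<psi>', \<phi>')"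
    and h: "(\<gamma>, \<gamma>', \<sigma>, \<tau>) \<in> Two (Ar C)"
  shows "pseudo_functor.over_square (Ar D) (Ar_psf C D L) (m, n, \<psi>, \<phi>) (m', n', \<psi>', \<phi>')
      (id2 (Ar D) \<alpha>) (id2 (Ar D) (id2 D e)) (\<gamma>, \<gamma>', \<sigma>, \<tau>) \<longleftrightarrow>
    over_square \<psi> \<psi>' (id2 D (dom2 D \<alpha>)) (id2 D e) \<sigma> \<and> over_square \<phi> \<phi>' (id2 D (cod2 D \<alpha>)) (id2 D e) \<tau>"
proof -
  interpret A: pseudo_functor "Ar C" "Ar D" "Ar_psf C D L" by (rule Ar_pseudo_functor)
  show ?thesis
    using e t t' h by (auto simp: A.over_square_def over_square_def D.Ar_simps Ar_psf_simps Ar_triangle_iff hom1_iff)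
qed

definition square_into :: "'p \<Rightarrow> 'o \<Rightarrow> 'n \<Rightarrow> 'o \<Rightarrow> 's \<Rightarrow> 't \<Rightarrow> 's \<Rightarrow> 's \<Rightarrow> bool" where
  "square_into Y R e X \<alpha> \<gamma> \<psi> \<phi> \<longleftrightarrow> \<alpha> \<in> Two D \<and> \<gamma> \<in> Two C \<and>
     triangle Y (X, dom2 D \<alpha>) (R, e) (dom2 C \<gamma>) \<psi> \<and> triangle Y (X, cod2 D \<alpha>) (R, e) (cod2 C \<gamma>) \<phi> \<and>
     over_square \<psi> \<phi> \<alpha> (id2 D e) \<gamma>"

text \<open>After this translation both conditions speak of squares for \<open>L\<close> itself, so that the closure properties of
  squares apply.\<close>

lemma Ar_contractible_iff:
  assumes e: "R \<in> Ob C" "e \<in> hom1 D (on_ob L R) Y"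
  shows "contractible_homs_to (slice_over (Ar C) (Ar D) (Ar_psf C D L) Y) (R, id2 D e) \<longleftrightarrow>
    (\<forall>X \<alpha>. X \<in> Ob C \<longrightarrow> \<alpha> \<in> Two D \<longrightarrow> dom2 D \<alpha> \<in> hom1 D (on_ob L X) Y \<longrightarrow> (\<exists>\<gamma> \<psi> \<phi>. square_into Y R e X \<alpha> \<gamma> \<psi> \<phi>)) \<and>
    (\<forall>X \<alpha> \<gamma> \<psi> \<phi> \<gamma>' \<psi>' \<phi>'. square_into Y R e X \<alpha> \<gamma> \<psi> \<phi> \<longrightarrow> square_into Y R e X \<alpha> \<gamma>' \<psi>' \<phi>' \<longrightarrow>
      (\<exists>!(\<sigma>, \<tau>). (\<gamma>, \<gamma>', \<sigma>, \<tau>) \<in> Two (Ar C) \<and>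
         over_square \<psi> \<psi>' (id2 D (dom2 D \<alpha>)) (id2 D e) \<sigma> \<and> over_square \<phi> \<phi>' (id2 D (cod2 D \<alpha>)) (id2 D e) \<tau>))"
    (is "_ \<longleftrightarrow> ?E \<and> ?U")
proof -
  interpret A: pseudo_functor "Ar C" "Ar D" "Ar_psf C D L" by (rule Ar_pseudo_functor)
  let ?e = "id2 D e"
  have obs: "(X, \<alpha>) \<in> over_obs (Ar C) (Ar D) (Ar_psf C D L) Y \<longleftrightarrow>
      X \<in> Ob C \<and> \<alpha> \<in> Two D \<and> dom2 D \<alpha> \<in> hom1 D (on_ob L X) Y" for X \<alpha>
    by (simp add: over_obs_def C.Ar_simps D.Ar_hom1_iff Ar_psf_simps) (auto simp: hom1_iff)
  have T: "(R, ?e) \<in> over_obs (Ar C) (Ar D) (Ar_psf C D L) Y"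
    using e by (simp add: obs hom1_iff)
  have tri: "A.triangle Y (X, \<alpha>) (R, ?e) \<gamma> \<Psi> \<longleftrightarrow>
      (\<exists>\<psi> \<phi>. \<Psi> = (?e \<star> on_two L \<gamma>, \<alpha>, \<psi>, \<phi>) \<and> square_into Y R e X \<alpha> \<gamma> \<psi> \<phi>)" for X \<alpha> \<gamma> \<Psi>
    by (cases \<Psi>) (auto simp: Ar_triangle_iff[OF e] square_into_def)
  have uniq: "(\<exists>!s. s \<in> hom2 (Ar C) \<gamma> \<gamma>' \<and> A.over_square \<Psi> \<Psi>' (id2 (Ar D) \<alpha>) (id2 (Ar D) ?e) s)
      \<longleftrightarrow> (\<exists>!(\<sigma>, \<tau>). (\<gamma>, \<gamma>', \<sigma>, \<tau>) \<in> Two (Ar C) \<and>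
         over_square \<psi> \<psi>' (id2 D (dom2 D \<alpha>)) (id2 D e) \<sigma> \<and> over_square \<phi> \<phi>' (id2 D (cod2 D \<alpha>)) (id2 D e) \<tau>)"
      (is "(\<exists>!s. ?P s) \<longleftrightarrow> (\<exists>!r. ?Q r)")
    if t: "square_into Y R e X \<alpha> \<gamma> \<psi> \<phi>" "square_into Y R e X \<alpha> \<gamma>' \<psi>' \<phi>'"
      and P: "\<Psi> = (?e \<star> on_two L \<gamma>, \<alpha>, \<psi>, \<phi>)" "\<Psi>' = (?e \<star> on_two L \<gamma>', \<alpha>, \<psi>', \<phi>')"
    for X \<alpha> \<gamma> \<Psi> \<psi> \<phi> \<gamma>' \<Psi>' \<psi>' \<phi>'
  proof -
    have "A.triangle Y (X, \<alpha>) (R, ?e) \<gamma> \<Psi>" "A.triangle Y (X, \<alpha>) (R, ?e) \<gamma>' \<Psi>'"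
      using t P by (auto simp: tri)
    note sq = Ar_over_square_iff[OF e this[unfolded P]]
    have "?P s \<longleftrightarrow> (\<exists>r. s = (\<gamma>, \<gamma>', r) \<and> ?Q r)" for s
      unfolding P using sq by (cases s) (auto simp: C.Ar_hom2_iff)
    then show ?thesis by auto
  qed
  have E: "(\<forall>X \<alpha>. (X, \<alpha>) \<in> over_obs (Ar C) (Ar D) (Ar_psf C D L) Y \<longrightarrow>
      (\<exists>\<gamma> \<Psi>. A.triangle Y (X, \<alpha>) (R, ?e) \<gamma> \<Psi>)) \<longleftrightarrow> ?E"
    by (simp add: obs tri imp_conjL)
  have U: "(\<forall>X \<alpha> \<gamma> \<Psi> \<gamma>' \<Psi>'. A.triangle Y (X, \<alpha>) (R, ?e) \<gamma> \<Psi> \<longrightarrow> A.triangle Y (X, \<alpha>) (R, ?e) \<gamma>' \<Psi>' \<longrightarrow>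
      (\<exists>!s. s \<in> hom2 (Ar C) \<gamma> \<gamma>' \<and> A.over_square \<Psi> \<Psi>' (id2 (Ar D) \<alpha>) (id2 (Ar D) ?e) s)) \<longleftrightarrow> ?U"
      (is "?L \<longleftrightarrow> _")
  proof (intro iffI allI impI)
    fix X \<alpha> \<gamma> \<psi> \<phi> \<gamma>' \<psi>' \<phi>'
    assume l: ?L and t: "square_into Y R e X \<alpha> \<gamma> \<psi> \<phi>" "square_into Y R e X \<alpha> \<gamma>' \<psi>' \<phi>'"
    show "\<exists>!(\<sigma>, \<tau>). (\<gamma>, \<gamma>', \<sigma>, \<tau>) \<in> Two (Ar C) \<and>
         over_square \<psi> \<psi>' (id2 D (dom2 D \<alpha>)) (id2 D e) \<sigma> \<and> over_square \<phi> \<phi>' (id2 D (cod2 D \<alpha>)) (id2 D e) \<tau>"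
      unfolding uniq[OF t refl refl, symmetric] by (rule l[rule_format, of X]) (simp_all add: tri t)
  next
    fix X \<alpha> \<gamma> \<Psi> \<gamma>' \<Psi>'
    assume u: ?U and t: "A.triangle Y (X, \<alpha>) (R, ?e) \<gamma> \<Psi>" "A.triangle Y (X, \<alpha>) (R, ?e) \<gamma>' \<Psi>'"
    obtain \<psi> \<phi> where s: "\<Psi> = (?e \<star> on_two L \<gamma>, \<alpha>, \<psi>, \<phi>)" "square_into Y R e X \<alpha> \<gamma> \<psi> \<phi>"
      using t(1) tri by auto
    obtain \<psi>' \<phi>' where s': "\<Psi>' = (?e \<star> on_two L \<gamma>', \<alpha>, \<psi>', \<phi>')" "square_into Y R e X \<alpha> \<gamma>' \<psi>' \<phi>'"
      using t(2) tri by auto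
    show "\<exists>!s. s \<in> hom2 (Ar C) \<gamma> \<gamma>' \<and> A.over_square \<Psi> \<Psi>' (id2 (Ar D) \<alpha>) (id2 (Ar D) ?e) s"
      unfolding uniq[OF s(2) s'(2) s(1) s'(1)] by (rule u[rule_format, OF s(2) s'(2)])
  qed
  show ?thesis
    unfolding A.contractible_slice_iff E U using T by simp
qed

text \<open>The two components of a comparison are found separately as unique fillers; they form a 2-cell of \<open>Ar C\<close>
  because \<open>\<gamma>' \<sigma>\<close> and \<open>\<tau> \<gamma>\<close> fill the same square along \<open>\<alpha>\<close>.\<close>

lemma couniversal_imp_Ar_contractible:
  assumes u: "couniversal Y R e"
  shows "contractible_homs_to (slice_over (Ar C) (Ar D) (Ar_psf C D L) Y) (R, id2 D e)"
proof -
  have e: "R \<in> Ob C" "e \<in> hom1 D (on_ob L R) Y" using u by (auto simp: couniversal_def)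
  show ?thesis
    unfolding Ar_contractible_iff[OF e]
  proof (intro conjI allI impI)
    fix X \<alpha> assume a: "X \<in> Ob C" "\<alpha> \<in> Two D" "dom2 D \<alpha> \<in> hom1 D (on_ob L X) Y"
    then have "(X, dom2 D \<alpha>) \<in> over_obs C D L Y" "(X, cod2 D \<alpha>) \<in> over_obs C D L Y"
      by (auto simp: over_obs_def hom1_iff)
    then obtain c \<psi> d \<phi> where t: "triangle Y (X, dom2 D \<alpha>) (R, e) c \<psi>" "triangle Y (X, cod2 D \<alpha>) (R, e) d \<phi>"
      using couniversal_triangle[OF u] by meson
    moreover have "\<alpha> \<in> hom2 D (dom2 D \<alpha>) (cod2 D \<alpha>)" using a by (simp add: hom2_iff)
    ultimately obtain \<gamma> where "\<gamma> \<in> hom2 C c d" "over_square \<psi> \<phi> \<alpha> (id2 D e) \<gamma>"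
      using couniversal_square[OF u] by blast
    then show "\<exists>\<gamma> \<psi> \<phi>. square_into Y R e X \<alpha> \<gamma> \<psi> \<phi>"
      using t a by (auto simp: hom2_iff square_into_def)
  next
    fix X \<alpha> \<gamma> \<psi> \<phi> \<gamma>' \<psi>' \<phi>'
    assume "square_into Y R e X \<alpha> \<gamma> \<psi> \<phi>" "square_into Y R e X \<alpha> \<gamma>' \<psi>' \<phi>'"
    then have a: "\<alpha> \<in> Two D" and g: "\<gamma> \<in> Two C" "\<gamma>' \<in> Two C"
      and t: "triangle Y (X, dom2 D \<alpha>) (R, e) (dom2 C \<gamma>) \<psi>" "triangle Y (X, cod2 D \<alpha>) (R, e) (cod2 C \<gamma>) \<phi>"
      and t': "triangle Y (X, dom2 D \<alpha>) (R, e) (dom2 C \<gamma>') \<psi>'" "triangle Y (X, cod2 D \<alpha>) (R, e) (cod2 C \<gamma>') \<phi>'"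
      and s: "over_square \<psi> \<phi> \<alpha> (id2 D e) \<gamma>" "over_square \<psi>' \<phi>' \<alpha> (id2 D e) \<gamma>'"
      by (auto simp: square_into_def)
    let ?i = "id2 D" and ?f = "dom2 D \<alpha>" and ?g = "cod2 D \<alpha>"
    have h: "?i ?f \<in> hom2 D ?f ?f" "?i ?g \<in> hom2 D ?g ?g" "\<alpha> \<in> hom2 D ?f ?g" "?i e \<in> hom2 D e e"
      using a e by (auto simp: hom2_iff hom1_iff)
    have "\<exists>!\<sigma>. \<sigma> \<in> hom2 C (dom2 C \<gamma>) (dom2 C \<gamma>') \<and> over_square \<psi> \<psi>' (?i ?f) (?i e) \<sigma>"
      by (rule couniversal_square[OF u t(1) t'(1) h(1)])
    then obtain \<sigma> where s1: "\<sigma> \<in> hom2 C (dom2 C \<gamma>) (dom2 C \<gamma>')" "over_square \<psi> \<psi>' (?i ?f) (?i e) \<sigma>"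
      and uq1: "\<And>\<sigma>'. \<sigma>' \<in> hom2 C (dom2 C \<gamma>) (dom2 C \<gamma>') \<Longrightarrow> over_square \<psi> \<psi>' (?i ?f) (?i e) \<sigma>' \<Longrightarrow> \<sigma>' = \<sigma>"
      by blast
    have "\<exists>!\<tau>. \<tau> \<in> hom2 C (cod2 C \<gamma>) (cod2 C \<gamma>') \<and> over_square \<phi> \<phi>' (?i ?g) (?i e) \<tau>"
      by (rule couniversal_square[OF u t(2) t'(2) h(2)])
    then obtain \<tau> where s2: "\<tau> \<in> hom2 C (cod2 C \<gamma>) (cod2 C \<gamma>')" "over_square \<phi> \<phi>' (?i ?g) (?i e) \<tau>"
      and uq2: "\<And>\<tau>'. \<tau>' \<in> hom2 C (cod2 C \<gamma>) (cod2 C \<gamma>') \<Longrightarrow> over_square \<phi> \<phi>' (?i ?g) (?i e) \<tau>' \<Longrightarrow> \<tau>' = \<tau>"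
      by blast
    have "\<gamma>' \<bullet>\<^bsub>C\<^esub> \<sigma> = \<tau> \<bullet>\<^bsub>C\<^esub> \<gamma>"
    proof -
      have gg: "\<gamma> \<in> hom2 C (dom2 C \<gamma>) (cod2 C \<gamma>)" "\<gamma>' \<in> hom2 C (dom2 C \<gamma>') (cod2 C \<gamma>')"
        using g by (auto simp: hom2_iff)
      have "over_square \<psi> \<phi>' (\<alpha> \<bullet> ?i ?f) (?i e \<bullet> ?i e) (\<gamma>' \<bullet>\<^bsub>C\<^esub> \<sigma>)"
        by (rule over_square_vcomp[OF t(1) t'(1) t'(2) h(1,4,3,4) s1(1) gg(2) s1(2) s(2)])
      moreover have "over_square \<psi> \<phi>' (?i ?g \<bullet> \<alpha>) (?i e \<bullet> ?i e) (\<tau> \<bullet>\<^bsub>C\<^esub> \<gamma>)"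
        by (rule over_square_vcomp[OF t(1) t(2) t'(2) h(3,4,2,4) gg(1) s2(1) s(1) s2(2)])
      ultimately show ?thesis
        using couniversal_square[OF u t(1) t'(2) h(3)] s1 s2 g a e by (auto simp: hom2_iff hom1_iff)
    qed
    then have "(\<gamma>, \<gamma>', \<sigma>, \<tau>) \<in> Two (Ar C)" using g s1(1) s2(1) by (auto simp: C.Ar_Two_iff hom2_iff)
    then show "\<exists>!(\<sigma>, \<tau>). (\<gamma>, \<gamma>', \<sigma>, \<tau>) \<in> Two (Ar C) \<and>
         over_square \<psi> \<psi>' (?i ?f) (?i e) \<sigma> \<and> over_square \<phi> \<phi>' (?i ?g) (?i e) \<tau>"
      using s1(2) s2(2) uq1 uq2 by (intro ex1I[of _ "(\<sigma>, \<tau>)"]) (auto simp: C.Ar_Two_iff hom2_iff)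
  qed
qed

text \<open>A square along \<open>\<alpha>\<close> exists with some top and bottom; pasting with the comparisons to the prescribed triangles
  gives a filler between these.\<close>

lemma Ar_contractible_imp_couniversal:
  assumes e: "R \<in> Ob C" "e \<in> hom1 D (on_ob L R) Y"
    and con: "contractible_homs_to (slice_over (Ar C) (Ar D) (Ar_psf C D L) Y) (R, id2 D e)"
  shows "couniversal Y R e"
proof -
  let ?i = "id2 D"
  note E = con[unfolded Ar_contractible_iff[OF e], THEN conjunct1, rule_format]
  note U = con[unfolded Ar_contractible_iff[OF e], THEN conjunct2, rule_format]
  have ie: "?i e \<in> hom2 D e e" using e by (simp add: hom2_iff hom1_iff)
  \<comment> \<open>Morphisms over an identity arrow whose underlying 2-cell is an identity give the
    contractibility of the hom-categories of the slice of \<open>L\<close> itself.\<close>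
  have slice: "\<exists>!\<sigma>. \<sigma> \<in> hom2 C c d \<and> over_square \<psi> \<phi> (?i f) (?i e) \<sigma>"
    if t: "triangle Y (X, f) (R, e) c \<psi>" and t': "triangle Y (X, f) (R, e) d \<phi>" for X f c d \<psi> \<phi>
  proof -
    note [simp] = triangle_cell(1-14)[OF t] triangle_cell(1-14)[OF t']
    have "\<exists>!(\<sigma>, \<tau>). (id2 C c, id2 C d, \<sigma>, \<tau>) \<in> Two (Ar C) \<and>
        over_square \<psi> \<phi> (?i (dom2 D (?i f))) (?i e) \<sigma> \<and> over_square \<psi> \<phi> (?i (cod2 D (?i f))) (?i e) \<tau>"
      using t t' over_square_id[OF t] over_square_id[OF t'] by (intro U[of X]) (simp_all add: square_into_def)
    then obtain \<sigma> \<tau> where st: "(id2 C c, id2 C d, \<sigma>, \<tau>) \<in> Two (Ar C) \<and>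
        over_square \<psi> \<phi> (?i (dom2 D (?i f))) (?i e) \<sigma> \<and> over_square \<psi> \<phi> (?i (cod2 D (?i f))) (?i e) \<tau>"
      and uq: "\<And>\<sigma>' \<tau>'. (id2 C c, id2 C d, \<sigma>', \<tau>') \<in> Two (Ar C) \<and>
        over_square \<psi> \<phi> (?i (dom2 D (?i f))) (?i e) \<sigma>' \<and> over_square \<psi> \<phi> (?i (cod2 D (?i f))) (?i e) \<tau>' \<Longrightarrow>
        \<sigma>' = \<sigma> \<and> \<tau>' = \<tau>"
      by (rule ex1_pairE) (rule that; blast)
    show ?thesis
    proof (rule ex1I)
      show "\<sigma> \<in> hom2 C c d \<and> over_square \<psi> \<phi> (?i f) (?i e) \<sigma>"
        using st by (simp add: C.Ar_Two_iff hom2_iff)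
      show "\<sigma>' = \<sigma>" if "\<sigma>' \<in> hom2 C c d \<and> over_square \<psi> \<phi> (?i f) (?i e) \<sigma>'" for \<sigma>'
        using uq[of \<sigma>' \<sigma>'] that by (simp add: C.Ar_Two_iff hom2_iff)
    qed
  qed
  show ?thesis
  proof (rule couniversalI[OF e])
    fix X f assume f: "(X, f) \<in> over_obs C D L Y"
    then have f': "X \<in> Ob C" "?i f \<in> Two D" "dom2 D (?i f) \<in> hom1 D (on_ob L X) Y" "dom2 D (?i f) = f"
      by (auto simp: over_obs_def hom1_iff)
    then show "\<exists>c \<psi>. triangle Y (X, f) (R, e) c \<psi>"
      using E[OF f'(1-3)] unfolding square_into_def by metis
  next
    fix X f g c d \<psi> \<phi> \<alpha>
    assume t: "triangle Y (X, f) (R, e) c \<psi>" and t': "triangle Y (X, g) (R, e) d \<phi>" and a: "\<alpha> \<in> hom2 D f g"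
    note [simp] = triangle_cell(1-14)[OF t] triangle_cell(1-14)[OF t'] a[unfolded hom2_iff]
    have h: "?i f \<in> hom2 D f f" "?i g \<in> hom2 D g g" by (simp_all add: hom2_iff)
    have "\<exists>\<gamma> \<psi> \<phi>. square_into Y R e X \<alpha> \<gamma> \<psi> \<phi>" by (rule E) (simp_all add: hom1_iff)
    then obtain \<gamma> \<psi>0 \<phi>0 where g: "\<gamma> \<in> Two C" and t0: "triangle Y (X, f) (R, e) (dom2 C \<gamma>) \<psi>0"
      and t0': "triangle Y (X, g) (R, e) (cod2 C \<gamma>) \<phi>0" and s0: "over_square \<psi>0 \<phi>0 \<alpha> (?i e) \<gamma>"
      by (auto simp: square_into_def)
    have gg: "\<gamma> \<in> hom2 C (dom2 C \<gamma>) (cod2 C \<gamma>)" using g by (simp add: hom2_iff)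
    obtain \<sigma> where s: "\<sigma> \<in> hom2 C c (dom2 C \<gamma>)" "over_square \<psi> \<psi>0 (?i f) (?i e) \<sigma>"
      using slice[OF t t0] by blast
    obtain \<tau> where s': "\<tau> \<in> hom2 C (cod2 C \<gamma>) d" "over_square \<phi>0 \<phi> (?i g) (?i e) \<tau>"
      using slice[OF t0' t'] by blast
    have 1: "over_square \<psi> \<phi>0 (\<alpha> \<bullet> ?i f) (?i e \<bullet> ?i e) (\<gamma> \<bullet>\<^bsub>C\<^esub> \<sigma>)"
      by (rule over_square_vcomp[OF t t0 t0' h(1) ie a ie s(1) gg s(2) s0])
    have sg: "\<gamma> \<bullet>\<^bsub>C\<^esub> \<sigma> \<in> hom2 C c (cod2 C \<gamma>)" using s g by (auto simp: hom2_iff)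
    have a1: "\<alpha> \<bullet> ?i f \<in> hom2 D f g" "?i e \<bullet> ?i e \<in> hom2 D e e" by (simp_all add: hom2_iff)
    have "over_square \<psi> \<phi> (?i g \<bullet> (\<alpha> \<bullet> ?i f)) (?i e \<bullet> (?i e \<bullet> ?i e)) (\<tau> \<bullet>\<^bsub>C\<^esub> (\<gamma> \<bullet>\<^bsub>C\<^esub> \<sigma>))"
      by (rule over_square_vcomp[OF t t0' t' a1 h(2) ie sg s'(1) 1 s'(2)])
    then have "over_square \<psi> \<phi> \<alpha> (?i e) (\<tau> \<bullet>\<^bsub>C\<^esub> (\<gamma> \<bullet>\<^bsub>C\<^esub> \<sigma>))" by simp
    moreover have "\<tau> \<bullet>\<^bsub>C\<^esub> (\<gamma> \<bullet>\<^bsub>C\<^esub> \<sigma>) \<in> hom2 C c d" using s s' g by (auto simp: hom2_iff)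
    moreover have "\<gamma>1 = \<gamma>2" if c1: "\<gamma>1 \<in> hom2 C c d" "over_square \<psi> \<phi> \<alpha> (?i e) \<gamma>1"
      and c2: "\<gamma>2 \<in> hom2 C c d" "over_square \<psi> \<phi> \<alpha> (?i e) \<gamma>2" for \<gamma>1 \<gamma>2
    proof -
      \<comment> \<open>The comparison \<open>(\<sigma>', \<tau>')\<close> between \<open>\<gamma>1\<close> and \<open>\<gamma>2\<close> over \<open>\<alpha>\<close> has endomorphisms of \<open>(c, \<psi>)\<close> and of
        \<open>(d, \<phi>)\<close> as components, so both are identities.\<close>
      have "\<exists>!(\<sigma>, \<tau>). (\<gamma>1, \<gamma>2, \<sigma>, \<tau>) \<in> Two (Ar C) \<and>
         over_square \<psi> \<psi> (?i (dom2 D \<alpha>)) (?i e) \<sigma> \<and> over_square \<phi> \<phi> (?i (cod2 D \<alpha>)) (?i e) \<tau>"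
        using c1 c2 t t' by (intro U[of X]) (simp_all add: hom2_iff square_into_def)
      from ex1_implies_ex[OF this] obtain \<sigma>' \<tau>' where st: "(\<gamma>1, \<gamma>2, \<sigma>', \<tau>') \<in> Two (Ar C)"
        "over_square \<psi> \<psi> (?i f) (?i e) \<sigma>'" "over_square \<phi> \<phi> (?i g) (?i e) \<tau>'"
        by auto
      have "\<sigma>' \<in> hom2 C c c" "\<tau>' \<in> hom2 C d d" "id2 C c \<in> hom2 C c c" "id2 C d \<in> hom2 C d d"
        using st(1) c1 c2 by (simp_all add: C.Ar_Two_iff hom2_iff)
      then have "\<sigma>' = id2 C c" "\<tau>' = id2 C d"
        using slice[OF t t] slice[OF t' t'] st(2,3) over_square_id[OF t] over_square_id[OF t'] by blast+
      moreover have "\<gamma>2 \<bullet>\<^bsub>C\<^esub> \<sigma>' = \<tau>' \<bullet>\<^bsub>C\<^esub> \<gamma>1" using st(1) by (simp add: C.Ar_Two_iff)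
      ultimately show ?thesis using c1(1) c2(1) by (simp add: hom2_iff)
    qed
    ultimately show "\<exists>!\<gamma>. \<gamma> \<in> hom2 C c d \<and> over_square \<psi> \<phi> \<alpha> (?i e) \<gamma>"
      by (intro ex1I[of _ "\<tau> \<bullet>\<^bsub>C\<^esub> (\<gamma> \<bullet>\<^bsub>C\<^esub> \<sigma>)"] conjI) (assumption | elim conjE)+
  qed
qed

lemma bi_terminal_Ar_slice_iff:
  assumes e: "R \<in> Ob C" "e \<in> hom1 D (on_ob L R) Y"
  shows "bi_terminal (slice_over (Ar C) (Ar D) (Ar_psf C D L) Y) (R, id2 D e) \<longleftrightarrow> couniversal Y R e"
  unfolding two_category.bi_terminal_iff[OF pseudo_functor.slice_over_two_category[OF Ar_pseudo_functor]]
  by (rule iffI[OF Ar_contractible_imp_couniversal[OF e] couniversal_imp_Ar_contractible])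

lemma double_bi_terminal_slice_iff: "double_bi_terminal (dbl_slice_over C D L Y) (R, e) \<longleftrightarrow> couniversal Y R e"
  unfolding double_category.double_bi_terminal_iff[OF dbl_slice_over_double_category]
  by (rule contractible_dbl_slice_iff)

lemma couniversal_imp_bi_terminal_slice:
  assumes u: "couniversal Y R e"
  shows "bi_terminal (slice_over C D L Y) (R, e)"
  unfolding two_category.bi_terminal_iff[OF slice_over_two_category] contractible_slice_iff
proof (intro conjI allI impI)
  show "(R, e) \<in> over_obs C D L Y" using u by (simp add: couniversal_def over_obs_def)
next
  fix X f c \<psi> d \<phi> assume t: "triangle Y (X, f) (R, e) c \<psi>" "triangle Y (X, f) (R, e) d \<phi>"
  show "\<exists>!\<gamma>. \<gamma> \<in> hom2 C c d \<and> over_square \<psi> \<phi> (id2 D f) (id2 D e) \<gamma>"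
    using id2_hom2[OF t(1)] by (intro couniversal_square[OF u t]) simp
qed (rule couniversal_triangle[OF u])

end

section \<open>Equivalences of categories\<close>

context category
begin

lemma Homs_Obj: "f \<in> Homs A x y \<Longrightarrow> x \<in> Obj A" "f \<in> Homs A x y \<Longrightarrow> y \<in> Obj A"
  using Dom_Obj Cod_Obj by (auto simp: Homs_def)

lemma iso_arr_cancel_left:
  assumes h: "h \<in> Homs A y z" "iso_arr A h" and f: "f \<in> Homs A x y" "f' \<in> Homs A x y" and eq: "h \<odot> f = h \<odot> f'"
  shows "f = f'"
proof -
  obtain k where k: "k \<in> Homs A z y" "k \<odot> h = Idn A y"
    using h by (auto simp: iso_arr_def Homs_def)
  have "f = (k \<odot> h) \<odot> f" using Idn_Comp[OF f(1)] k by simp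
  also have "\<dots> = k \<odot> (h \<odot> f')" using Comp_assoc[OF f(1) h(1) k(1)] eq by simp
  also have "\<dots> = (k \<odot> h) \<odot> f'" using Comp_assoc[OF f(2) h(1) k(1)] by simp
  also have "\<dots> = f'" using Idn_Comp[OF f(2)] k by simp
  finally show ?thesis .
qed

lemma iso_arr_cancel_right:
  assumes h: "h \<in> Homs A x y" "iso_arr A h" and f: "f \<in> Homs A y z" "f' \<in> Homs A y z" and eq: "f \<odot> h = f' \<odot> h"
  shows "f = f'"
proof -
  obtain k where k: "k \<in> Homs A y x" "h \<odot> k = Idn A y"
    using h by (auto simp: iso_arr_def Homs_def)
  have "f = f \<odot> (h \<odot> k)" using Comp_Idn[OF f(1)] k by simp
  also have "\<dots> = (f' \<odot> h) \<odot> k" using Comp_assoc[OF k(1) h(1) f(1)] eq by simp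
  also have "\<dots> = f' \<odot> (h \<odot> k)" using Comp_assoc[OF k(1) h(1) f(2)] by simp
  also have "\<dots> = f'" using Comp_Idn[OF f(2)] k by simp
  finally show ?thesis .
qed

end

lemma ex1_implies_unique: "\<exists>!x. P x \<Longrightarrow> P a \<Longrightarrow> P b \<Longrightarrow> a = b"
  by blast

lemma is_functorD:
  assumes "is_functor A B F"
  shows "x \<in> Obj A \<Longrightarrow> fob F x \<in> Obj B"
    and "x \<in> Obj A \<Longrightarrow> y \<in> Obj A \<Longrightarrow> f \<in> Homs A x y \<Longrightarrow> farr F f \<in> Homs B (fob F x) (fob F y)"
    and "x \<in> Obj A \<Longrightarrow> farr F (Idn A x) = Idn B (fob F x)"
    and "x \<in> Obj A \<Longrightarrow> y \<in> Obj A \<Longrightarrow> z \<in> Obj A \<Longrightarrow> f \<in> Homs A x y \<Longrightarrow> g \<in> Homs A y z \<Longrightarrow>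
      farr F (g \<odot>\<^bsub>A\<^esub> f) = farr F g \<odot>\<^bsub>B\<^esub> farr F f"
  using assms unfolding is_functor_def by blast+

lemma is_functor_id: "is_functor A A id_fctr"
  by (simp add: is_functor_def id_fctr_def)

lemma is_functor_comp:
  assumes F: "is_functor A B F" and G: "is_functor B E G"
  shows "is_functor A E (comp_fctr G F)"
proof -
  have "farr G (farr F (g \<odot>\<^bsub>A\<^esub> f)) = farr G (farr F g) \<odot>\<^bsub>E\<^esub> farr G (farr F f)"
    if x: "x \<in> Obj A" and y: "y \<in> Obj A" and z: "z \<in> Obj A" and f: "f \<in> Homs A x y" and g: "g \<in> Homs A y z"
    for x y z f g
    using is_functorD(4)[OF F x y z f g]
      is_functorD(4)[OF G is_functorD(1)[OF F x] is_functorD(1)[OF F y] is_functorD(1)[OF F z]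
        is_functorD(2)[OF F x y f] is_functorD(2)[OF F y z g]] by simp
  then show ?thesis
    unfolding is_functor_def comp_fctr_def using is_functorD(1-3)[OF F] is_functorD(1-3)[OF G] by simp
qed

lemma is_nat_isoD:
  assumes "is_nat_iso A B F G \<theta>"
  shows "x \<in> Obj A \<Longrightarrow> \<theta> x \<in> Homs B (fob F x) (fob G x)" and "x \<in> Obj A \<Longrightarrow> iso_arr B (\<theta> x)"
    and "x \<in> Obj A \<Longrightarrow> y \<in> Obj A \<Longrightarrow> f \<in> Homs A x y \<Longrightarrow> \<theta> y \<odot>\<^bsub>B\<^esub> farr F f = farr G f \<odot>\<^bsub>B\<^esub> \<theta> x"
  using assms unfolding is_nat_iso_def by blast+

text \<open>The counit makes \<open>G\<close> faithful, so the morphism \<open>f\<close> with \<open>\<eta>\<^sub>y f = (G g) \<eta>\<^sub>x\<close> is sent to \<open>g\<close>.\<close>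

lemma adjoint_equivalence_fully_faithful:
  assumes A: "category A" and B: "category B" and eq: "adjoint_equivalence A B F G \<eta> \<epsilon>"
    and x: "x \<in> Obj A" and y: "y \<in> Obj A" and g: "g \<in> Homs B (fob F x) (fob F y)"
  shows "\<exists>!f. f \<in> Homs A x y \<and> farr F f = g"
proof -
  have F: "is_functor A B F" and G: "is_functor B A G"
    and eta: "is_nat_iso A A id_fctr (comp_fctr G F) \<eta>" and eps: "is_nat_iso B B (comp_fctr F G) id_fctr \<epsilon>"
    using eq by (auto simp: adjoint_equivalence_def)
  note Fx = is_functorD(1)[OF F x] and Fy = is_functorD(1)[OF F y]
  have ex: "\<eta> x \<in> Homs A x (fob G (fob F x))" and ey: "\<eta> y \<in> Homs A y (fob G (fob F y))"
    using is_nat_isoD(1)[OF eta x] is_nat_isoD(1)[OF eta y] by (simp_all add: id_fctr_def comp_fctr_def)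
  have nat: "\<eta> y \<odot>\<^bsub>A\<^esub> f = farr G (farr F f) \<odot>\<^bsub>A\<^esub> \<eta> x" if "f \<in> Homs A x y" for f
    using is_nat_isoD(3)[OF eta x y that] by (simp add: id_fctr_def comp_fctr_def)
  have Gfaithful: "k = k'" if k: "k \<in> Homs B (fob F x) (fob F y)" "k' \<in> Homs B (fob F x) (fob F y)"
    and "farr G k = farr G k'" for k k'
  proof (rule category.iso_arr_cancel_right[OF B _ is_nat_isoD(2)[OF eps Fx] k])
    show "\<epsilon> (fob F x) \<in> Homs B (fob F (fob G (fob F x))) (fob F x)"
      using is_nat_isoD(1)[OF eps Fx] by (simp add: id_fctr_def comp_fctr_def)
    show "k \<odot>\<^bsub>B\<^esub> \<epsilon> (fob F x) = k' \<odot>\<^bsub>B\<^esub> \<epsilon> (fob F x)"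
      using is_nat_isoD(3)[OF eps Fx Fy k(1)] is_nat_isoD(3)[OF eps Fx Fy k(2)] that(3)
      by (simp add: id_fctr_def comp_fctr_def)
  qed
  obtain i where i: "i \<in> Homs A (fob G (fob F y)) y" "\<eta> y \<odot>\<^bsub>A\<^esub> i = Idn A (fob G (fob F y))"
    using is_nat_isoD(2)[OF eta y] ey by (auto simp: iso_arr_def Homs_def)
  have Gg: "farr G g \<in> Homs A (fob G (fob F x)) (fob G (fob F y))" by (rule is_functorD(2)[OF G Fx Fy g])
  define f where "f = i \<odot>\<^bsub>A\<^esub> (farr G g \<odot>\<^bsub>A\<^esub> \<eta> x)"
  have Ggx: "farr G g \<odot>\<^bsub>A\<^esub> \<eta> x \<in> Homs A x (fob G (fob F y))" by (rule category.Comp_Homs[OF A ex Gg])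
  have f: "f \<in> Homs A x y" unfolding f_def by (rule category.Comp_Homs[OF A Ggx i(1)])
  have Ff: "farr F f \<in> Homs B (fob F x) (fob F y)" by (rule is_functorD(2)[OF F x y f])
  have "\<eta> y \<odot>\<^bsub>A\<^esub> f = farr G g \<odot>\<^bsub>A\<^esub> \<eta> x"
    unfolding f_def using category.Comp_assoc[OF A Ggx i(1) ey] i(2) category.Idn_Comp[OF A Ggx] by simp
  then have "farr G (farr F f) \<odot>\<^bsub>A\<^esub> \<eta> x = farr G g \<odot>\<^bsub>A\<^esub> \<eta> x" using nat[OF f] by simp
  then have "farr G (farr F f) = farr G g"
    by (rule category.iso_arr_cancel_right[OF A ex is_nat_isoD(2)[OF eta x] is_functorD(2)[OF G Fx Fy Ff] Gg])
  then have "farr F f = g" by (rule Gfaithful[OF Ff g])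
  moreover have "f' = f" if f': "f' \<in> Homs A x y" "farr F f' = g" for f'
    using category.iso_arr_cancel_left[OF A ey is_nat_isoD(2)[OF eta y] f'(1) f] nat[OF f'(1)] nat[OF f] f'(2) calculation
    by simp
  ultimately show ?thesis using f by blast
qed

text \<open>Choose isomorphisms \<open>i\<^sub>u : F (G u) \<rightarrow> u\<close> with inverses \<open>j\<^sub>u\<close>. The counit is \<open>i\<close>, and the action of \<open>G\<close> on morphisms and
  the unit are lifts along \<open>F\<close> of \<open>j\<^sub>v g i\<^sub>u\<close> and of \<open>j\<close>; the equations between them can be checked after
  applying \<open>F\<close>.\<close>

lemma fully_faithful_eso_imp_adjoint_equivalence:
  assumes A: "category A" and B: "category B" and F: "is_functor A B F"
    and ff: "\<And>x y g. x \<in> Obj A \<Longrightarrow> y \<in> Obj A \<Longrightarrow> g \<in> Homs B (fob F x) (fob F y) \<Longrightarrow>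
      \<exists>!f. f \<in> Homs A x y \<and> farr F f = g"
    and eso: "\<And>u. u \<in> Obj B \<Longrightarrow> \<exists>x \<in> Obj A. \<exists>i \<in> Homs B (fob F x) u. iso_arr B i"
  shows "\<exists>G \<eta> \<epsilon>. adjoint_equivalence A B F G \<eta> \<epsilon>"
proof -
  interpret A: category A by fact
  interpret B: category B by fact
  note [simp] = is_functorD(1)[OF F]
  define P where "P u = (\<lambda>(x, i, j). x \<in> Obj A \<and> i \<in> Homs B (fob F x) u \<and> j \<in> Homs B u (fob F x) \<and>
      j \<odot>\<^bsub>B\<^esub> i = Idn B (fob F x) \<and> i \<odot>\<^bsub>B\<^esub> j = Idn B u)" for u
  define T where "T u = (SOME t. P u t)" for u
  define G i j where "G u = fst (T u)" and "i u = fst (snd (T u))" and "j u = snd (snd (T u))" for u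
  have T: "P u (G u, i u, j u)" if u: "u \<in> Obj B" for u
  proof -
    obtain x k where x: "x \<in> Obj A" and k: "k \<in> Homs B (fob F x) u" "iso_arr B k" using eso[OF u] by blast
    then obtain l where "l \<in> Homs B u (fob F x)" "l \<odot>\<^bsub>B\<^esub> k = Idn B (fob F x)" "k \<odot>\<^bsub>B\<^esub> l = Idn B u"
      by (auto simp: iso_arr_def Homs_def)
    then have "P u (x, k, l)" using x k by (simp add: P_def)
    then have "P u (T u)" unfolding T_def by (rule someI)
    then show ?thesis by (simp add: G_def i_def j_def)
  qed
  have G [simp]: "\<And>u. u \<in> Obj B \<Longrightarrow> G u \<in> Obj A"
    and i: "\<And>u. u \<in> Obj B \<Longrightarrow> i u \<in> Homs B (fob F (G u)) u" and j: "\<And>u. u \<in> Obj B \<Longrightarrow> j u \<in> Homs B u (fob F (G u))"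
    and ji: "\<And>u. u \<in> Obj B \<Longrightarrow> j u \<odot>\<^bsub>B\<^esub> i u = Idn B (fob F (G u))" and ij: "\<And>u. u \<in> Obj B \<Longrightarrow> i u \<odot>\<^bsub>B\<^esub> j u = Idn B u"
    using T by (simp_all add: P_def)
  define lift where "lift x y g = (THE f. f \<in> Homs A x y \<and> farr F f = g)" for x y g
  have lift: "lift x y g \<in> Homs A x y" "farr F (lift x y g) = g"
    if "x \<in> Obj A" "y \<in> Obj A" "g \<in> Homs B (fob F x) (fob F y)" for x y g
    using theI'[OF ff[OF that]] by (simp_all add: lift_def)
  have faithful: "f = f'" if "f \<in> Homs A x y" "f' \<in> Homs A x y" "farr F f = farr F f'" for x y f f'
    using ex1_implies_unique[OF ff[OF A.Homs_Obj[OF that(1)] is_functorD(2)[OF F A.Homs_Obj[OF that(1)] that(1)]]] that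
    by simp
  have i_iso: "iso_arr B (i u)" if "u \<in> Obj B" for u
    using i[OF that] j[OF that] ij[OF that] ji[OF that] by (auto simp: iso_arr_def Homs_def)
  have jgi: "j v \<odot>\<^bsub>B\<^esub> (g \<odot>\<^bsub>B\<^esub> i u) \<in> Homs B (fob F (G u)) (fob F (G v))"
    if u: "u \<in> Obj B" and v: "v \<in> Obj B" and g: "g \<in> Homs B u v" for u v g
    by (rule B.Comp_Homs[OF B.Comp_Homs[OF i[OF u] g] j[OF v]])
  define GF where "GF = \<lparr>fob = G, farr = (\<lambda>g. lift (G (Dom B g)) (G (Cod B g)) (j (Cod B g) \<odot>\<^bsub>B\<^esub> (g \<odot>\<^bsub>B\<^esub> i (Dom B g))))\<rparr>"
  have Gob [simp]: "fob GF u = G u" for u by (simp add: GF_def)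
  have Garr: "farr GF g \<in> Homs A (G u) (G v)" "farr F (farr GF g) = j v \<odot>\<^bsub>B\<^esub> (g \<odot>\<^bsub>B\<^esub> i u)"
    if u: "u \<in> Obj B" and v: "v \<in> Obj B" and g: "g \<in> Homs B u v" for u v g
    using lift[OF G[OF u] G[OF v] jgi[OF u v g]] g by (simp_all add: GF_def Homs_def)
  have iG: "i v \<odot>\<^bsub>B\<^esub> farr F (farr GF g) = g \<odot>\<^bsub>B\<^esub> i u"
    if u: "u \<in> Obj B" and v: "v \<in> Obj B" and g: "g \<in> Homs B u v" for u v g
    using B.Comp_assoc[OF B.Comp_Homs[OF i[OF u] g] j[OF v] i[OF v]] ij[OF v] B.Idn_Comp[OF B.Comp_Homs[OF i[OF u] g]]
    by (simp add: Garr(2)[OF u v g])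
  have Gfun: "is_functor B A GF"
    unfolding is_functor_def
  proof (intro conjI ballI)
    fix u assume u: "u \<in> Obj B"
    show "fob GF u \<in> Obj A" using u by simp
    show "farr GF (Idn B u) = Idn A (fob GF u)"
    proof (rule faithful)
      show "farr GF (Idn B u) \<in> Homs A (G u) (G u)" by (rule Garr(1)[OF u u B.Idn_Homs[OF u]])
      show "Idn A (fob GF u) \<in> Homs A (G u) (G u)" using A.Idn_Homs u by simp
      show "farr F (farr GF (Idn B u)) = farr F (Idn A (fob GF u))"
        using u B.Idn_Comp[OF i[OF u]] ji[OF u] by (simp add: Garr(2)[OF u u B.Idn_Homs[OF u]] is_functorD(3)[OF F])
    qed
  next
    fix u v g assume "u \<in> Obj B" "v \<in> Obj B" "g \<in> Homs B u v"
    then show "farr GF g \<in> Homs A (fob GF u) (fob GF v)" using Garr(1) by simp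
  next
    fix u v w g h assume u: "u \<in> Obj B" and v: "v \<in> Obj B" and w: "w \<in> Obj B" and g: "g \<in> Homs B u v" and h: "h \<in> Homs B v w"
    note gh = B.Comp_Homs[OF g h] and Gg = Garr[OF u v g] and Gh = Garr[OF v w h]
    note FGg = is_functorD(2)[OF F G[OF u] G[OF v] Gg(1)]
    have "farr F (farr GF h \<odot>\<^bsub>A\<^esub> farr GF g) = (j w \<odot>\<^bsub>B\<^esub> (h \<odot>\<^bsub>B\<^esub> i v)) \<odot>\<^bsub>B\<^esub> farr F (farr GF g)"
      using is_functorD(4)[OF F G[OF u] G[OF v] G[OF w] Gg(1) Gh(1)] Gh(2) by simp
    also have "\<dots> = j w \<odot>\<^bsub>B\<^esub> (h \<odot>\<^bsub>B\<^esub> (i v \<odot>\<^bsub>B\<^esub> farr F (farr GF g)))"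
      using B.Comp_assoc[OF FGg B.Comp_Homs[OF i[OF v] h] j[OF w]] B.Comp_assoc[OF FGg i[OF v] h] by simp
    also have "\<dots> = j w \<odot>\<^bsub>B\<^esub> ((h \<odot>\<^bsub>B\<^esub> g) \<odot>\<^bsub>B\<^esub> i u)"
      using iG[OF u v g] B.Comp_assoc[OF i[OF u] g h] by simp
    also have "\<dots> = farr F (farr GF (h \<odot>\<^bsub>B\<^esub> g))" using Garr(2)[OF u w gh] by simp
    finally show "farr GF (h \<odot>\<^bsub>B\<^esub> g) = farr GF h \<odot>\<^bsub>A\<^esub> farr GF g"
      using faithful[OF Garr(1)[OF u w gh] A.Comp_Homs[OF Gg(1) Gh(1)]] by simp
  qed
  define \<eta> where "\<eta> x = lift x (G (fob F x)) (j (fob F x))" for x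
  have eta: "\<eta> x \<in> Homs A x (G (fob F x))" "farr F (\<eta> x) = j (fob F x)" if "x \<in> Obj A" for x
    using lift[of x "G (fob F x)" "j (fob F x)"] j[of "fob F x"] that by (simp_all add: \<eta>_def)
  have eta_iso: "iso_arr A (\<eta> x)" if x: "x \<in> Obj A" for x
  proof -
    let ?k = "lift (G (fob F x)) x (i (fob F x))"
    have k: "?k \<in> Homs A (G (fob F x)) x" "farr F ?k = i (fob F x)"
      using lift[of "G (fob F x)" x "i (fob F x)"] i[of "fob F x"] x by simp_all
    note Fx = is_functorD(1)[OF F x]
    have "?k \<odot>\<^bsub>A\<^esub> \<eta> x = Idn A x"
      by (rule faithful[OF A.Comp_Homs[OF eta(1)[OF x] k(1)] A.Idn_Homs[OF x]])
        (use is_functorD(4)[OF F x G[OF Fx] x eta(1)[OF x] k(1)] is_functorD(3)[OF F x] eta(2)[OF x] k(2) ij[OF Fx] in simp)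
    moreover have "\<eta> x \<odot>\<^bsub>A\<^esub> ?k = Idn A (G (fob F x))"
      by (rule faithful[OF A.Comp_Homs[OF k(1) eta(1)[OF x]] A.Idn_Homs[OF G[OF Fx]]])
        (use is_functorD(4)[OF F G[OF Fx] x G[OF Fx] k(1) eta(1)[OF x]] is_functorD(3)[OF F G[OF Fx]] eta(2)[OF x] k(2) ji[OF Fx] in simp)
    ultimately show ?thesis using eta(1)[OF x] k(1) by (auto simp: iso_arr_def Homs_def)
  qed
  have nat_eta: "is_nat_iso A A id_fctr (comp_fctr GF F) \<eta>"
    unfolding is_nat_iso_def
  proof (intro conjI ballI is_functor_id is_functor_comp[OF F Gfun])
    fix x assume "x \<in> Obj A"
    then show "\<eta> x \<in> Homs A (fob id_fctr x) (fob (comp_fctr GF F) x)" "iso_arr A (\<eta> x)"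
      using eta eta_iso by (simp_all add: id_fctr_def comp_fctr_def)
  next
    fix x y f assume x: "x \<in> Obj A" and y: "y \<in> Obj A" and f: "f \<in> Homs A x y"
    note Fx = is_functorD(1)[OF F x] and Fy = is_functorD(1)[OF F y] and Ff = is_functorD(2)[OF F x y f]
    have "\<eta> y \<odot>\<^bsub>A\<^esub> f = farr GF (farr F f) \<odot>\<^bsub>A\<^esub> \<eta> x"
    proof (rule faithful[OF A.Comp_Homs[OF f eta(1)[OF y]] A.Comp_Homs[OF eta(1)[OF x] Garr(1)[OF Fx Fy Ff]]])
      have "farr F (farr GF (farr F f) \<odot>\<^bsub>A\<^esub> \<eta> x) = (j (fob F y) \<odot>\<^bsub>B\<^esub> (farr F f \<odot>\<^bsub>B\<^esub> i (fob F x))) \<odot>\<^bsub>B\<^esub> j (fob F x)"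
        using is_functorD(4)[OF F x G[OF Fx] G[OF Fy] eta(1)[OF x] Garr(1)[OF Fx Fy Ff]] Garr(2)[OF Fx Fy Ff] eta(2)[OF x] by simp
      also have "\<dots> = j (fob F y) \<odot>\<^bsub>B\<^esub> (farr F f \<odot>\<^bsub>B\<^esub> (i (fob F x) \<odot>\<^bsub>B\<^esub> j (fob F x)))"
        using B.Comp_assoc[OF j[OF Fx] B.Comp_Homs[OF i[OF Fx] Ff] j[OF Fy]] B.Comp_assoc[OF j[OF Fx] i[OF Fx] Ff] by simp
      also have "\<dots> = farr F (\<eta> y \<odot>\<^bsub>A\<^esub> f)"
        using ij[OF Fx] B.Comp_Idn[OF Ff] is_functorD(4)[OF F x y G[OF Fy] f eta(1)[OF y]] eta(2)[OF y] by simp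
      finally show "farr F (\<eta> y \<odot>\<^bsub>A\<^esub> f) = farr F (farr GF (farr F f) \<odot>\<^bsub>A\<^esub> \<eta> x)" ..
    qed
    then show "\<eta> y \<odot>\<^bsub>A\<^esub> farr id_fctr f = farr (comp_fctr GF F) f \<odot>\<^bsub>A\<^esub> \<eta> x" by (simp add: id_fctr_def comp_fctr_def)
  qed
  have nat_eps: "is_nat_iso B B (comp_fctr F GF) id_fctr i"
    unfolding is_nat_iso_def
    by (intro conjI ballI is_functor_id is_functor_comp[OF Gfun F])
      (simp_all add: id_fctr_def comp_fctr_def i i_iso iG)
  have "farr GF (i u) \<odot>\<^bsub>A\<^esub> \<eta> (fob GF u) = Idn A (fob GF u)" if u: "u \<in> Obj B" for u
  proof -
    let ?v = "fob F (G u)"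
    have v: "?v \<in> Obj B" using u by simp
    note e = eta[OF G[OF u]] and Gi = Garr[OF v u i[OF u]]
    have "farr F (farr GF (i u)) = i ?v"
      using Gi(2) B.Comp_assoc[OF i[OF v] i[OF u] j[OF u]] ji[OF u] B.Idn_Comp[OF i[OF v]] by simp
    then have "farr F (farr GF (i u) \<odot>\<^bsub>A\<^esub> \<eta> (G u)) = farr F (Idn A (G u))"
      using is_functorD(4)[OF F G[OF u] G[OF v] G[OF u] e(1) Gi(1)] e(2) ij[OF v] is_functorD(3)[OF F G[OF u]] by simp
    then show ?thesis using faithful[OF A.Comp_Homs[OF e(1) Gi(1)] A.Idn_Homs[OF G[OF u]]] by simp
  qed
  moreover have "i (fob F x) \<odot>\<^bsub>B\<^esub> farr F (\<eta> x) = Idn B (fob F x)" if "x \<in> Obj A" for x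
    using that eta(2) ij by simp
  ultimately have "adjoint_equivalence A B F GF \<eta> i"
    unfolding adjoint_equivalence_def by (intro conjI ballI F Gfun nat_eta nat_eps)
  then show ?thesis by blast
qed

section \<open>Bi-adjunctions give couniversal arrows\<close>

lemma prod2_simps:
  "Ob (prod2 A B) = Ob A \<times> Ob B"
  "id1 (prod2 A B) (X, Y) = (id1 A X, id1 B Y)"
  "comp1 (prod2 A B) (f, g) (f', g') = (f \<cdot>\<^bsub>A\<^esub> f', g \<cdot>\<^bsub>B\<^esub> g')"
  "(f, g) \<in> hom1 (prod2 A B) (X, Y) (X', Y') \<longleftrightarrow> f \<in> hom1 A X X' \<and> g \<in> hom1 B Y Y'"
  "(\<alpha>, \<beta>) \<in> hom2 (prod2 A B) (f, g) (f', g') \<longleftrightarrow> \<alpha> \<in> hom2 A f f' \<and> \<beta> \<in> hom2 B g g'"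
  by (auto simp: prod2_def hom1_def hom2_def)

lemma pseudo_naturalD:
  assumes "pseudo_natural A F G \<Phi> \<phi>"
  shows "X \<in> Ob A \<Longrightarrow> is_functor (cob F X) (cob G X) (\<Phi> X)"
    and "X \<in> Ob A \<Longrightarrow> Y \<in> Ob A \<Longrightarrow> a \<in> hom1 A X Y \<Longrightarrow>
        is_nat_iso (cob F X) (cob G Y) (comp_fctr (cmor G a) (\<Phi> X)) (comp_fctr (\<Phi> Y) (cmor F a)) (\<phi> a)"
    and "X \<in> Ob A \<Longrightarrow> Y \<in> Ob A \<Longrightarrow> a \<in> hom1 A X Y \<Longrightarrow> b \<in> hom1 A X Y \<Longrightarrow> \<alpha> \<in> hom2 A a b \<Longrightarrow>
        x \<in> Obj (cob F X) \<Longrightarrow>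
        \<phi> b x \<odot>\<^bsub>cob G Y\<^esub> ctwo G \<alpha> (fob (\<Phi> X) x) = farr (\<Phi> Y) (ctwo F \<alpha> x) \<odot>\<^bsub>cob G Y\<^esub> \<phi> a x"
  using assms unfolding pseudo_natural_def by blast+

lemma hom_right_simps:
  "cob (hom_right C R) (X, Y) = hom_cat C X (on_ob R Y)"
  "fob (cmor (hom_right C R) (c, d)) h = on_mor R d \<cdot>\<^bsub>C\<^esub> (h \<cdot>\<^bsub>C\<^esub> c)"
  "farr (cmor (hom_right C R) (c, d)) \<theta> = id2 C (on_mor R d) \<star>\<^bsub>C\<^esub> (\<theta> \<star>\<^bsub>C\<^esub> id2 C c)"
  "ctwo (hom_right C R) (\<gamma>, \<delta>) h = on_two R \<delta> \<star>\<^bsub>C\<^esub> (id2 C h \<star>\<^bsub>C\<^esub> \<gamma>)"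
  "ccmpr (hom_right C R) (c, d) (c', d') h = cmpr R d d' \<star>\<^bsub>C\<^esub> id2 C (h \<cdot>\<^bsub>C\<^esub> (c \<cdot>\<^bsub>C\<^esub> c'))"
  by (simp_all add: hom_right_def)

lemma hom_left_simps:
  "cob (hom_left D L) (X, Y) = hom_cat D (on_ob L X) Y"
  "fob (cmor (hom_left D L) (c, d)) k = d \<cdot>\<^bsub>D\<^esub> (k \<cdot>\<^bsub>D\<^esub> on_mor L c)"
  "farr (cmor (hom_left D L) (c, d)) \<theta> = id2 D d \<star>\<^bsub>D\<^esub> (\<theta> \<star>\<^bsub>D\<^esub> id2 D (on_mor L c))"
  "ctwo (hom_left D L) (\<gamma>, \<delta>) k = \<delta> \<star>\<^bsub>D\<^esub> (id2 D k \<star>\<^bsub>D\<^esub> on_two L \<gamma>)"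
  "ccmpr (hom_left D L) (c, d) (c', d') k = id2 D (d' \<cdot>\<^bsub>D\<^esub> (d \<cdot>\<^bsub>D\<^esub> k)) \<star>\<^bsub>D\<^esub> cmpr L c' c"
  by (simp_all add: hom_left_def)

context two_category
begin

lemma iso_arr_hom_cat:
  assumes "f \<in> hom1 C X Y" "g \<in> hom1 C X Y"
  shows "\<alpha> \<in> Homs (hom_cat C X Y) f g \<and> iso_arr (hom_cat C X Y) \<alpha> \<longleftrightarrow> \<alpha> \<in> iso2 C f g"
proof -
  have "\<alpha> \<in> Arr (hom_cat C X Y)" if "\<alpha> \<in> hom2 C f g" using that assms by (auto simp: hom_cat_def hom2_def)
  then show ?thesis
    using Homs_hom_cat[OF assms] Homs_hom_cat[OF assms(2,1)]
    by (auto simp: iso_arr_def iso2_def inverse2_def hom_cat_simps hom2_iff)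
qed

lemma whisker_functor:
  assumes a: "a \<in> hom1 C X' X" and b: "b \<in> hom1 C Y Y'"
  shows "is_functor (hom_cat C X Y) (hom_cat C X' Y') \<lparr>fob = (\<lambda>k. b \<cdot> (k \<cdot> a)), farr = (\<lambda>\<theta>. id2 C b \<star> (\<theta> \<star> id2 C a))\<rparr>"
  unfolding is_functor_def hom_cat_simps fctr.simps
proof (intro conjI ballI)
  fix f assume f: "f \<in> hom1 C X Y"
  show "b \<cdot> (f \<cdot> a) \<in> hom1 C X' Y'" using a b f by (simp add: hom1_iff)
  show "id2 C b \<star> (id2 C f \<star> id2 C a) = id2 C (b \<cdot> (f \<cdot> a))" using a b f by (simp add: hom1_iff)
next
  fix f g \<theta> assume f: "f \<in> hom1 C X Y" and g: "g \<in> hom1 C X Y" and "\<theta> \<in> Homs (hom_cat C X Y) f g"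
  then have th: "\<theta> \<in> hom2 C f g" using Homs_hom_cat by blast
  have "b \<cdot> (f \<cdot> a) \<in> hom1 C X' Y'" "b \<cdot> (g \<cdot> a) \<in> hom1 C X' Y'" using a b f g by (simp_all add: hom1_iff)
  moreover have "id2 C b \<star> (\<theta> \<star> id2 C a) \<in> hom2 C (b \<cdot> (f \<cdot> a)) (b \<cdot> (g \<cdot> a))"
    using a b f g th by (simp add: hom1_iff hom2_iff)
  ultimately show "id2 C b \<star> (\<theta> \<star> id2 C a) \<in> Homs (hom_cat C X' Y') (b \<cdot> (f \<cdot> a)) (b \<cdot> (g \<cdot> a))"
    using Homs_hom_cat by blast
next
  fix f g h \<theta> \<theta>' assume f: "f \<in> hom1 C X Y" and g: "g \<in> hom1 C X Y" and h: "h \<in> hom1 C X Y"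
    and "\<theta> \<in> Homs (hom_cat C X Y) f g" "\<theta>' \<in> Homs (hom_cat C X Y) g h"
  then have th: "\<theta> \<in> hom2 C f g" "\<theta>' \<in> hom2 C g h" using Homs_hom_cat by blast+
  show "id2 C b \<star> ((\<theta>' \<bullet> \<theta>) \<star> id2 C a) = (id2 C b \<star> (\<theta>' \<star> id2 C a)) \<bullet> (id2 C b \<star> (\<theta> \<star> id2 C a))"
    using a b f g h th by (simp add: hom1_iff hom2_iff whisker_vcomp)
qed

end

context pseudo_functor
begin

text \<open>The couniversal arrow at \<open>Y\<close> is the transpose \<open>e\<close> of the identity; pseudo-naturality in \<open>X\<close>,
  evaluated at that identity, exhibits \<open>h \<mapsto> e (L h)\<close> as isomorphic to the equivalence
  \<open>C(X, R Y) \<rightarrow> D(L X, Y)\<close>.\<close>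

lemma bi_adjunction_imp_couniversal:
  assumes adj: "bi_adjunction C D L R \<Phi> \<phi> \<Psi> \<eta> \<epsilon>" and Y: "Y \<in> Ob D"
  shows "couniversal Y (on_ob R Y) (fob (\<Phi> (on_ob R Y, Y)) (id1 C (on_ob R Y)))"
proof -
  interpret R: pseudo_functor D C R
    using adj by (intro pseudo_functor.intro C.two_category_axioms D.two_category_axioms) (simp add: bi_adjunction_def)
  have nat: "pseudo_natural (prod2 (op2 C) D) (hom_right C R) (hom_left D L) \<Phi> \<phi>"
    and eqv: "\<And>X. X \<in> Ob C \<Longrightarrow> adjoint_equivalence (hom_cat C X (on_ob R Y)) (hom_cat D (on_ob L X) Y)
          (\<Phi> (X, Y)) (\<Psi> (X, Y)) (\<eta> (X, Y)) (\<epsilon> (X, Y))"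
    using adj Y by (auto simp: bi_adjunction_def)
  let ?R = "on_ob R Y" and ?i = "id1 D Y" and ?j = "id1 C (on_ob R Y)"
  let ?e = "fob (\<Phi> (?R, Y)) ?j"
  have R: "?R \<in> Ob C" using Y by simp
  have Phi: "is_functor (hom_cat C X ?R) (hom_cat D (on_ob L X) Y) (\<Phi> (X, Y))" if "X \<in> Ob C" for X
    using eqv[OF that] by (simp add: adjoint_equivalence_def)
  have Phi_ob: "fob (\<Phi> (X, Y)) h \<in> hom1 D (on_ob L X) Y" if "X \<in> Ob C" "h \<in> hom1 C X ?R" for X h
    using is_functorD(1)[OF Phi[OF that(1)]] that(2) by (simp add: hom_cat_simps)
  have e: "?e \<in> hom1 D (on_ob L ?R) Y" using Phi_ob[OF R, of ?j] R by (simp add: hom1_iff)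
  have e': "?e \<in> Mor D" "dom1 D ?e = on_ob L ?R" "cod1 D ?e = Y" using e by (auto simp: hom1_iff)
  define \<nu> where "\<nu> h = \<phi> (h, ?i) ?j" for h
  have a: "(h, ?i) \<in> hom1 (prod2 (op2 C) D) (?R, Y) (X, Y)" if "h \<in> hom1 C X ?R" for X h
    unfolding prod2_simps op2_homs using that Y by (simp add: hom1_iff)
  have ob: "(X, Y) \<in> Ob (prod2 (op2 C) D)" if "X \<in> Ob C" for X using that Y by (simp add: prod2_simps)
  have nu: "\<nu> h \<in> iso2 D (?e \<cdot> on_mor L h) (fob (\<Phi> (X, Y)) h)" if X: "X \<in> Ob C" and h: "h \<in> hom1 C X ?R" for X h
  proof -
    note n = pseudo_naturalD(2)[OF nat ob[OF R] ob[OF X] a[OF h]]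
    have j: "?j \<in> Obj (cob (hom_right C R) (?R, Y))" using R by (simp add: hom_right_simps hom_cat_simps hom1_iff)
    have "\<nu> h \<in> Homs (hom_cat D (on_ob L X) Y) (?e \<cdot> on_mor L h) (fob (\<Phi> (X, Y)) h) \<and>
        iso_arr (hom_cat D (on_ob L X) Y) (\<nu> h)"
      using is_nat_isoD(1,2)[OF n j] e' h R Y
      by (simp add: \<nu>_def comp_fctr_def hom_left_simps hom_right_simps hom1_iff)
    moreover have "?e \<cdot> on_mor L h \<in> hom1 D (on_ob L X) Y" using e' h by (auto simp: hom1_iff)
    ultimately show ?thesis using D.iso_arr_hom_cat Phi_ob[OF X h] by blast
  qed
  have nu_nat: "\<nu> d \<bullet> (id2 D ?e \<star> on_two L \<gamma>) = farr (\<Phi> (X, Y)) \<gamma> \<bullet> \<nu> c"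
    if X: "X \<in> Ob C" and c: "c \<in> hom1 C X ?R" and d: "d \<in> hom1 C X ?R" and g: "\<gamma> \<in> hom2 C c d" for X c d \<gamma>
  proof -
    have j: "?j \<in> Obj (cob (hom_right C R) (?R, Y))" using R by (simp add: hom_right_simps hom_cat_simps hom1_iff)
    have al: "(\<gamma>, id2 D ?i) \<in> hom2 (prod2 (op2 C) D) (c, ?i) (d, ?i)"
      unfolding prod2_simps op2_homs using g Y by (simp add: hom2_iff)
    have t: "\<gamma> \<in> Two C" "dom1 C (dom2 C \<gamma>) = X" "cod1 C (dom2 C \<gamma>) = ?R" using g c by (auto simp: hom1_iff hom2_iff)
    have lhs: "id2 D ?i \<star> (id2 D ?e \<star> on_two L \<gamma>) = id2 D ?e \<star> on_two L \<gamma>"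
      using t e' Y by simp
    have rhs: "on_two R (id2 D ?i) \<star>\<^bsub>C\<^esub> (id2 C ?j \<star>\<^bsub>C\<^esub> \<gamma>) = \<gamma>"
      using t R Y by simp
    show ?thesis
      using pseudo_naturalD(3)[OF nat ob[OF R] ob[OF X] a[OF c] a[OF d] al j]
      unfolding hom_left_simps hom_right_simps lhs rhs by (simp add: hom_cat_simps \<nu>_def)
  qed
  show ?thesis
    unfolding couniversal_def
  proof (intro conjI ballI R e)
    fix X f assume X: "X \<in> Ob C" and f: "f \<in> hom1 D (on_ob L X) Y"
    let ?c = "fob (\<Psi> (X, Y)) f" and ?F = "comp_fctr (\<Phi> (X, Y)) (\<Psi> (X, Y))"
    have Psi: "is_functor (hom_cat D (on_ob L X) Y) (hom_cat C X ?R) (\<Psi> (X, Y))"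
      and eps: "is_nat_iso (hom_cat D (on_ob L X) Y) (hom_cat D (on_ob L X) Y) ?F id_fctr (\<epsilon> (X, Y))"
      using eqv[OF X] by (simp_all add: adjoint_equivalence_def)
    have c: "?c \<in> hom1 C X ?R" using is_functorD(1)[OF Psi] f by (simp add: hom_cat_simps)
    have "f \<in> Obj (hom_cat D (on_ob L X) Y)" using f by (simp add: hom_cat_simps)
    from is_nat_isoD(1,2)[OF eps this]
    have "\<epsilon> (X, Y) f \<in> Homs (hom_cat D (on_ob L X) Y) (fob (\<Phi> (X, Y)) ?c) f \<and>
        iso_arr (hom_cat D (on_ob L X) Y) (\<epsilon> (X, Y) f)"
      by (simp add: comp_fctr_def id_fctr_def)
    then have "\<epsilon> (X, Y) f \<in> iso2 D (fob (\<Phi> (X, Y)) ?c) f"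
      unfolding D.iso_arr_hom_cat[OF Phi_ob[OF X c] f] .
    then have "\<epsilon> (X, Y) f \<bullet> \<nu> ?c \<in> iso2 D (?e \<cdot> on_mor L ?c) f" by (rule D.iso2_vcomp(1)[OF nu[OF X c]])
    then show "\<exists>c\<in>hom1 C X ?R. \<exists>\<psi>. \<psi> \<in> iso2 D (?e \<cdot> on_mor L c) f" using c by blast
  next
    fix X c d \<alpha> assume X: "X \<in> Ob C" and c: "c \<in> hom1 C X ?R" and d: "d \<in> hom1 C X ?R"
      and a: "\<alpha> \<in> hom2 D (?e \<cdot> on_mor L c) (?e \<cdot> on_mor L d)"
    note nc = nu[OF X c] and nd = nu[OF X d]
    let ?g = "\<nu> d \<bullet> (\<alpha> \<bullet> inv2 D (\<nu> c))"
    note [simp] = D.iso2_cell[OF nc] D.iso2_cell[OF nd] D.iso2_cell[OF D.inv2_iso2[OF nc]]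
      D.iso2_cell[OF D.inv2_iso2[OF nd]] a[unfolded hom2_iff]
    have "?g \<in> hom2 D (fob (\<Phi> (X, Y)) c) (fob (\<Phi> (X, Y)) d)" by (simp add: hom2_iff)
    then have "\<exists>!\<gamma>. \<gamma> \<in> Homs (hom_cat C X ?R) c d \<and> farr (\<Phi> (X, Y)) \<gamma> = ?g"
      using X c d Y D.Homs_hom_cat[OF Phi_ob[OF X c] Phi_ob[OF X d]]
      by (intro adjoint_equivalence_fully_faithful[OF C.hom_category D.hom_category eqv[OF X]])
        (simp_all add: hom_cat_simps)
    moreover have "\<gamma> \<in> Homs (hom_cat C X ?R) c d \<and> farr (\<Phi> (X, Y)) \<gamma> = ?g \<longleftrightarrow>
        \<gamma> \<in> hom2 C c d \<and> id2 D ?e \<star> on_two L \<gamma> = \<alpha>" for \<gamma>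
    proof -
      have "farr (\<Phi> (X, Y)) \<gamma> = ?g \<longleftrightarrow> id2 D ?e \<star> on_two L \<gamma> = \<alpha>" if g: "\<gamma> \<in> hom2 C c d"
      proof -
        have "farr (\<Phi> (X, Y)) \<gamma> \<in> Homs (hom_cat D (on_ob L X) Y) (fob (\<Phi> (X, Y)) c) (fob (\<Phi> (X, Y)) d)"
          using g c d C.Homs_hom_cat[OF c d] by (intro is_functorD(2)[OF Phi[OF X]]) (simp_all add: hom_cat_simps)
        then have [simp]: "farr (\<Phi> (X, Y)) \<gamma> \<in> Two D" "dom2 D (farr (\<Phi> (X, Y)) \<gamma>) = fob (\<Phi> (X, Y)) c"
          "cod2 D (farr (\<Phi> (X, Y)) \<gamma>) = fob (\<Phi> (X, Y)) d"
          using D.Homs_hom_cat[OF Phi_ob[OF X c] Phi_ob[OF X d]] by (auto simp: hom2_iff)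
        have [simp]: "\<gamma> \<in> Two C" "dom2 C \<gamma> = c" "cod2 C \<gamma> = d" "c \<in> Mor C" "dom1 C c = X" "cod1 C c = ?R"
          using g c by (auto simp: hom2_iff hom1_iff)
        note n = nu_nat[OF X c d g]
        show ?thesis
        proof
          assume eq: "farr (\<Phi> (X, Y)) \<gamma> = ?g"
          have "inv2 D (\<nu> d) \<bullet> (\<nu> d \<bullet> (id2 D ?e \<star> on_two L \<gamma>)) = inv2 D (\<nu> d) \<bullet> (\<nu> d \<bullet> \<alpha>)"
            unfolding n eq by (simp add: D.inv2_laws[OF nc])
          then show "id2 D ?e \<star> on_two L \<gamma> = \<alpha>" using e' by (simp add: D.inv2_cancel[OF nd])
        next
          assume eq: "id2 D ?e \<star> on_two L \<gamma> = \<alpha>"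
          have "?g = (farr (\<Phi> (X, Y)) \<gamma> \<bullet> \<nu> c) \<bullet> inv2 D (\<nu> c)"
            unfolding n[symmetric] eq by simp
          then show "farr (\<Phi> (X, Y)) \<gamma> = ?g" by (simp add: D.inv2_laws[OF nc])
        qed
      qed
      then show ?thesis using C.Homs_hom_cat[OF c d] by auto
    qed
    ultimately show "\<exists>!\<gamma>. \<gamma> \<in> hom2 C c d \<and> id2 D ?e \<star> on_two L \<gamma> = \<alpha>" by simp
  qed
qed

end

section \<open>Couniversal arrows give bi-adjunctions\<close>

context pseudo_functor
begin

text \<open>Composition with \<open>d : Y \<rightarrow> Y'\<close> carries the pseudo-slice double category over \<open>Y\<close> to the one over
  \<open>Y'\<close>, and a 2-cell \<open>\<delta> : d \<Rightarrow> d'\<close> acts on the vertical sides of squares.\<close>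

lemma triangle_whisker:
  assumes "triangle Y (X, f) (X', f') c \<psi>" "d \<in> hom1 D Y Y'"
  shows "triangle Y' (X, d \<cdot> f) (X', d \<cdot> f') c (id2 D d \<star> \<psi>)"
  using triangle_cell[OF assms(1)] assms(2) D.iso2_whisker(1)[OF triangle_cell(15)[OF assms(1)], of d]
  by (simp add: triangle_iff hom1_iff)

lemma paste_whisker:
  assumes "triangle Y (X, f) (X', f') c \<psi>" "triangle Y (X', f') (X'', f'') c' \<psi>'" "d \<in> hom1 D Y Y'"
  shows "id2 D d \<star> paste f'' c c' \<psi> \<psi>' = paste (d \<cdot> f'') c c' (id2 D d \<star> \<psi>) (id2 D d \<star> \<psi>')"
  using triangle_cell[OF assms(1)] triangle_cell[OF assms(2)] assms(3)
  by (simp add: paste_def hom1_iff D.whisker_vcomp)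

lemma over_square_whisker:
  assumes c: "triangle Y (X, f) (X', f') c \<psi>" and d: "triangle Y (X, g) (X', g') d \<phi>"
    and a: "\<alpha> \<in> hom2 D f g" and a': "\<alpha>' \<in> hom2 D f' g'" and ga: "\<gamma> \<in> hom2 C c d"
    and s: "over_square \<psi> \<phi> \<alpha> \<alpha>' \<gamma>" and de: "k \<in> hom1 D Y Y'" "\<delta> \<in> hom2 D k k'"
  shows "over_square (id2 D k \<star> \<psi>) (id2 D k' \<star> \<phi>) (\<delta> \<star> \<alpha>) (\<delta> \<star> \<alpha>') \<gamma>"
proof -
  note [simp] = triangle_cell[OF c] triangle_cell[OF d] a[unfolded hom2_iff] a'[unfolded hom2_iff]
    ga[unfolded hom2_iff] de[unfolded hom1_iff hom2_iff]
  have [simp]: "k' \<in> Mor D" "dom1 D k' = Y"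
    using de D.cod2_boundary[of \<delta>] D.cod2_Mor[of \<delta>] by (auto simp: hom1_iff hom2_iff)
  have "(\<delta> \<star> \<alpha>) \<bullet> (id2 D k \<star> \<psi>) = \<delta> \<star> (\<alpha> \<bullet> \<psi>)" by (simp add: D.interchange')
  also have "\<dots> = (id2 D k' \<bullet> \<delta>) \<star> (\<phi> \<bullet> (\<alpha>' \<star> on_two L \<gamma>))" using s by (simp add: over_square_def)
  also have "\<dots> = (id2 D k' \<star> \<phi>) \<bullet> (\<delta> \<star> (\<alpha>' \<star> on_two L \<gamma>))"
    by (intro D.interchange'[symmetric]) simp_all
  finally show ?thesis by (simp add: over_square_def)
qed

lemma triangle_whisker_id: "triangle Y (X, k \<cdot> on_mor L c) (X', k) c (id2 D (k \<cdot> on_mor L c))"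
  if "k \<in> hom1 D (on_ob L X') Y" "c \<in> hom1 C X X'" "X \<in> Ob C" "X' \<in> Ob C"
  using that by (auto simp: triangle_iff hom1_iff D.iso2_id2)

text \<open>A square in the form needed for pseudo-naturality, where the constraints are the inverses of the 2-cells of
  triangles.\<close>

lemma over_square_inv:
  assumes c: "triangle Y (X, f) (X', f') c \<psi>" and d: "triangle Y (X, g) (X', g') d \<phi>"
    and a: "\<alpha> \<in> hom2 D f g" and a': "\<alpha>' \<in> hom2 D f' g'" and ga: "\<gamma> \<in> hom2 C c d"
    and s: "over_square \<psi> \<phi> \<alpha> \<alpha>' \<gamma>"
  shows "inv2 D \<phi> \<bullet> \<alpha> = (\<alpha>' \<star> on_two L \<gamma>) \<bullet> inv2 D \<psi>"
proof -
  note [simp] = triangle_cell(1-14)[OF c] triangle_cell(1-14)[OF d] a[unfolded hom2_iff] a'[unfolded hom2_iff]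
    ga[unfolded hom2_iff]
  note i = triangle_cell(15)[OF c] and j = triangle_cell(15)[OF d]
  note [simp] = D.iso2_cell[OF D.inv2_iso2[OF i]] D.iso2_cell[OF D.inv2_iso2[OF j]]
  have "inv2 D \<phi> \<bullet> \<alpha> = inv2 D \<phi> \<bullet> ((\<alpha> \<bullet> \<psi>) \<bullet> inv2 D \<psi>)" by (simp add: D.inv2_laws[OF i])
  also have "\<dots> = inv2 D \<phi> \<bullet> (\<phi> \<bullet> ((\<alpha>' \<star> on_two L \<gamma>) \<bullet> inv2 D \<psi>))"
    using s by (simp add: over_square_def)
  also have "\<dots> = (\<alpha>' \<star> on_two L \<gamma>) \<bullet> inv2 D \<psi>" by (simp add: D.inv2_cancel[OF j])
  finally show ?thesis .
qed

end

locale couniversal_family = pseudo_functor C D L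
  for C :: "('o, 'm, 't) two_cat" and D :: "('p, 'n, 's) two_cat" (structure)
    and L :: "('o, 'm, 't, 'p, 'n, 's) psf" +
  fixes R_ob :: "'p \<Rightarrow> 'o" and e :: "'p \<Rightarrow> 'n"
  assumes couniv: "Y \<in> Ob D \<Longrightarrow> couniversal Y (R_ob Y) (e Y)"
begin

lemma R_ob_Ob [simp]: "Y \<in> Ob D \<Longrightarrow> R_ob Y \<in> Ob C"
  and e_cell [simp]: "Y \<in> Ob D \<Longrightarrow> e Y \<in> Mor D" "Y \<in> Ob D \<Longrightarrow> dom1 D (e Y) = on_ob L (R_ob Y)"
    "Y \<in> Ob D \<Longrightarrow> cod1 D (e Y) = Y"
  using couniv by (auto simp: couniversal_def hom1_iff)

definition fill :: "'p \<Rightarrow> 'm \<Rightarrow> 's \<Rightarrow> 'm \<Rightarrow> 's \<Rightarrow> 's \<Rightarrow> 't" where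
  "fill Y c \<psi> d \<phi> \<alpha> = (THE \<gamma>. \<gamma> \<in> hom2 C c d \<and> over_square \<psi> \<phi> \<alpha> (id2 D (e Y)) \<gamma>)"

lemma triangle_Ob: "triangle Y (X, f) (X', f') c \<psi> \<Longrightarrow> Y \<in> Ob D"
  using triangle_cell(3,5)[of Y X f X' f' c \<psi>] D.cod1_Ob by blast

lemma fill_square:
  assumes c: "triangle Y (X, f) (R_ob Y, e Y) c \<psi>" and d: "triangle Y (X, g) (R_ob Y, e Y) d \<phi>" and a: "\<alpha> \<in> hom2 D f g"
  shows "fill Y c \<psi> d \<phi> \<alpha> \<in> hom2 C c d" "over_square \<psi> \<phi> \<alpha> (id2 D (e Y)) (fill Y c \<psi> d \<phi> \<alpha>)"
  using theI'[OF couniversal_square[OF couniv[OF triangle_Ob[OF c]] c d a]] by (simp_all add: fill_def)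

lemma square_unique:
  assumes c: "triangle Y (X, f) (R_ob Y, e Y) c \<psi>" and d: "triangle Y (X, g) (R_ob Y, e Y) d \<phi>" and a: "\<alpha> \<in> hom2 D f g"
    and "\<gamma> \<in> hom2 C c d" "over_square \<psi> \<phi> \<alpha> (id2 D (e Y)) \<gamma>"
    and "\<gamma>' \<in> hom2 C c d" "over_square \<psi> \<phi> \<alpha> (id2 D (e Y)) \<gamma>'"
  shows "\<gamma> = \<gamma>'"
  using ex1_implies_unique[OF couniversal_square[OF couniv[OF triangle_Ob[OF c]] c d a]] assms(4-) by simp

lemma vcomp_into:
  assumes c: "triangle Y (X, f) (R_ob Y, e Y) c \<psi>" and d: "triangle Y (X, g) (R_ob Y, e Y) d \<phi>"
    and k: "triangle Y (X, h) (R_ob Y, e Y) k \<chi>"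
    and a: "\<alpha> \<in> hom2 D f g" and b: "\<beta> \<in> hom2 D g h" and ga: "\<gamma> \<in> hom2 C c d" and de: "\<delta> \<in> hom2 C d k"
    and s: "over_square \<psi> \<phi> \<alpha> (id2 D (e Y)) \<gamma>" and t: "over_square \<phi> \<chi> \<beta> (id2 D (e Y)) \<delta>"
  shows "\<delta> \<bullet>\<^bsub>C\<^esub> \<gamma> \<in> hom2 C c k" "over_square \<psi> \<chi> (\<beta> \<bullet> \<alpha>) (id2 D (e Y)) (\<delta> \<bullet>\<^bsub>C\<^esub> \<gamma>)"
proof -
  have i: "id2 D (e Y) \<in> hom2 D (e Y) (e Y)" using triangle_Ob[OF c] by (simp add: hom2_iff)
  show "\<delta> \<bullet>\<^bsub>C\<^esub> \<gamma> \<in> hom2 C c k" using ga de by (auto simp: hom2_iff)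
  show "over_square \<psi> \<chi> (\<beta> \<bullet> \<alpha>) (id2 D (e Y)) (\<delta> \<bullet>\<^bsub>C\<^esub> \<gamma>)"
    using over_square_vcomp[OF c d k a i b i ga de s t] triangle_Ob[OF c] by simp
qed

text \<open>The fillers in the two directions compose to fillers of identity squares, which are identities.\<close>

lemma fill_iso2:
  assumes c: "triangle Y (X, f) (R_ob Y, e Y) c \<psi>" and d: "triangle Y (X, f) (R_ob Y, e Y) d \<phi>"
  shows "fill Y c \<psi> d \<phi> (id2 D f) \<in> iso2 C c d"
proof -
  have i: "id2 D f \<in> hom2 D f f" using id2_hom2[OF c] by simp
  have ii: "id2 D f \<bullet> id2 D f = id2 D f" using triangle_cell[OF c] by simp
  note 1 = fill_square[OF c d i] and 2 = fill_square[OF d c i]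
  let ?p = "fill Y c \<psi> d \<phi> (id2 D f)" and ?q = "fill Y d \<phi> c \<psi> (id2 D f)"
  have "?q \<bullet>\<^bsub>C\<^esub> ?p = id2 C c"
    using vcomp_into[OF c d c i i 1(1) 2(1) 1(2) 2(2)] over_square_id[OF c] id2_hom2[OF c]
    by (intro square_unique[OF c c i]) (simp_all add: ii)
  moreover have "?p \<bullet>\<^bsub>C\<^esub> ?q = id2 C d"
    using vcomp_into[OF d c d i i 2(1) 1(1) 2(2) 1(2)] over_square_id[OF d] id2_hom2[OF d]
    by (intro square_unique[OF d d i]) (simp_all add: ii)
  ultimately have "inverse2 C ?p ?q" using 1(1) 2(1) by (auto simp: inverse2_def hom2_iff)
  then show ?thesis using C.iso2I[of ?p ?q] 1(1) by (simp add: hom2_iff)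
qed

text \<open>The right bi-adjoint on a morphism \<open>d : Y \<rightarrow> Y'\<close> is a chosen morphism of \<open>L \<down> Y'\<close> from \<open>(R Y, d e\<^sub>Y)\<close>
  to \<open>(R Y', e\<^sub>Y\<^sub>')\<close>; normality forces the choice at identities.\<close>

definition lift :: "'n \<Rightarrow> 'm \<times> 's" where
  "lift d = (if d = id1 D (dom1 D d) then (id1 C (R_ob (dom1 D d)), id2 D (e (dom1 D d)))
     else SOME (c, \<psi>). triangle (cod1 D d) (R_ob (dom1 D d), d \<cdot> e (dom1 D d)) (R_ob (cod1 D d), e (cod1 D d)) c \<psi>)"

definition R_mor :: "'n \<Rightarrow> 'm" where "R_mor d = fst (lift d)"
definition \<rho> :: "'n \<Rightarrow> 's" where "\<rho> d = snd (lift d)"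

lemma lift_triangle:
  assumes d: "d \<in> hom1 D Y Y'"
  shows "triangle Y' (R_ob Y, d \<cdot> e Y) (R_ob Y', e Y') (R_mor d) (\<rho> d)"
proof -
  have d': "d \<in> Mor D" "dom1 D d = Y" "cod1 D d = Y'" "Y \<in> Ob D" "Y' \<in> Ob D" using d by (auto simp: hom1_iff)
  show ?thesis
  proof (cases "d = id1 D (dom1 D d)")
    case True
    then have d1: "d = id1 D Y" unfolding d'(2) .
    have "Y' = Y" using d'(3,4) unfolding d1 by simp
    then show ?thesis unfolding d1 using d'(4) by (simp add: R_mor_def \<rho>_def lift_def triangle_iff D.iso2_id2)
  next
    case False
    let ?P = "\<lambda>p. case p of (c, \<psi>) \<Rightarrow> triangle Y' (R_ob Y, d \<cdot> e Y) (R_ob Y', e Y') c \<psi>"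
    have "(R_ob Y, d \<cdot> e Y) \<in> over_obs C D L Y'" using d' by (simp add: over_obs_def hom1_iff)
    then obtain c \<psi> where "?P (c, \<psi>)" using couniversal_triangle[OF couniv[OF d'(5)], of "R_ob Y" "d \<cdot> e Y"] by auto
    from someI[of ?P, OF this] have "?P (SOME p. ?P p)" .
    moreover have "lift d = (SOME p. ?P p)" using False d' by (simp add: lift_def)
    ultimately show ?thesis by (simp add: R_mor_def \<rho>_def case_prod_beta)
  qed
qed

lemma lift_id: "Y \<in> Ob D \<Longrightarrow> R_mor (id1 D Y) = id1 C (R_ob Y)" "Y \<in> Ob D \<Longrightarrow> \<rho> (id1 D Y) = id2 D (e Y)"
  by (simp_all add: R_mor_def \<rho>_def lift_def)

lemma R_mor_cell [simp]:
  assumes "d \<in> Mor D"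
  shows "R_mor d \<in> Mor C" "dom1 C (R_mor d) = R_ob (dom1 D d)" "cod1 C (R_mor d) = R_ob (cod1 D d)"
  using triangle_cell[OF lift_triangle[of d "dom1 D d" "cod1 D d"]] assms by (simp_all add: hom1_iff)

text \<open>On 2-cells and for the compositors: the unique filler of the square whose left side is \<open>\<delta> e\<^sub>Y\<close>,
  respectively an identity.\<close>

definition R_two :: "'s \<Rightarrow> 't" where
  "R_two \<delta> = (let d = dom2 D \<delta>; d' = cod2 D \<delta> in
     fill (cod1 D d) (R_mor d) (\<rho> d) (R_mor d') (\<rho> d') (\<delta> \<star> id2 D (e (dom1 D d))))"

definition R_cmpr :: "'n \<Rightarrow> 'n \<Rightarrow> 't" where
  "R_cmpr d d' = fill (cod1 D d') (R_mor d' \<cdot>\<^bsub>C\<^esub> R_mor d) (paste (e (cod1 D d')) (R_mor d) (R_mor d') (id2 D d' \<star> \<rho> d) (\<rho> d'))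
     (R_mor (d' \<cdot> d)) (\<rho> (d' \<cdot> d)) (id2 D (d' \<cdot> (d \<cdot> e (dom1 D d))))"

definition R :: "('p, 'n, 's, 'o, 'm, 't) psf" where
  "R = \<lparr>on_ob = R_ob, on_mor = R_mor, on_two = R_two, cmpr = R_cmpr\<rparr>"

lemma R_simps [simp]: "on_ob R = R_ob" "on_mor R = R_mor" "on_two R = R_two" "cmpr R = R_cmpr"
  by (simp_all add: R_def)

lemma whiskered_e:
  assumes "d \<in> hom1 D Y Y'" "\<delta> \<in> hom2 D d d'"
  shows "d' \<in> hom1 D Y Y'" "\<delta> \<star> id2 D (e Y) \<in> hom2 D (d \<cdot> e Y) (d' \<cdot> e Y)"
proof -
  have t: "\<delta> \<in> Two D" "dom2 D \<delta> = d" "cod2 D \<delta> = d'" "d \<in> Mor D" "dom1 D d = Y" "cod1 D d = Y'"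
    using assms by (simp_all add: hom1_iff hom2_iff)
  have Y: "Y \<in> Ob D" using D.dom1_Ob[OF t(4)] t(5) by simp
  have "d' \<in> Mor D" "dom1 D d' = Y" "cod1 D d' = Y'"
    using D.cod2_Mor[OF t(1)] D.cod2_boundary[OF t(1)] unfolding t by simp_all
  then show "d' \<in> hom1 D Y Y'" "\<delta> \<star> id2 D (e Y) \<in> hom2 D (d \<cdot> e Y) (d' \<cdot> e Y)"
    using t Y by (simp_all add: hom1_iff hom2_iff)
qed

lemma R_two_square:
  assumes d: "d \<in> hom1 D Y Y'" and de: "\<delta> \<in> hom2 D d d'"
  shows "R_two \<delta> \<in> hom2 C (R_mor d) (R_mor d')" "over_square (\<rho> d) (\<rho> d') (\<delta> \<star> id2 D (e Y)) (id2 D (e Y')) (R_two \<delta>)"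
proof -
  note w = whiskered_e[OF d de]
  have "R_two \<delta> = fill Y' (R_mor d) (\<rho> d) (R_mor d') (\<rho> d') (\<delta> \<star> id2 D (e Y))"
    using d de unfolding R_two_def Let_def hom1_iff hom2_iff by simp
  then show "R_two \<delta> \<in> hom2 C (R_mor d) (R_mor d')" "over_square (\<rho> d) (\<rho> d') (\<delta> \<star> id2 D (e Y)) (id2 D (e Y')) (R_two \<delta>)"
    using fill_square[OF lift_triangle[OF d] lift_triangle[OF w(1)] w(2)] by simp_all
qed

lemma R_two_eqI:
  assumes d: "d \<in> hom1 D Y Y'" and de: "\<delta> \<in> hom2 D d d'" and "\<gamma> \<in> hom2 C (R_mor d) (R_mor d')"
    and "over_square (\<rho> d) (\<rho> d') (\<delta> \<star> id2 D (e Y)) (id2 D (e Y')) \<gamma>"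
  shows "R_two \<delta> = \<gamma>"
  by (rule square_unique[OF lift_triangle[OF d] lift_triangle[OF whiskered_e(1)[OF d de]] whiskered_e(2)[OF d de]
      R_two_square[OF d de] assms(3,4)])

text \<open>The 2-cell of the composite of the lifts of \<open>d\<close> and \<open>d'\<close>, the first one carried along \<open>d'\<close>.\<close>

definition \<rho>_comp :: "'n \<Rightarrow> 'n \<Rightarrow> 's" where
  "\<rho>_comp d d' = paste (e (cod1 D d')) (R_mor d) (R_mor d') (id2 D d' \<star> \<rho> d) (\<rho> d')"

lemma comp_triangle:
  assumes d: "d \<in> hom1 D Y Y'" and d': "d' \<in> hom1 D Y' Y''"
  shows "triangle Y'' (R_ob Y, d' \<cdot> (d \<cdot> e Y)) (R_ob Y'', e Y'') (R_mor d' \<cdot>\<^bsub>C\<^esub> R_mor d) (\<rho>_comp d d')"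
    and "triangle Y'' (R_ob Y, d' \<cdot> (d \<cdot> e Y)) (R_ob Y'', e Y'') (R_mor (d' \<cdot> d)) (\<rho> (d' \<cdot> d))"
proof -
  have c: "cod1 D d' = Y''" using d' by (simp add: hom1_iff)
  show "triangle Y'' (R_ob Y, d' \<cdot> (d \<cdot> e Y)) (R_ob Y'', e Y'') (R_mor d' \<cdot>\<^bsub>C\<^esub> R_mor d) (\<rho>_comp d d')"
    unfolding \<rho>_comp_def c by (rule triangle_paste[OF triangle_whisker[OF lift_triangle[OF d] d'] lift_triangle[OF d']])
  have "(d' \<cdot> d) \<cdot> e Y = d' \<cdot> (d \<cdot> e Y)" using d d' by (auto simp: hom1_iff)
  then show "triangle Y'' (R_ob Y, d' \<cdot> (d \<cdot> e Y)) (R_ob Y'', e Y'') (R_mor (d' \<cdot> d)) (\<rho> (d' \<cdot> d))"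
    using lift_triangle[OF D.comp1_hom1[OF d d']] by simp
qed

lemma R_cmpr_square:
  assumes d: "d \<in> hom1 D Y Y'" and d': "d' \<in> hom1 D Y' Y''"
  shows "R_cmpr d d' \<in> iso2 C (R_mor d' \<cdot>\<^bsub>C\<^esub> R_mor d) (R_mor (d' \<cdot> d))" "R_cmpr d d' \<in> hom2 C (R_mor d' \<cdot>\<^bsub>C\<^esub> R_mor d) (R_mor (d' \<cdot> d))"
    "over_square (\<rho>_comp d d') (\<rho> (d' \<cdot> d)) (id2 D (d' \<cdot> (d \<cdot> e Y))) (id2 D (e Y'')) (R_cmpr d d')"
proof -
  have e: "R_cmpr d d' = fill Y'' (R_mor d' \<cdot>\<^bsub>C\<^esub> R_mor d) (\<rho>_comp d d') (R_mor (d' \<cdot> d)) (\<rho> (d' \<cdot> d)) (id2 D (d' \<cdot> (d \<cdot> e Y)))"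
    using d d' by (simp add: R_cmpr_def \<rho>_comp_def hom1_iff)
  note t = comp_triangle[OF d d']
  show "R_cmpr d d' \<in> iso2 C (R_mor d' \<cdot>\<^bsub>C\<^esub> R_mor d) (R_mor (d' \<cdot> d))" unfolding e by (rule fill_iso2[OF t])
  show "R_cmpr d d' \<in> hom2 C (R_mor d' \<cdot>\<^bsub>C\<^esub> R_mor d) (R_mor (d' \<cdot> d))"
    "over_square (\<rho>_comp d d') (\<rho> (d' \<cdot> d)) (id2 D (d' \<cdot> (d \<cdot> e Y))) (id2 D (e Y'')) (R_cmpr d d')"
    unfolding e using fill_square[OF t] id2_hom2[OF t(1)] by simp_all
qed

text \<open>Each axiom of a pseudo-functor equates two 2-cells which fill the same square into \<open>(R Y, e\<^sub>Y)\<close>.\<close>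

lemma R_hom_functor:
  assumes Y: "Y \<in> Ob D" "Y' \<in> Ob D"
  shows "is_functor (hom_cat D Y Y') (hom_cat C (R_ob Y) (R_ob Y')) \<lparr>fob = R_mor, farr = R_two\<rparr>"
  unfolding is_functor_def hom_cat_simps fctr.simps
proof (intro conjI ballI)
  fix d assume d: "d \<in> hom1 D Y Y'"
  then have i: "id2 D d \<in> hom2 D d d" by (simp add: hom1_iff hom2_iff)
  show "R_mor d \<in> hom1 C (R_ob Y) (R_ob Y')" using d by (simp add: hom1_iff)
  show "R_two (id2 D d) = id2 C (R_mor d)"
    using over_square_id[OF lift_triangle[OF d]] id2_hom2[OF lift_triangle[OF d]] d Y
    by (intro R_two_eqI[OF d i]) (simp_all add: hom1_iff)
next
  fix d d' \<delta> assume d: "d \<in> hom1 D Y Y'" "d' \<in> hom1 D Y Y'" and "\<delta> \<in> Homs (hom_cat D Y Y') d d'"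
  then have de: "\<delta> \<in> hom2 D d d'" using D.Homs_hom_cat by blast
  have "R_mor d \<in> hom1 C (R_ob Y) (R_ob Y')" "R_mor d' \<in> hom1 C (R_ob Y) (R_ob Y')" using d by (simp_all add: hom1_iff)
  then show "R_two \<delta> \<in> Homs (hom_cat C (R_ob Y) (R_ob Y')) (R_mor d) (R_mor d')"
    using C.Homs_hom_cat R_two_square(1)[OF d(1) de] by blast
next
  fix d d' d'' \<delta> \<delta>' assume d: "d \<in> hom1 D Y Y'" "d' \<in> hom1 D Y Y'" "d'' \<in> hom1 D Y Y'"
    and "\<delta> \<in> Homs (hom_cat D Y Y') d d'" "\<delta>' \<in> Homs (hom_cat D Y Y') d' d''"
  then have de: "\<delta> \<in> hom2 D d d'" and de': "\<delta>' \<in> hom2 D d' d''" using D.Homs_hom_cat by blast+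
  have c: "\<delta>' \<bullet> \<delta> \<in> hom2 D d d''" using de de' by (auto simp: hom2_iff)
  have w: "(\<delta>' \<bullet> \<delta>) \<star> id2 D (e Y) = (\<delta>' \<star> id2 D (e Y)) \<bullet> (\<delta> \<star> id2 D (e Y))"
    using de de' d Y by (intro D.whisker_vcomp(2)) (auto simp: hom1_iff hom2_iff)
  note v = vcomp_into[OF lift_triangle[OF d(1)] lift_triangle[OF d(2)] lift_triangle[OF d(3)] whiskered_e(2)[OF d(1) de]
    whiskered_e(2)[OF d(2) de'] R_two_square(1)[OF d(1) de] R_two_square(1)[OF d(2) de'] R_two_square(2)[OF d(1) de] R_two_square(2)[OF d(2) de']]
  show "R_two (\<delta>' \<bullet> \<delta>) = R_two \<delta>' \<bullet>\<^bsub>C\<^esub> R_two \<delta>"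
    using v by (intro R_two_eqI[OF d(1) c]) (simp_all add: w)
qed

lemma R_cmpr_natural:
  assumes d: "d \<in> hom1 D Y Y'" and d': "d' \<in> hom1 D Y' Y''" and de: "\<delta> \<in> hom2 D d b" and de': "\<delta>' \<in> hom2 D d' b'"
  shows "R_two (\<delta>' \<star> \<delta>) \<bullet>\<^bsub>C\<^esub> R_cmpr d d' = R_cmpr b b' \<bullet>\<^bsub>C\<^esub> (R_two \<delta>' \<star>\<^bsub>C\<^esub> R_two \<delta>)"
proof -
  have Y: "Y \<in> Ob D" "Y' \<in> Ob D" "Y'' \<in> Ob D" using d d' by (auto simp: hom1_iff)
  note b = whiskered_e(1)[OF d de] and b' = whiskered_e(1)[OF d' de']
  note [simp] = d[unfolded hom1_iff] d'[unfolded hom1_iff] b[unfolded hom1_iff] b'[unfolded hom1_iff]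
    de[unfolded hom2_iff] de'[unfolded hom2_iff]
  note [simp] = Y
  note dd = D.comp1_hom1[OF d d'] and dede = D.hcomp_hom2[OF d d' de de']
  let ?\<alpha> = "\<delta>' \<star> (\<delta> \<star> id2 D (e Y))"
  have al: "?\<alpha> \<in> hom2 D (d' \<cdot> (d \<cdot> e Y)) (b' \<cdot> (b \<cdot> e Y))" by (simp add: hom2_iff)
  have ids: "id2 D (d' \<cdot> (d \<cdot> e Y)) \<in> hom2 D (d' \<cdot> (d \<cdot> e Y)) (d' \<cdot> (d \<cdot> e Y))"
    "id2 D (b' \<cdot> (b \<cdot> e Y)) \<in> hom2 D (b' \<cdot> (b \<cdot> e Y)) (b' \<cdot> (b \<cdot> e Y))" by (simp_all add: hom2_iff)
  have s: "over_square (\<rho> (d' \<cdot> d)) (\<rho> (b' \<cdot> b)) ?\<alpha> (id2 D (e Y'')) (R_two (\<delta>' \<star> \<delta>))"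
    using R_two_square(2)[OF dd dede] by simp
  note 1 = vcomp_into[OF comp_triangle[OF d d'] comp_triangle(2)[OF b b'] ids(1) al R_cmpr_square(2)[OF d d'] R_two_square(1)[OF dd dede]
    R_cmpr_square(3)[OF d d'] s]
  have w: "over_square (id2 D d' \<star> \<rho> d) (id2 D b' \<star> \<rho> b) ?\<alpha> (\<delta>' \<star> id2 D (e Y')) (R_two \<delta>)"
    using id2_hom2[OF lift_triangle[OF d]]
    by (intro over_square_whisker[OF lift_triangle[OF d] lift_triangle[OF b] whiskered_e(2)[OF d de] _ R_two_square(1)[OF d de]
      R_two_square(2)[OF d de] d' de']) simp
  have h: "over_square (\<rho>_comp d d') (\<rho>_comp b b') ?\<alpha> (id2 D (e Y'')) (R_two \<delta>' \<star>\<^bsub>C\<^esub> R_two \<delta>)"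
    using over_square_hcomp[OF triangle_whisker[OF lift_triangle[OF d] d'] triangle_whisker[OF lift_triangle[OF b] b']
        lift_triangle[OF d'] lift_triangle[OF b'] al whiskered_e(2)[OF d' de'] _ R_two_square(1)[OF d de] R_two_square(1)[OF d' de'] w R_two_square(2)[OF d' de']]
      id2_hom2[OF lift_triangle[OF d']] by (simp add: \<rho>_comp_def)
  have hh: "R_two \<delta>' \<star>\<^bsub>C\<^esub> R_two \<delta> \<in> hom2 C (R_mor d' \<cdot>\<^bsub>C\<^esub> R_mor d) (R_mor b' \<cdot>\<^bsub>C\<^esub> R_mor b)"
    using R_two_square(1)[OF d de] R_two_square(1)[OF d' de'] by (auto simp: hom2_iff)
  note 2 = vcomp_into[OF comp_triangle(1)[OF d d'] comp_triangle[OF b b'] al ids(2) hh R_cmpr_square(2)[OF b b'] h R_cmpr_square(3)[OF b b']]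
  show ?thesis
    using 1 2 by (intro square_unique[OF comp_triangle(1)[OF d d'] comp_triangle(2)[OF b b'] al]) simp_all
qed

end

context couniversal_family
begin

lemma R_cmpr_assoc:
  assumes d: "d \<in> hom1 D Y Y'" and d': "d' \<in> hom1 D Y' Y''" and d'': "d'' \<in> hom1 D Y'' Y3"
  shows "R_cmpr (d' \<cdot> d) d'' \<bullet>\<^bsub>C\<^esub> (id2 C (R_mor d'') \<star>\<^bsub>C\<^esub> R_cmpr d d')
    = R_cmpr d (d'' \<cdot> d') \<bullet>\<^bsub>C\<^esub> (R_cmpr d' d'' \<star>\<^bsub>C\<^esub> id2 C (R_mor d))"
proof -
  have Y: "Y \<in> Ob D" "Y' \<in> Ob D" "Y'' \<in> Ob D" "Y3 \<in> Ob D" using d d' d'' by (auto simp: hom1_iff)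
  note [simp] = Y d[unfolded hom1_iff] d'[unfolded hom1_iff] d''[unfolded hom1_iff]
  note dd = D.comp1_hom1[OF d d'] and dd' = D.comp1_hom1[OF d' d'']
  note t = lift_triangle[OF d] and t' = lift_triangle[OF d'] and t'' = lift_triangle[OF d'']
  let ?f = "d'' \<cdot> (d' \<cdot> (d \<cdot> e Y))" and ?i = "id2 D" and ?c = "R_mor d'' \<cdot>\<^bsub>C\<^esub> (R_mor d' \<cdot>\<^bsub>C\<^esub> R_mor d)"
  let ?\<chi> = "paste (e Y3) (R_mor d' \<cdot>\<^bsub>C\<^esub> R_mor d) (R_mor d'') (?i d'' \<star> \<rho>_comp d d') (\<rho> d'')"
  have if': "?i ?f \<in> hom2 D ?f ?f" by (simp add: hom2_iff)
  have ifff: "?i ?f \<bullet> ?i ?f = ?i ?f" by simp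
  have i: "?i (d'' \<cdot> e Y'') \<in> hom2 D (d'' \<cdot> e Y'') (d'' \<cdot> e Y'')" "?i (e Y3) \<in> hom2 D (e Y3) (e Y3)"
    "?i (e Y'') \<in> hom2 D (e Y'') (e Y'')" "?i (d' \<cdot> (d \<cdot> e Y)) \<in> hom2 D (d' \<cdot> (d \<cdot> e Y)) (d' \<cdot> (d \<cdot> e Y))"
    "?i d'' \<in> hom2 D d'' d''" "id2 C (R_mor d'') \<in> hom2 C (R_mor d'') (R_mor d'')" "id2 C (R_mor d) \<in> hom2 C (R_mor d) (R_mor d)"
    "?i (d'' \<cdot> (d' \<cdot> e Y')) \<in> hom2 D (d'' \<cdot> (d' \<cdot> e Y')) (d'' \<cdot> (d' \<cdot> e Y'))"
    by (simp_all add: hom2_iff)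
  note w1 = triangle_whisker[OF comp_triangle(1)[OF d d'] d''] and w2 = triangle_whisker[OF comp_triangle(2)[OF d d'] d'']
  have T: "triangle Y3 (R_ob Y, ?f) (R_ob Y3, e Y3) ?c ?\<chi>"
    by (rule triangle_paste[OF w1 t''])
  have eq: "paste (e Y3) (R_mor d) (R_mor d'' \<cdot>\<^bsub>C\<^esub> R_mor d') (?i (d'' \<cdot> d') \<star> \<rho> d) (\<rho>_comp d' d'') = ?\<chi>"
  proof -
    have dw: "?i (d'' \<cdot> d') \<star> \<rho> d = ?i d'' \<star> (?i d' \<star> \<rho> d)"
      using triangle_cell[OF t] by simp
    show ?thesis
      unfolding dw using paste_assoc[OF triangle_whisker[OF triangle_whisker[OF t d'] d''] triangle_whisker[OF t' d''] t'']
        paste_whisker[OF triangle_whisker[OF t d'] t' d''] by (simp add: \<rho>_comp_def)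
  qed
  have B: "triangle Y3 (R_ob Y, ?f) (R_ob Y3, e Y3) (R_mor (d'' \<cdot> (d' \<cdot> d))) (\<rho> (d'' \<cdot> (d' \<cdot> d)))"
    using comp_triangle(2)[OF dd d''] by simp
  have M1: "triangle Y3 (R_ob Y, ?f) (R_ob Y3, e Y3) (R_mor d'' \<cdot>\<^bsub>C\<^esub> R_mor (d' \<cdot> d)) (\<rho>_comp (d' \<cdot> d) d'')"
    using comp_triangle(1)[OF dd d''] by simp
  have M2: "triangle Y3 (R_ob Y, ?f) (R_ob Y3, e Y3) (R_mor (d'' \<cdot> d') \<cdot>\<^bsub>C\<^esub> R_mor d) (\<rho>_comp d (d'' \<cdot> d'))"
    using comp_triangle(1)[OF d dd'] by simp
  have s1: "over_square ?\<chi> (\<rho>_comp (d' \<cdot> d) d'') (?i ?f) (?i (e Y3)) (id2 C (R_mor d'') \<star>\<^bsub>C\<^esub> R_cmpr d d')"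
  proof -
    have "over_square (?i d'' \<star> \<rho>_comp d d') (?i d'' \<star> \<rho> (d' \<cdot> d)) (?i d'' \<star> ?i (d' \<cdot> (d \<cdot> e Y))) (?i d'' \<star> ?i (e Y'')) (R_cmpr d d')"
      by (rule over_square_whisker[OF comp_triangle[OF d d'] i(4,3) R_cmpr_square(2)[OF d d'] R_cmpr_square(3)[OF d d'] d'' i(5)])
    then have "over_square (?i d'' \<star> \<rho>_comp d d') (?i d'' \<star> \<rho> (d' \<cdot> d)) (?i ?f) (?i (d'' \<cdot> e Y'')) (R_cmpr d d')" by simp
    from over_square_hcomp[OF w1 w2 t'' t'' if' i(1,2) R_cmpr_square(2)[OF d d'] i(6) this over_square_id[OF t'']]
    show ?thesis by (simp add: \<rho>_comp_def)
  qed
  have s2: "over_square ?\<chi> (\<rho>_comp d (d'' \<cdot> d')) (?i ?f) (?i (e Y3)) (R_cmpr d' d'' \<star>\<^bsub>C\<^esub> id2 C (R_mor d))"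
  proof -
    note w = triangle_whisker[OF t dd']
    have w': "triangle Y3 (R_ob Y, ?f) (R_ob Y', d'' \<cdot> (d' \<cdot> e Y')) (R_mor d) (?i (d'' \<cdot> d') \<star> \<rho> d)"
      using w by simp
    from over_square_hcomp[OF w' w' comp_triangle[OF d' d''] if' i(8,2) i(7) R_cmpr_square(2)[OF d' d''] over_square_id[OF w'] R_cmpr_square(3)[OF d' d'']]
    show ?thesis unfolding eq by (simp add: \<rho>_comp_def)
  qed
  have m1: "id2 C (R_mor d'') \<star>\<^bsub>C\<^esub> R_cmpr d d' \<in> hom2 C ?c (R_mor d'' \<cdot>\<^bsub>C\<^esub> R_mor (d' \<cdot> d))"
    and m2: "R_cmpr d' d'' \<star>\<^bsub>C\<^esub> id2 C (R_mor d) \<in> hom2 C ?c (R_mor (d'' \<cdot> d') \<cdot>\<^bsub>C\<^esub> R_mor d)"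
    using R_cmpr_square(2)[OF d d'] R_cmpr_square(2)[OF d' d''] by (simp_all add: hom2_iff)
  have r1: "R_cmpr (d' \<cdot> d) d'' \<in> hom2 C (R_mor d'' \<cdot>\<^bsub>C\<^esub> R_mor (d' \<cdot> d)) (R_mor (d'' \<cdot> (d' \<cdot> d)))"
    "over_square (\<rho>_comp (d' \<cdot> d) d'') (\<rho> (d'' \<cdot> (d' \<cdot> d))) (?i ?f) (?i (e Y3)) (R_cmpr (d' \<cdot> d) d'')"
    using R_cmpr_square(2,3)[OF dd d''] by simp_all
  have r2: "R_cmpr d (d'' \<cdot> d') \<in> hom2 C (R_mor (d'' \<cdot> d') \<cdot>\<^bsub>C\<^esub> R_mor d) (R_mor (d'' \<cdot> (d' \<cdot> d)))"
    "over_square (\<rho>_comp d (d'' \<cdot> d')) (\<rho> (d'' \<cdot> (d' \<cdot> d))) (?i ?f) (?i (e Y3)) (R_cmpr d (d'' \<cdot> d'))"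
    using R_cmpr_square(2,3)[OF d dd'] by simp_all
  note v1 = vcomp_into[OF T M1 B if' if' m1 r1(1) s1 r1(2)] and v2 = vcomp_into[OF T M2 B if' if' m2 r2(1) s2 r2(2)]
  show ?thesis
    by (rule square_unique[OF T B if' v1(1) _ v2(1)]) (use v1(2) v2(2) in \<open>simp_all only: ifff\<close>)
qed

lemma R_cmpr_units:
  assumes d: "d \<in> hom1 D Y Y'"
  shows "R_cmpr (id1 D Y) d = id2 C (R_mor d)" "R_cmpr d (id1 D Y') = id2 C (R_mor d)"
proof -
  have Y: "Y \<in> Ob D" "Y' \<in> Ob D" using d by (auto simp: hom1_iff)
  note [simp] = Y d[unfolded hom1_iff]
  note t = lift_triangle[OF d]
  have h: "id1 D Y \<in> hom1 D Y Y" "id1 D Y' \<in> hom1 D Y' Y'" by (simp_all add: hom1_iff)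
  have i: "id2 D (d \<cdot> e Y) \<in> hom2 D (d \<cdot> e Y) (d \<cdot> e Y)" "id2 C (R_mor d) \<in> hom2 C (R_mor d) (R_mor d)" by (simp_all add: hom2_iff)
  have "\<rho>_comp (id1 D Y) d = \<rho> d"
    using paste_id(1)[OF t] by (simp add: \<rho>_comp_def lift_id)
  then show "R_cmpr (id1 D Y) d = id2 C (R_mor d)"
    using R_cmpr_square(2,3)[OF h(1) d] over_square_id[OF t] i(2)
    by (intro square_unique[OF t t i(1)]) (simp_all add: lift_id)
  have "\<rho>_comp d (id1 D Y') = \<rho> d"
    using paste_id(2)[OF t] triangle_cell[OF t] by (simp add: \<rho>_comp_def lift_id)
  then show "R_cmpr d (id1 D Y') = id2 C (R_mor d)"
    using R_cmpr_square(2,3)[OF d h(2)] over_square_id[OF t] i(2)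
    by (intro square_unique[OF t t i(1)]) (simp_all add: lift_id)
qed

lemma R_pseudo_functor: "normal_pseudo_functor D C R"
proof
  fix Y Y' assume "Y \<in> Ob D" "Y' \<in> Ob D"
  then show "is_functor (hom_cat D Y Y') (hom_cat C (on_ob R Y) (on_ob R Y')) \<lparr>fob = on_mor R, farr = on_two R\<rparr>"
    using R_hom_functor by simp
next
  fix a a' X Y Z \<alpha> b \<alpha>' b' assume "a \<in> hom1 D X Y" "a' \<in> hom1 D Y Z" "\<alpha> \<in> hom2 D a b" "\<alpha>' \<in> hom2 D a' b'"
  then show "on_two R (\<alpha>' \<star> \<alpha>) \<bullet>\<^bsub>C\<^esub> cmpr R a a' = cmpr R b b' \<bullet>\<^bsub>C\<^esub> (on_two R \<alpha>' \<star>\<^bsub>C\<^esub> on_two R \<alpha>)"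
    using R_cmpr_natural by simp
next
  fix a a' a'' X Y Z W assume "a \<in> hom1 D X Y" "a' \<in> hom1 D Y Z" "a'' \<in> hom1 D Z W"
  then show "cmpr R (a' \<cdot> a) a'' \<bullet>\<^bsub>C\<^esub> (id2 C (on_mor R a'') \<star>\<^bsub>C\<^esub> cmpr R a a')
      = cmpr R a (a'' \<cdot> a') \<bullet>\<^bsub>C\<^esub> (cmpr R a' a'' \<star>\<^bsub>C\<^esub> id2 C (on_mor R a))"
    using R_cmpr_assoc by simp
qed (simp_all add: lift_id R_cmpr_square R_cmpr_units)

text \<open>The pseudo-naturality constraint of \<open>h \<mapsto> e (L h)\<close> is the inverse of the 2-cell \<open>\<chi>\<close> of a composite
  in \<open>L \<down> Y'\<close>, of \<open>c\<close>, \<open>h\<close> and the chosen lift of \<open>d\<close>.\<close>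

definition \<kappa> :: "'p \<Rightarrow> 'm \<Rightarrow> 'm \<Rightarrow> 's" where
  "\<kappa> Y c h = paste (e Y) c h (id2 D ((e Y \<cdot> on_mor L h) \<cdot> on_mor L c)) (id2 D (e Y \<cdot> on_mor L h))"

definition \<chi> :: "'m \<Rightarrow> 'n \<Rightarrow> 'm \<Rightarrow> 's" where
  "\<chi> c d h = paste (e (cod1 D d)) (h \<cdot>\<^bsub>C\<^esub> c) (R_mor d) (id2 D d \<star> \<kappa> (dom1 D d) c h) (\<rho> d)"

lemma \<kappa>_triangles:
  assumes c: "c \<in> hom1 C X' X" and h: "h \<in> hom1 C X (R_ob Y)" and Y: "Y \<in> Ob D"
  shows "triangle Y (X', (e Y \<cdot> on_mor L h) \<cdot> on_mor L c) (X, e Y \<cdot> on_mor L h) c (id2 D ((e Y \<cdot> on_mor L h) \<cdot> on_mor L c))"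
    and "triangle Y (X, e Y \<cdot> on_mor L h) (R_ob Y, e Y) h (id2 D (e Y \<cdot> on_mor L h))"
    and "triangle Y (X', (e Y \<cdot> on_mor L h) \<cdot> on_mor L c) (R_ob Y, e Y) (h \<cdot>\<^bsub>C\<^esub> c) (\<kappa> Y c h)"
proof -
  have X: "X \<in> Ob C" "X' \<in> Ob C" using c by (auto simp: hom1_iff)
  have eY: "e Y \<in> hom1 D (on_ob L (R_ob Y)) Y" using Y by (simp add: hom1_iff)
  have k: "e Y \<cdot> on_mor L h \<in> hom1 D (on_ob L X) Y" using h Y by (simp add: hom1_iff)
  show 1: "triangle Y (X', (e Y \<cdot> on_mor L h) \<cdot> on_mor L c) (X, e Y \<cdot> on_mor L h) c (id2 D ((e Y \<cdot> on_mor L h) \<cdot> on_mor L c))"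
    by (rule triangle_whisker_id[OF k c X(2,1)])
  show 2: "triangle Y (X, e Y \<cdot> on_mor L h) (R_ob Y, e Y) h (id2 D (e Y \<cdot> on_mor L h))"
    by (rule triangle_whisker_id[OF eY h X(1) R_ob_Ob[OF Y]])
  show "triangle Y (X', (e Y \<cdot> on_mor L h) \<cdot> on_mor L c) (R_ob Y, e Y) (h \<cdot>\<^bsub>C\<^esub> c) (\<kappa> Y c h)"
    unfolding \<kappa>_def by (rule triangle_paste[OF 1 2])
qed

lemma \<chi>_triangle:
  assumes c: "c \<in> hom1 C X' X" and h: "h \<in> hom1 C X (R_ob Y)" and d: "d \<in> hom1 D Y Y'"
  shows "triangle Y' (X', d \<cdot> ((e Y \<cdot> on_mor L h) \<cdot> on_mor L c)) (R_ob Y', e Y') (R_mor d \<cdot>\<^bsub>C\<^esub> (h \<cdot>\<^bsub>C\<^esub> c)) (\<chi> c d h)"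
proof -
  have Y: "Y \<in> Ob D" "dom1 D d = Y" "cod1 D d = Y'" using d by (auto simp: hom1_iff)
  show ?thesis
    unfolding \<chi>_def Y(2,3)
    by (rule triangle_paste[OF triangle_whisker[OF \<kappa>_triangles(3)[OF c h Y(1)] d] lift_triangle[OF d]])
qed

text \<open>Naturality of \<open>\<chi>\<close> in \<open>c\<close>, \<open>h\<close> and \<open>d\<close> at once: the square is the horizontal composite of squares for \<open>\<gamma>\<close>, for
  \<open>\<theta>\<close> and for \<open>R \<delta>\<close>. The first two are commutative by definition, their triangles being tautological.\<close>

lemma \<chi>_square:
  assumes c: "c \<in> hom1 C X' X" and h: "h \<in> hom1 C X (R_ob Y)" and d: "d \<in> hom1 D Y Y'"
    and ga: "\<gamma> \<in> hom2 C c c'" and th: "\<theta> \<in> hom2 C h h'" and de: "\<delta> \<in> hom2 D d d'"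
  shows "over_square (\<chi> c d h) (\<chi> c' d' h') (\<delta> \<star> ((id2 D (e Y) \<star> on_two L \<theta>) \<star> on_two L \<gamma>)) (id2 D (e Y'))
    (R_two \<delta> \<star>\<^bsub>C\<^esub> (\<theta> \<star>\<^bsub>C\<^esub> \<gamma>))"
proof -
  have Y: "Y \<in> Ob D" "Y' \<in> Ob D" using d by (auto simp: hom1_iff)
  have c': "c' \<in> hom1 C X' X" using c ga C.cod2_Mor[of \<gamma>] C.cod2_boundary[of \<gamma>] by (auto simp: hom1_iff hom2_iff)
  have h': "h' \<in> hom1 C X (R_ob Y)" using h th C.cod2_Mor[of \<theta>] C.cod2_boundary[of \<theta>] by (auto simp: hom1_iff hom2_iff)
  note d' = whiskered_e(1)[OF d de]
  note [simp] = Y c[unfolded hom1_iff] c'[unfolded hom1_iff] h[unfolded hom1_iff] h'[unfolded hom1_iff]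
    d[unfolded hom1_iff] d'[unfolded hom1_iff] ga[unfolded hom2_iff] th[unfolded hom2_iff] de[unfolded hom2_iff]
  note t = \<kappa>_triangles[OF c h Y(1)] and t' = \<kappa>_triangles[OF c' h' Y(1)]
  let ?k = "e Y \<cdot> on_mor L h" and ?k' = "e Y \<cdot> on_mor L h'" and ?a = "id2 D (e Y) \<star> on_two L \<theta>"
  have h2: "?a \<in> hom2 D ?k ?k'" "?a \<star> on_two L \<gamma> \<in> hom2 D (?k \<cdot> on_mor L c) (?k' \<cdot> on_mor L c')"
    "id2 D (e Y) \<in> hom2 D (e Y) (e Y)" "id2 D (e Y') \<in> hom2 D (e Y') (e Y')"
    by (simp_all add: hom2_iff)
  have "over_square (id2 D (?k \<cdot> on_mor L c)) (id2 D (?k' \<cdot> on_mor L c')) (?a \<star> on_two L \<gamma>) ?a \<gamma>"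
    "over_square (id2 D ?k) (id2 D ?k') ?a (id2 D (e Y)) \<theta>"
    by (simp_all add: over_square_def)
  from over_square_hcomp[OF t(1) t'(1) t(2) t'(2) h2(2,1,3) ga th this]
  have s: "over_square (\<kappa> Y c h) (\<kappa> Y c' h') (?a \<star> on_two L \<gamma>) (id2 D (e Y)) (\<theta> \<star>\<^bsub>C\<^esub> \<gamma>)"
    by (simp add: \<kappa>_def)
  have th': "\<theta> \<star>\<^bsub>C\<^esub> \<gamma> \<in> hom2 C (h \<cdot>\<^bsub>C\<^esub> c) (h' \<cdot>\<^bsub>C\<^esub> c')" by (simp add: hom2_iff)
  note w = over_square_whisker[OF t(3) t'(3) h2(2,3) th' s d de]
  have l: "\<delta> \<star> (?a \<star> on_two L \<gamma>) \<in> hom2 D (d \<cdot> (?k \<cdot> on_mor L c)) (d' \<cdot> (?k' \<cdot> on_mor L c'))"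
    by (simp add: hom2_iff)
  from over_square_hcomp[OF triangle_whisker[OF t(3) d] triangle_whisker[OF t'(3) d'] lift_triangle[OF d] lift_triangle[OF d']
      l whiskered_e(2)[OF d de] h2(4) th' R_two_square(1)[OF d de] w R_two_square(2)[OF d de]]
  show ?thesis by (simp add: \<chi>_def)
qed

text \<open>\<open>W\<close> is the 2-cell of the composite of the tautological triangles for \<open>c'\<close>, \<open>c\<close> and \<open>h\<close>, with codomain
  \<open>k (L c) (L c')\<close>; the compositor of \<open>L\<close> relates it to the tautological triangle for \<open>c c'\<close>, with codomain
  \<open>k (L (c c'))\<close>.\<close>

lemma \<kappa>_comp:
  assumes c: "c \<in> hom1 C X' X" and c': "c' \<in> hom1 C X'' X'" and h: "h \<in> hom1 C X (R_ob Y)" and Y: "Y \<in> Ob D"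
  defines "k \<equiv> e Y \<cdot> on_mor L h"
  defines "W \<equiv> paste (e Y) (c \<cdot>\<^bsub>C\<^esub> c') h (id2 D k \<star> cmpr_inv c' c) (id2 D k)"
  shows "triangle Y (X'', k \<cdot> (on_mor L c \<cdot> on_mor L c')) (R_ob Y, e Y) (h \<cdot>\<^bsub>C\<^esub> (c \<cdot>\<^bsub>C\<^esub> c')) W"
    and "over_square W (\<kappa> Y (c \<cdot>\<^bsub>C\<^esub> c') h) (id2 D k \<star> cmpr L c' c) (id2 D (e Y)) (id2 C (h \<cdot>\<^bsub>C\<^esub> (c \<cdot>\<^bsub>C\<^esub> c')))"
    and "paste (e Y) c' (h \<cdot>\<^bsub>C\<^esub> c) (id2 D ((k \<cdot> on_mor L c) \<cdot> on_mor L c')) (\<kappa> Y c h) = W"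
proof -
  note [simp] = Y c[unfolded hom1_iff] c'[unfolded hom1_iff] h[unfolded hom1_iff]
  have X: "X \<in> Ob C" "X' \<in> Ob C" "X'' \<in> Ob C" using C.dom1_Ob[of c] C.cod1_Ob[of c] C.dom1_Ob[of c'] by simp_all
  have k: "k \<in> Mor D" "dom1 D k = on_ob L X" "cod1 D k = Y" by (simp_all add: k_def)
  note [simp] = X k
  have k': "k \<cdot> on_mor L c \<in> hom1 D (on_ob L X') Y" "k \<in> hom1 D (on_ob L X) Y" by (simp_all add: hom1_iff)
  note t1 = triangle_whisker_id[OF k'(1) c' X(3,2)] and t2 = triangle_whisker_id[OF k'(2) c X(2,1)]
  note t3 = \<kappa>_triangles(2)[OF c h Y, folded k_def]
  have p: "paste k c' c (id2 D ((k \<cdot> on_mor L c) \<cdot> on_mor L c')) (id2 D (k \<cdot> on_mor L c)) = id2 D k \<star> cmpr_inv c' c"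
    by (simp add: paste_def)
  show "paste (e Y) c' (h \<cdot>\<^bsub>C\<^esub> c) (id2 D ((k \<cdot> on_mor L c) \<cdot> on_mor L c')) (\<kappa> Y c h) = W"
    using paste_assoc[OF t1 t2 t3] unfolding p by (simp add: W_def \<kappa>_def k_def)
  have u: "triangle Y (X'', k \<cdot> (on_mor L c \<cdot> on_mor L c')) (X, k) (c \<cdot>\<^bsub>C\<^esub> c') (id2 D k \<star> cmpr_inv c' c)"
    using triangle_paste[OF t1 t2] unfolding p by simp
  show "triangle Y (X'', k \<cdot> (on_mor L c \<cdot> on_mor L c')) (R_ob Y, e Y) (h \<cdot>\<^bsub>C\<^esub> (c \<cdot>\<^bsub>C\<^esub> c')) W"
    unfolding W_def using triangle_paste[OF u t3] by simp
  have cc: "c \<cdot>\<^bsub>C\<^esub> c' \<in> hom1 C X'' X" by (simp add: hom1_iff)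
  note v = \<kappa>_triangles(1)[OF cc h Y, folded k_def]
  have i: "id2 D k \<star> cmpr L c' c \<in> hom2 D (k \<cdot> (on_mor L c \<cdot> on_mor L c')) (k \<cdot> on_mor L (c \<cdot>\<^bsub>C\<^esub> c'))"
    "id2 D k \<in> hom2 D k k" "id2 D (e Y) \<in> hom2 D (e Y) (e Y)" "id2 C (c \<cdot>\<^bsub>C\<^esub> c') \<in> hom2 C (c \<cdot>\<^bsub>C\<^esub> c') (c \<cdot>\<^bsub>C\<^esub> c')"
    "id2 C h \<in> hom2 C h h"
    by (simp_all add: hom2_iff)
  have "over_square (id2 D k \<star> cmpr_inv c' c) (id2 D (k \<cdot> on_mor L (c \<cdot>\<^bsub>C\<^esub> c'))) (id2 D k \<star> cmpr L c' c) (id2 D k) (id2 C (c \<cdot>\<^bsub>C\<^esub> c'))"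
    using D.inv2_laws(2)[OF cmpr_iso2'[of c' c]] by (simp add: over_square_def D.interchange')
  from over_square_hcomp[OF u v t3 t3 i(1,2,3,4,5) this over_square_id[OF t3]]
  show "over_square W (\<kappa> Y (c \<cdot>\<^bsub>C\<^esub> c') h) (id2 D k \<star> cmpr L c' c) (id2 D (e Y)) (id2 C (h \<cdot>\<^bsub>C\<^esub> (c \<cdot>\<^bsub>C\<^esub> c')))"
    by (simp add: W_def \<kappa>_def k_def)
qed

end

context couniversal_family
begin

text \<open>The equation is \<open>over_square_inv\<close> for a single square. Its top \<open>V U\<close> is the pasting of the two 2-cells \<open>\<chi>\<close> of the
  single steps, its bottom is \<open>\<chi>\<close> for the composite, its left side is a whiskered compositor of \<open>L\<close>, and its filler
  is a whiskered compositor of \<open>R\<close>.\<close>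

lemma \<chi>_comp:
  assumes c: "c \<in> hom1 C X' X" and c': "c' \<in> hom1 C X'' X'" and h: "h \<in> hom1 C X (R_ob Y)"
    and d: "d \<in> hom1 D Y Y'" and d': "d' \<in> hom1 D Y' Y''"
  defines "k \<equiv> e Y \<cdot> on_mor L h" and "h' \<equiv> R_mor d \<cdot>\<^bsub>C\<^esub> (h \<cdot>\<^bsub>C\<^esub> c)"
  shows "inv2 D (\<chi> (c \<cdot>\<^bsub>C\<^esub> c') (d' \<cdot> d) h) \<bullet> (id2 D (d' \<cdot> (d \<cdot> k)) \<star> cmpr L c' c)
    = (id2 D (e Y'') \<star> on_two L (R_cmpr d d' \<star>\<^bsub>C\<^esub> id2 C (h \<cdot>\<^bsub>C\<^esub> (c \<cdot>\<^bsub>C\<^esub> c'))))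
      \<bullet> (inv2 D (\<chi> c' d' h') \<bullet> (id2 D d' \<star> (inv2 D (\<chi> c d h) \<star> id2 D (on_mor L c'))))"
proof -
  have Y: "Y \<in> Ob D" "Y' \<in> Ob D" "Y'' \<in> Ob D" using d d' by (auto simp: hom1_iff)
  note [simp] = Y c[unfolded hom1_iff] c'[unfolded hom1_iff] h[unfolded hom1_iff] d[unfolded hom1_iff] d'[unfolded hom1_iff]
  have X: "X \<in> Ob C" "X' \<in> Ob C" "X'' \<in> Ob C" using C.dom1_Ob[of c] C.cod1_Ob[of c] C.dom1_Ob[of c'] by simp_all
  have k: "k \<in> Mor D" "dom1 D k = on_ob L X" "cod1 D k = Y" by (simp_all add: k_def)
  have h': "h' \<in> Mor C" "dom1 C h' = X'" "cod1 C h' = R_ob Y'" by (simp_all add: h'_def)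
  note [simp] = X k h'
  have h'1: "h' \<in> hom1 C X' (R_ob Y')" and k1: "k \<cdot> on_mor L c \<in> hom1 D (on_ob L X') Y" by (simp_all add: hom1_iff)
  define W where "W = paste (e Y) (c \<cdot>\<^bsub>C\<^esub> c') h (id2 D k \<star> cmpr_inv c' c) (id2 D k)"
  define U where "U = \<chi> c' d' h'"
  define V where "V = id2 D d' \<star> (\<chi> c d h \<star> id2 D (on_mor L c'))"
  let ?i = "id2 D" and ?Lc = "on_mor L c" and ?Lc' = "on_mor L c'" and ?hcc = "h \<cdot>\<^bsub>C\<^esub> (c \<cdot>\<^bsub>C\<^esub> c')"
  note \<kappa>c = \<kappa>_comp[OF c c' h Y(1), folded k_def, folded W_def]
  note tW = \<kappa>c(1)
  note t\<chi> = \<chi>_triangle[OF c h d, folded k_def h'_def] and tU = \<chi>_triangle[OF c' h'1 d']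
  note t\<kappa> = \<kappa>_triangles(3)[OF c h Y(1), folded k_def]
  note t1 = triangle_whisker_id[OF k1 c' X(3,2)]
  note [simp] = triangle_cell(12-14)[OF t\<chi>] triangle_cell(12-14)[OF tU]
  \<comment> \<open>By associativity of pasting, \<open>V U\<close> is the composite of \<open>W\<close> with \<open>\<rho>_comp d d'\<close>, both of which are sides of
    squares with known fillers.\<close>
  have VU: "V \<bullet> U = paste (e Y'') ?hcc (R_mor d' \<cdot>\<^bsub>C\<^esub> R_mor d) (?i (d' \<cdot> d) \<star> W) (\<rho>_comp d d')"
  proof -
    let ?Z = "paste (e Y') ?hcc (R_mor d) (?i d \<star> W) (\<rho> d)"
    note tdW = triangle_whisker[OF tW d]
    have Z: "(\<chi> c d h \<star> ?i ?Lc') \<bullet> \<kappa> Y' c' h' = ?Z"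
    proof -
      have "(\<chi> c d h \<star> ?i ?Lc') \<bullet> \<kappa> Y' c' h' = paste (e Y') c' h' (?i d \<star> ?i ((k \<cdot> ?Lc) \<cdot> ?Lc')) (\<chi> c d h)"
        by (simp add: \<kappa>_def paste_def)
      also have "\<dots> = paste (e Y') ((h \<cdot>\<^bsub>C\<^esub> c) \<cdot>\<^bsub>C\<^esub> c') (R_mor d) (paste (d \<cdot> e Y) c' (h \<cdot>\<^bsub>C\<^esub> c) (?i d \<star> ?i ((k \<cdot> ?Lc) \<cdot> ?Lc')) (?i d \<star> \<kappa> Y c h)) (\<rho> d)"
        using paste_assoc[OF triangle_whisker[OF t1 d] triangle_whisker[OF t\<kappa> d] lift_triangle[OF d]]
        by (simp add: \<chi>_def h'_def)
      also have "\<dots> = ?Z"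
        using paste_whisker[OF t1 t\<kappa> d] \<kappa>c(3) by simp
      finally show ?thesis .
    qed
    have k2: "\<kappa> Y' c' h' \<in> Two D" "dom2 D (\<kappa> Y' c' h') = e Y' \<cdot> on_mor L (h' \<cdot>\<^bsub>C\<^esub> c')"
      "cod2 D (\<kappa> Y' c' h') = (e Y' \<cdot> on_mor L h') \<cdot> ?Lc'"
      using triangle_cell(12-14)[OF \<kappa>_triangles(3)[OF c' h'1 Y(2)]] by simp_all
    note r = triangle_cell(12-14)[OF lift_triangle[OF d']]
    have U: "U = paste (e Y'') (h' \<cdot>\<^bsub>C\<^esub> c') (R_mor d') (?i d' \<star> \<kappa> Y' c' h') (\<rho> d')"
      by (simp add: U_def \<chi>_def)
    have V: "V \<in> Two D" "dom2 D V = d' \<cdot> (e Y' \<cdot> (on_mor L h' \<cdot> ?Lc'))" by (simp_all add: V_def)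
    have "V \<bullet> U = paste (e Y'') (h' \<cdot>\<^bsub>C\<^esub> c') (R_mor d') (V \<bullet> (?i d' \<star> \<kappa> Y' c' h')) (\<rho> d')"
      unfolding U paste_def using k2 r V by simp
    also have "V \<bullet> (?i d' \<star> \<kappa> Y' c' h') = ?i d' \<star> ((\<chi> c d h \<star> ?i ?Lc') \<bullet> \<kappa> Y' c' h')"
      unfolding V_def using k2 by (intro D.whisker_vcomp(1)[symmetric]) simp_all
    also have "\<dots> = paste (d' \<cdot> e Y') ?hcc (R_mor d) (?i d' \<star> (?i d \<star> W)) (?i d' \<star> \<rho> d)"
      unfolding Z by (rule paste_whisker[OF tdW lift_triangle[OF d] d'])
    also have "paste (e Y'') (h' \<cdot>\<^bsub>C\<^esub> c') (R_mor d') (paste (d' \<cdot> e Y') ?hcc (R_mor d) (?i d' \<star> (?i d \<star> W)) (?i d' \<star> \<rho> d)) (\<rho> d')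
        = paste (e Y'') ?hcc (R_mor d' \<cdot>\<^bsub>C\<^esub> R_mor d) (?i d' \<star> (?i d \<star> W)) (\<rho>_comp d d')"
      using paste_assoc[OF triangle_whisker[OF tdW d'] triangle_whisker[OF lift_triangle[OF d] d'] lift_triangle[OF d']]
      by (simp add: \<rho>_comp_def h'_def)
    also have "?i d' \<star> (?i d \<star> W) = ?i (d' \<cdot> d) \<star> W" using triangle_cell[OF tW] by simp
    finally show ?thesis .
  qed
  note dd = D.comp1_hom1[OF d d']
  have cc: "c \<cdot>\<^bsub>C\<^esub> c' \<in> hom1 C X'' X" by (simp add: hom1_iff)
  note t\<kappa>' = \<kappa>_triangles(3)[OF cc h Y(1), folded k_def]
  let ?f = "d' \<cdot> (d \<cdot> (k \<cdot> (?Lc \<cdot> ?Lc')))" and ?g = "d' \<cdot> (d \<cdot> (k \<cdot> on_mor L (c \<cdot>\<^bsub>C\<^esub> c')))" and ?e = "d' \<cdot> (d \<cdot> e Y)"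
  let ?Q = "?i (d' \<cdot> (d \<cdot> k)) \<star> cmpr L c' c"
  have tA: "triangle Y'' (X'', ?f) (R_ob Y, ?e) ?hcc (?i (d' \<cdot> d) \<star> W)"
    and tB: "triangle Y'' (X'', ?g) (R_ob Y, ?e) ?hcc (?i (d' \<cdot> d) \<star> \<kappa> Y (c \<cdot>\<^bsub>C\<^esub> c') h)"
    using triangle_whisker[OF tW dd] triangle_whisker[OF t\<kappa>' dd] by simp_all
  have hs: "?i k \<star> cmpr L c' c \<in> hom2 D (k \<cdot> (?Lc \<cdot> ?Lc')) (k \<cdot> on_mor L (c \<cdot>\<^bsub>C\<^esub> c'))" "?i (e Y) \<in> hom2 D (e Y) (e Y)"
    "?i (d' \<cdot> d) \<in> hom2 D (d' \<cdot> d) (d' \<cdot> d)" "?Q \<in> hom2 D ?f ?g" "?i ?e \<in> hom2 D ?e ?e" "?i (e Y'') \<in> hom2 D (e Y'') (e Y'')"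
    "id2 C ?hcc \<in> hom2 C ?hcc ?hcc"
    by (simp_all add: hom2_iff)
  have "over_square (?i (d' \<cdot> d) \<star> W) (?i (d' \<cdot> d) \<star> \<kappa> Y (c \<cdot>\<^bsub>C\<^esub> c') h) ?Q (?i ?e) (id2 C ?hcc)"
    using over_square_whisker[OF tW t\<kappa>' hs(1,2,7) \<kappa>c(2) dd hs(3)] by simp
  from over_square_hcomp[OF tA tB comp_triangle[OF d d'] hs(4,5,6) hs(7) R_cmpr_square(2)[OF d d'] this R_cmpr_square(3)[OF d d']]
  have s: "over_square (V \<bullet> U) (\<chi> (c \<cdot>\<^bsub>C\<^esub> c') (d' \<cdot> d) h) ?Q (?i (e Y'')) (R_cmpr d d' \<star>\<^bsub>C\<^esub> id2 C ?hcc)"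
    unfolding VU by (simp add: \<chi>_def)
  have T: "triangle Y'' (X'', ?f) (R_ob Y'', e Y'') (R_mor d' \<cdot>\<^bsub>C\<^esub> (R_mor d \<cdot>\<^bsub>C\<^esub> ?hcc)) (V \<bullet> U)"
    unfolding VU using triangle_paste[OF tA comp_triangle(1)[OF d d']] by simp
  have B: "triangle Y'' (X'', ?g) (R_ob Y'', e Y'') (R_mor (d' \<cdot> d) \<cdot>\<^bsub>C\<^esub> ?hcc) (\<chi> (c \<cdot>\<^bsub>C\<^esub> c') (d' \<cdot> d) h)"
    using \<chi>_triangle[OF cc h dd, folded k_def] by simp
  have "R_cmpr d d' \<star>\<^bsub>C\<^esub> id2 C ?hcc \<in> hom2 C (R_mor d' \<cdot>\<^bsub>C\<^esub> (R_mor d \<cdot>\<^bsub>C\<^esub> ?hcc)) (R_mor (d' \<cdot> d) \<cdot>\<^bsub>C\<^esub> ?hcc)"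
    using R_cmpr_square(2)[OF d d'] by (simp add: hom2_iff)
  note inv = over_square_inv[OF T B hs(4,6) this s]
  have i\<chi>: "\<chi> c d h \<in> iso2 D (e Y' \<cdot> on_mor L h') (d \<cdot> (k \<cdot> ?Lc))" using triangle_cell(15)[OF t\<chi>] by simp
  have iw: "\<chi> c d h \<star> ?i ?Lc' \<in> iso2 D ((e Y' \<cdot> on_mor L h') \<cdot> ?Lc') ((d \<cdot> (k \<cdot> ?Lc)) \<cdot> ?Lc')"
    "inv2 D (\<chi> c d h \<star> ?i ?Lc') = inv2 D (\<chi> c d h) \<star> ?i ?Lc'"
    using D.iso2_whisker(3,4)[OF i\<chi>, of ?Lc'] by simp_all
  have iV: "V \<in> iso2 D (d' \<cdot> ((e Y' \<cdot> on_mor L h') \<cdot> ?Lc')) (d' \<cdot> ((d \<cdot> (k \<cdot> ?Lc)) \<cdot> ?Lc'))"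
    "inv2 D V = ?i d' \<star> (inv2 D (\<chi> c d h) \<star> ?i ?Lc')"
    using D.iso2_whisker(1,2)[OF iw(1), of d'] iw(2) by (simp_all add: V_def)
  have "inv2 D (V \<bullet> U) = inv2 D U \<bullet> inv2 D V"
    using D.iso2_vcomp(2)[OF _ iV(1)] triangle_cell(15)[OF tU] by (simp add: U_def)
  then show ?thesis using inv unfolding iV(2) U_def by simp
qed

definition \<Phi> :: "'o \<times> 'p \<Rightarrow> ('m, 't, 'n, 's) fctr" where
  "\<Phi> = (\<lambda>(X, Y). \<lparr>fob = (\<lambda>h. e Y \<cdot> on_mor L h), farr = (\<lambda>\<theta>. id2 D (e Y) \<star> on_two L \<theta>)\<rparr>)"

lemma \<Phi>_simps: "fob (\<Phi> (X, Y)) h = e Y \<cdot> on_mor L h" "farr (\<Phi> (X, Y)) \<theta> = id2 D (e Y) \<star> on_two L \<theta>"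
  by (simp_all add: \<Phi>_def)

lemma \<Phi>_functor:
  assumes X: "X \<in> Ob C" and Y: "Y \<in> Ob D"
  shows "is_functor (hom_cat C X (R_ob Y)) (hom_cat D (on_ob L X) Y) (\<Phi> (X, Y))"
  unfolding is_functor_def hom_cat_simps \<Phi>_simps
proof (intro conjI ballI)
  fix h assume h: "h \<in> hom1 C X (R_ob Y)"
  show "e Y \<cdot> on_mor L h \<in> hom1 D (on_ob L X) Y" "id2 D (e Y) \<star> on_two L (id2 C h) = id2 D (e Y \<cdot> on_mor L h)"
    using h Y by (simp_all add: hom1_iff)
next
  fix f g \<theta> assume f: "f \<in> hom1 C X (R_ob Y)" and g: "g \<in> hom1 C X (R_ob Y)" and "\<theta> \<in> Homs (hom_cat C X (R_ob Y)) f g"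
  then have th: "\<theta> \<in> hom2 C f g" using C.Homs_hom_cat by blast
  have "e Y \<cdot> on_mor L f \<in> hom1 D (on_ob L X) Y" "e Y \<cdot> on_mor L g \<in> hom1 D (on_ob L X) Y"
    using f g Y by (simp_all add: hom1_iff)
  moreover have "id2 D (e Y) \<star> on_two L \<theta> \<in> hom2 D (e Y \<cdot> on_mor L f) (e Y \<cdot> on_mor L g)"
    using f g th Y by (simp add: hom1_iff hom2_iff)
  ultimately show "id2 D (e Y) \<star> on_two L \<theta> \<in> Homs (hom_cat D (on_ob L X) Y) (e Y \<cdot> on_mor L f) (e Y \<cdot> on_mor L g)"
    using D.Homs_hom_cat by blast
next
  fix f g h \<theta> \<theta>' assume f: "f \<in> hom1 C X (R_ob Y)" and g: "g \<in> hom1 C X (R_ob Y)" and h: "h \<in> hom1 C X (R_ob Y)"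
    and "\<theta> \<in> Homs (hom_cat C X (R_ob Y)) f g" "\<theta>' \<in> Homs (hom_cat C X (R_ob Y)) g h"
  then have th: "\<theta> \<in> hom2 C f g" "\<theta>' \<in> hom2 C g h" using C.Homs_hom_cat by blast+
  show "id2 D (e Y) \<star> on_two L (\<theta>' \<bullet>\<^bsub>C\<^esub> \<theta>) = (id2 D (e Y) \<star> on_two L \<theta>') \<bullet> (id2 D (e Y) \<star> on_two L \<theta>)"
    using f g h th Y by (simp add: hom1_iff hom2_iff D.whisker_vcomp)
qed

lemma \<Phi>_adjoint_equivalence:
  assumes X: "X \<in> Ob C" and Y: "Y \<in> Ob D"
  shows "\<exists>\<Psi> \<eta> \<epsilon>. adjoint_equivalence (hom_cat C X (R_ob Y)) (hom_cat D (on_ob L X) Y) (\<Phi> (X, Y)) \<Psi> \<eta> \<epsilon>"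
proof (rule fully_faithful_eso_imp_adjoint_equivalence)
  show "category (hom_cat C X (R_ob Y))" using X Y by (simp add: C.hom_category)
  show "category (hom_cat D (on_ob L X) Y)" using X Y by (simp add: D.hom_category)
  show "is_functor (hom_cat C X (R_ob Y)) (hom_cat D (on_ob L X) Y) (\<Phi> (X, Y))" by (rule \<Phi>_functor[OF X Y])
  have ob: "e Y \<cdot> on_mor L c \<in> hom1 D (on_ob L X) Y" if "c \<in> hom1 C X (R_ob Y)" for c
    using that Y by (simp add: hom1_iff)
  note u = couniv[OF Y, unfolded couniversal_def]
  fix c d \<alpha> assume "c \<in> Obj (hom_cat C X (R_ob Y))" "d \<in> Obj (hom_cat C X (R_ob Y))"
    and a: "\<alpha> \<in> Homs (hom_cat D (on_ob L X) Y) (fob (\<Phi> (X, Y)) c) (fob (\<Phi> (X, Y)) d)"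
  then have cd: "c \<in> hom1 C X (R_ob Y)" "d \<in> hom1 C X (R_ob Y)" by (simp_all add: hom_cat_simps)
  have "\<alpha> \<in> hom2 D (e Y \<cdot> on_mor L c) (e Y \<cdot> on_mor L d)"
    using a D.Homs_hom_cat[OF ob[OF cd(1)] ob[OF cd(2)]] by (simp add: \<Phi>_simps)
  then show "\<exists>!\<gamma>. \<gamma> \<in> Homs (hom_cat C X (R_ob Y)) c d \<and> farr (\<Phi> (X, Y)) \<gamma> = \<alpha>"
    unfolding C.Homs_hom_cat[OF cd] \<Phi>_simps using u X cd by blast
next
  fix f assume "f \<in> Obj (hom_cat D (on_ob L X) Y)"
  then have f: "f \<in> hom1 D (on_ob L X) Y" by (simp add: hom_cat_simps)
  obtain c \<psi> where c: "c \<in> hom1 C X (R_ob Y)" and p: "\<psi> \<in> iso2 D (e Y \<cdot> on_mor L c) f"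
    using couniv[OF Y] f X unfolding couniversal_def by blast
  have "e Y \<cdot> on_mor L c \<in> hom1 D (on_ob L X) Y" using c Y by (simp add: hom1_iff)
  then show "\<exists>c\<in>Obj (hom_cat C X (R_ob Y)). \<exists>i\<in>Homs (hom_cat D (on_ob L X) Y) (fob (\<Phi> (X, Y)) c) f.
      iso_arr (hom_cat D (on_ob L X) Y) i"
    unfolding hom_cat_simps \<Phi>_simps using D.iso_arr_hom_cat f c p by blast
qed

definition \<phi> :: "'m \<times> 'n \<Rightarrow> 'm \<Rightarrow> 's" where
  "\<phi> = (\<lambda>(c, d) h. inv2 D (\<chi> c d h))"

lemma \<phi>_natural:
  assumes c: "c \<in> hom1 C X' X" and h: "h \<in> hom1 C X (R_ob Y)" and d: "d \<in> hom1 D Y Y'"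
    and ga: "\<gamma> \<in> hom2 C c c'" and th: "\<theta> \<in> hom2 C h h'" and de: "\<delta> \<in> hom2 D d d'"
  shows "\<phi> (c', d') h' \<bullet> (\<delta> \<star> ((id2 D (e Y) \<star> on_two L \<theta>) \<star> on_two L \<gamma>))
    = (id2 D (e Y') \<star> on_two L (R_two \<delta> \<star>\<^bsub>C\<^esub> (\<theta> \<star>\<^bsub>C\<^esub> \<gamma>))) \<bullet> \<phi> (c, d) h"
proof -
  have Y: "Y \<in> Ob D" "Y' \<in> Ob D" using d by (auto simp: hom1_iff)
  have c': "c' \<in> hom1 C X' X" using c ga C.cod2_Mor[of \<gamma>] C.cod2_boundary[of \<gamma>] by (auto simp: hom1_iff hom2_iff)
  have h': "h' \<in> hom1 C X (R_ob Y)" using h th C.cod2_Mor[of \<theta>] C.cod2_boundary[of \<theta>] by (auto simp: hom1_iff hom2_iff)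
  note d' = whiskered_e(1)[OF d de]
  note [simp] = Y c[unfolded hom1_iff] c'[unfolded hom1_iff] h[unfolded hom1_iff] h'[unfolded hom1_iff]
    d[unfolded hom1_iff] d'[unfolded hom1_iff] ga[unfolded hom2_iff] th[unfolded hom2_iff] de[unfolded hom2_iff]
    R_two_square(1)[OF d de, unfolded hom2_iff]
  show ?thesis
    unfolding \<phi>_def prod.case
    by (rule over_square_inv[OF \<chi>_triangle[OF c h d] \<chi>_triangle[OF c' h' d'] _ _ _ \<chi>_square[OF c h d ga th de]])
      (simp_all add: hom2_iff)
qed

theorem bi_adjunction:
  "\<exists>\<Psi> \<eta> \<epsilon>. bi_adjunction C D L R \<Phi> \<phi> \<Psi> \<eta> \<epsilon>"
proof -
  let ?A = "prod2 (op2 C) D" and ?F = "hom_right C R" and ?G = "hom_left D L"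
  have Fun: "is_functor (cob ?F p) (cob ?G p) (\<Phi> p)" if "p \<in> Ob ?A" for p
    using that \<Phi>_functor by (cases p) (simp add: hom_left_simps hom_right_simps prod2_simps)
  have nat: "is_nat_iso (cob ?F p) (cob ?G q) (comp_fctr (cmor ?G a) (\<Phi> p)) (comp_fctr (\<Phi> q) (cmor ?F a)) (\<phi> a)"
    if "p \<in> Ob ?A" "q \<in> Ob ?A" "a \<in> hom1 ?A p q" for p q a
  proof -
    obtain X Y where [simp]: "p = (X, Y)" by (cases p)
    obtain X' Y' where [simp]: "q = (X', Y')" by (cases q)
    obtain c d where [simp]: "a = (c, d)" by (cases a)
    have ob: "X \<in> Ob C" "Y \<in> Ob D" "X' \<in> Ob C" "Y' \<in> Ob D" using that by (simp_all add: prod2_simps)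
    have c: "c \<in> hom1 C X' X" and d: "d \<in> hom1 D Y Y'" using that(3) by (simp_all add: prod2_simps)
    have Rd: "R_mor d \<in> hom1 C (R_ob Y) (R_ob Y')" and Lc: "on_mor L c \<in> hom1 D (on_ob L X') (on_ob L X)"
      using c d by (simp_all add: hom1_iff)
    have "is_functor (hom_cat C X (R_ob Y)) (hom_cat C X' (R_ob Y')) (cmor ?F a)"
      using C.whisker_functor[OF c Rd] by (simp add: hom_right_def)
    then have f1: "is_functor (cob ?F p) (cob ?G q) (comp_fctr (\<Phi> q) (cmor ?F a))"
      using is_functor_comp[OF _ Fun[OF that(2)]] by (simp add: hom_right_simps)
    have "is_functor (hom_cat D (on_ob L X) Y) (hom_cat D (on_ob L X') Y') (cmor ?G a)"
      using D.whisker_functor[OF Lc d] by (simp add: hom_left_def)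
    then have f2: "is_functor (cob ?F p) (cob ?G q) (comp_fctr (cmor ?G a) (\<Phi> p))"
      using is_functor_comp[OF Fun[OF that(1)]] by (simp add: hom_left_simps)
    have "\<phi> a h \<in> Homs (cob ?G q) (fob (comp_fctr (cmor ?G a) (\<Phi> p)) h) (fob (comp_fctr (\<Phi> q) (cmor ?F a)) h) \<and>
        iso_arr (cob ?G q) (\<phi> a h)" if h: "h \<in> Obj (cob ?F p)" for h
    proof -
      have h: "h \<in> hom1 C X (R_ob Y)" using h by (simp add: hom_right_simps hom_cat_simps)
      let ?k = "d \<cdot> ((e Y \<cdot> on_mor L h) \<cdot> on_mor L c)" and ?l = "e Y' \<cdot> on_mor L (R_mor d \<cdot>\<^bsub>C\<^esub> (h \<cdot>\<^bsub>C\<^esub> c))"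
      have "?k \<in> hom1 D (on_ob L X') Y'" "?l \<in> hom1 D (on_ob L X') Y'"
        using c d h ob by (simp_all add: hom1_iff)
      moreover have "\<phi> (c, d) h \<in> iso2 D ?k ?l"
        unfolding \<phi>_def prod.case by (rule D.inv2_iso2[OF triangle_cell(15)[OF \<chi>_triangle[OF c h d]]])
      ultimately show ?thesis
        using D.iso_arr_hom_cat[of ?k "on_ob L X'" Y' ?l]
        by (simp add: comp_fctr_def hom_left_simps hom_right_simps \<Phi>_simps)
    qed
    moreover have "\<phi> a h' \<odot>\<^bsub>cob ?G q\<^esub> farr (comp_fctr (cmor ?G a) (\<Phi> p)) \<theta>
        = farr (comp_fctr (\<Phi> q) (cmor ?F a)) \<theta> \<odot>\<^bsub>cob ?G q\<^esub> \<phi> a h"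
      if "h \<in> Obj (cob ?F p)" "h' \<in> Obj (cob ?F p)" "\<theta> \<in> Homs (cob ?F p) h h'" for h h' \<theta>
    proof -
      have h: "h \<in> hom1 C X (R_ob Y)" "h' \<in> hom1 C X (R_ob Y)" using that by (simp_all add: hom_right_simps hom_cat_simps)
      have th: "\<theta> \<in> hom2 C h h'" using that(3) C.Homs_hom_cat[OF h] by (simp add: hom_right_simps)
      have i: "id2 C c \<in> hom2 C c c" "id2 D d \<in> hom2 D d d" using c d by (simp_all add: hom1_iff hom2_iff)
      have "R_two (id2 D d) = id2 C (R_mor d)"
        using is_functorD(3)[OF R_hom_functor[OF ob(2,4)], of d] d by (simp add: hom_cat_simps)
      then show ?thesis
        using \<phi>_natural[OF c h(1) d i(1) th i(2)] c
        by (simp add: comp_fctr_def hom_left_simps hom_right_simps \<Phi>_simps hom_cat_simps hom1_iff)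
    qed
    ultimately show ?thesis unfolding is_nat_iso_def using f1 f2 by blast
  qed
  have two: "\<phi> b h \<odot>\<^bsub>cob ?G q\<^esub> ctwo ?G \<alpha> (fob (\<Phi> p) h) = farr (\<Phi> q) (ctwo ?F \<alpha> h) \<odot>\<^bsub>cob ?G q\<^esub> \<phi> a h"
    if "p \<in> Ob ?A" "q \<in> Ob ?A" "a \<in> hom1 ?A p q" "\<alpha> \<in> hom2 ?A a b" "h \<in> Obj (cob ?F p)" for p q a b \<alpha> h
  proof -
    obtain X Y where [simp]: "p = (X, Y)" by (cases p)
    obtain X' Y' where [simp]: "q = (X', Y')" by (cases q)
    obtain c d where [simp]: "a = (c, d)" by (cases a)
    obtain c' d' where [simp]: "b = (c', d')" by (cases b)
    obtain \<gamma> \<delta> where [simp]: "\<alpha> = (\<gamma>, \<delta>)" by (cases \<alpha>)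
    have c: "c \<in> hom1 C X' X" and d: "d \<in> hom1 D Y Y'" using that(3) by (simp_all add: prod2_simps)
    have ga: "\<gamma> \<in> hom2 C c c'" and de: "\<delta> \<in> hom2 D d d'" using that(4) by (simp_all add: prod2_simps)
    have h: "h \<in> hom1 C X (R_ob Y)" using that(5) by (simp add: hom_right_simps hom_cat_simps)
    have i: "id2 C h \<in> hom2 C h h" using h by (simp add: hom1_iff hom2_iff)
    have Y: "Y \<in> Ob D" using d by (auto simp: hom1_iff)
    show ?thesis
      using \<phi>_natural[OF c h d ga i de] h Y
      by (simp add: hom_left_simps hom_right_simps \<Phi>_simps hom_cat_simps hom1_iff)
  qed
  have comp: "\<phi> (a' \<cdot>\<^bsub>?A\<^esub> a) h \<odot>\<^bsub>cob ?G r\<^esub> ccmpr ?G a a' (fob (\<Phi> p) h)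
      = farr (\<Phi> r) (ccmpr ?F a a' h) \<odot>\<^bsub>cob ?G r\<^esub>
          (\<phi> a' (fob (cmor ?F a) h) \<odot>\<^bsub>cob ?G r\<^esub> farr (cmor ?G a') (\<phi> a h))"
    if "a \<in> hom1 ?A p q" "a' \<in> hom1 ?A q r" "h \<in> Obj (cob ?F p)" for p q r a a' h
  proof -
    obtain X Y where [simp]: "p = (X, Y)" by (cases p)
    obtain X' Y' where [simp]: "q = (X', Y')" by (cases q)
    obtain X'' Y'' where [simp]: "r = (X'', Y'')" by (cases r)
    obtain c d where [simp]: "a = (c, d)" by (cases a)
    obtain c' d' where [simp]: "a' = (c', d')" by (cases a')
    have c: "c \<in> hom1 C X' X" "c' \<in> hom1 C X'' X'" and d: "d \<in> hom1 D Y Y'" "d' \<in> hom1 D Y' Y''"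
      using that(1,2) by (simp_all add: prod2_simps)
    have h: "h \<in> hom1 C X (R_ob Y)" using that(3) by (simp add: hom_right_simps hom_cat_simps)
    show ?thesis
      using \<chi>_comp[OF c h d]
      by (simp add: hom_left_simps hom_right_simps \<Phi>_simps hom_cat_simps prod2_simps \<phi>_def)
  qed
  have unit: "\<phi> (id1 ?A p) h = Idn (cob ?G p) (fob (\<Phi> p) h)" if "p \<in> Ob ?A" "h \<in> Obj (cob ?F p)" for p h
  proof -
    obtain X Y where [simp]: "p = (X, Y)" by (cases p)
    have X: "X \<in> Ob C" and Y: "Y \<in> Ob D" using that by (simp_all add: prod2_simps)
    have h: "h \<in> hom1 C X (R_ob Y)" using that(2) by (simp add: hom_right_simps hom_cat_simps)
    have i: "id1 C X \<in> hom1 C X X" using X by (simp add: hom1_iff)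
    note [simp] = X Y h[unfolded hom1_iff]
    note t = \<kappa>_triangles[OF i h Y]
    have "\<kappa> Y (id1 C X) h = id2 D (e Y \<cdot> on_mor L h)"
      using paste_id(1)[OF t(2)] by (simp add: \<kappa>_def)
    then have "\<chi> (id1 C X) (id1 D Y) h = id2 D (e Y \<cdot> on_mor L h)"
      using paste_id(2)[OF t(2)] by (simp add: \<chi>_def lift_id)
    then show ?thesis by (simp add: prod2_simps \<phi>_def hom_left_simps hom_cat_simps \<Phi>_simps)
  qed
  have psn: "pseudo_natural ?A ?F ?G \<Phi> \<phi>"
    unfolding pseudo_natural_def
    by (intro conjI ballI;
      (rule Fun, assumption | rule nat, assumption+ | rule two, assumption+ | rule comp, assumption+ | rule unit, assumption+))
  have "\<forall>p \<in> Ob C \<times> Ob D. \<exists>t. case t of (\<Psi>, \<eta>, \<epsilon>) \<Rightarrow>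
      adjoint_equivalence (hom_cat C (fst p) (R_ob (snd p))) (hom_cat D (on_ob L (fst p)) (snd p)) (\<Phi> p) \<Psi> \<eta> \<epsilon>"
    using \<Phi>_adjoint_equivalence by (auto simp: split_paired_Ex)
  from bchoice[OF this] obtain T where T: "\<forall>p \<in> Ob C \<times> Ob D. case T p of (\<Psi>, \<eta>, \<epsilon>) \<Rightarrow>
      adjoint_equivalence (hom_cat C (fst p) (R_ob (snd p))) (hom_cat D (on_ob L (fst p)) (snd p)) (\<Phi> p) \<Psi> \<eta> \<epsilon>" ..
  have "bi_adjunction C D L R \<Phi> \<phi> (\<lambda>p. fst (T p)) (\<lambda>p. fst (snd (T p))) (\<lambda>p. snd (snd (T p)))"
    unfolding bi_adjunction_def
  proof (intro conjI ballI psn R_pseudo_functor)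
    show "normal_pseudo_functor C D L" by (rule normal_pseudo_functor_axioms)
    fix X Y assume "X \<in> Ob C" "Y \<in> Ob D"
    then show "adjoint_equivalence (hom_cat C X (on_ob R Y)) (hom_cat D (on_ob L X) Y) (\<Phi> (X, Y))
        (fst (T (X, Y))) (fst (snd (T (X, Y)))) (snd (snd (T (X, Y))))"
      using T[THEN bspec, of "(X, Y)"] by (simp add: case_prod_beta)
  qed
  then show ?thesis by blast
qed

end

section \<open>The equivalence of the four conditions\<close>

theorem (in pseudo_functor) right_bi_adjoint_iff_couniversal:
  "(\<exists>R. right_bi_adjoint C D L R) \<longleftrightarrow> (\<forall>Y \<in> Ob D. \<exists>R e. couniversal Y R e)"
proof
  assume "\<exists>R. right_bi_adjoint C D L R"
  then obtain R \<Phi> \<phi> \<Psi> \<eta> \<epsilon> where "bi_adjunction C D L R \<Phi> \<phi> \<Psi> \<eta> \<epsilon>" by (auto simp: right_bi_adjoint_def)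
  then show "\<forall>Y \<in> Ob D. \<exists>R e. couniversal Y R e" using bi_adjunction_imp_couniversal by blast
next
  assume "\<forall>Y \<in> Ob D. \<exists>R e. couniversal Y R e"
  then obtain R_ob e where "\<And>Y. Y \<in> Ob D \<Longrightarrow> couniversal Y (R_ob Y) (e Y)" by metis
  then interpret couniversal_family C D L R_ob e
    by (intro couniversal_family.intro pseudo_functor_axioms couniversal_family_axioms.intro)
  obtain \<Psi> \<eta> \<epsilon> where "bi_adjunction C D L R \<Phi> \<phi> \<Psi> \<eta> \<epsilon>" using bi_adjunction by blast
  then have "right_bi_adjoint C D L R" unfolding right_bi_adjoint_def by (intro exI)
  then show "\<exists>R. right_bi_adjoint C D L R" ..
qed

theorem theorem7p12:
  fixes C :: "('o, 'm, 't) two_cat" and D :: "('p, 'n, 's) two_cat"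
    and L :: "('o, 'm, 't, 'p, 'n, 's) psf"
  assumes "two_category C" and "two_category D" and "normal_pseudo_functor C D L"
  shows "let
      i = (\<exists>R. right_bi_adjoint C D L R);
      ii = (\<forall>Y \<in> Ob D. \<exists>RY \<in> Ob C. \<exists>\<epsilon> \<in> hom1 D (on_ob L RY) Y.
             double_bi_terminal (dbl_slice_over C D L Y) (RY, \<epsilon>));
      iii = (\<forall>Y \<in> Ob D. \<exists>RY \<in> Ob C. \<exists>\<epsilon> \<in> hom1 D (on_ob L RY) Y.
              bi_terminal (slice_over C D L Y) (RY, \<epsilon>) \<and>
              bi_terminal (slice_over (Ar C) (Ar D) (Ar_psf C D L) Y) (RY, id2 D \<epsilon>));
      iv = (\<forall>Y \<in> Ob D. \<exists>RY \<in> Ob C. \<exists>\<epsilon> \<in> hom1 D (on_ob L RY) Y.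
             bi_terminal (slice_over (Ar C) (Ar D) (Ar_psf C D L) Y) (RY, id2 D \<epsilon>))
    in (i \<longleftrightarrow> ii) \<and> (ii \<longleftrightarrow> iii) \<and> (iii \<longleftrightarrow> iv)"
proof -
  interpret pseudo_functor C D L by (intro pseudo_functor.intro assms)
  have cond: "(\<forall>Y \<in> Ob D. \<exists>RY \<in> Ob C. \<exists>\<epsilon> \<in> hom1 D (on_ob L RY) Y. P Y RY \<epsilon>) \<longleftrightarrow> (\<exists>R. right_bi_adjoint C D L R)"
    if P: "\<And>Y R e. R \<in> Ob C \<Longrightarrow> e \<in> hom1 D (on_ob L R) Y \<Longrightarrow> P Y R e \<longleftrightarrow> couniversal Y R e" for P
    unfolding right_bi_adjoint_iff_couniversal
  proof (intro ball_cong refl iffI)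
    fix Y assume "\<exists>RY \<in> Ob C. \<exists>\<epsilon> \<in> hom1 D (on_ob L RY) Y. P Y RY \<epsilon>"
    then show "\<exists>R e. couniversal Y R e" using P by blast
  next
    fix Y assume "\<exists>R e. couniversal Y R e"
    then obtain R e where u: "couniversal Y R e" by blast
    then have "R \<in> Ob C" "e \<in> hom1 D (on_ob L R) Y" by (simp_all add: couniversal_def)
    then show "\<exists>RY \<in> Ob C. \<exists>\<epsilon> \<in> hom1 D (on_ob L RY) Y. P Y RY \<epsilon>" using P u by blast
  qed
  have ii: "(\<forall>Y \<in> Ob D. \<exists>RY \<in> Ob C. \<exists>\<epsilon> \<in> hom1 D (on_ob L RY) Y.
      double_bi_terminal (dbl_slice_over C D L Y) (RY, \<epsilon>)) \<longleftrightarrow> (\<exists>R. right_bi_adjoint C D L R)"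
    by (rule cond) (rule double_bi_terminal_slice_iff)
  have iii: "(\<forall>Y \<in> Ob D. \<exists>RY \<in> Ob C. \<exists>\<epsilon> \<in> hom1 D (on_ob L RY) Y.
      bi_terminal (slice_over C D L Y) (RY, \<epsilon>) \<and>
      bi_terminal (slice_over (Ar C) (Ar D) (Ar_psf C D L) Y) (RY, id2 D \<epsilon>)) \<longleftrightarrow> (\<exists>R. right_bi_adjoint C D L R)"
    by (rule cond) (auto simp: bi_terminal_Ar_slice_iff couniversal_imp_bi_terminal_slice)
  have iv: "(\<forall>Y \<in> Ob D. \<exists>RY \<in> Ob C. \<exists>\<epsilon> \<in> hom1 D (on_ob L RY) Y.
      bi_terminal (slice_over (Ar C) (Ar D) (Ar_psf C D L) Y) (RY, id2 D \<epsilon>)) \<longleftrightarrow> (\<exists>R. right_bi_adjoint C D L R)"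
    by (rule cond) (rule bi_terminal_Ar_slice_iff)
  show ?thesis unfolding Let_def ii iii iv by simp
qed

end
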